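(* Let $\Bbbk$ be an algebraically closed field of any characteristic. Let $X\subset\mathbb{P}^{n+e}_{\Bbbk}$ be a nondegenerate integral variety of dimension $n$ satisfying property $\mathbf{N}_{d,2}$ for some $d\ge2$. For the linear projection $\pi_q:X\to\pi_q(X)\subset\mathbb{P}^{n+e-1}$ from a point $q\in(\operatorname{Sec}(X)\cup\operatorname{Tan}(X))\setminus X$, consider the $d$-secant locus $$\Sigma_d(X):=\{x\in X\mid \pi_q^{-1}(\pi_q(x))\text{ has length }d\}$$ and $Z_d:=\pi_q(\Sigma_d(X))$. Then: (a) $\Sigma_d(X)$ is either empty or a hypersurface $F$ of degree $d$ in the linear span $\langle F,q\rangle$; (b) $Z_d=\pi_q(\Sigma_d(X))$ is either empty or a linear subspace contained in $\pi_q(X)$, parametrizing the locus of $d$-secant lines to $X$ through $q$; (c) If $q\in\operatorname{Sec}(X)\setminus(\operatorname{Tan}(X)\cup X)$ and $Z_d\ne\emptyset$, then there is a unique $d$-secant line to $X$ through $q$.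
   Context: Let $R=\Bbbk[x_0,\dots,x_{n+e}]$ and $I_X=\bigoplus_{m\ge0}H^0(\mathcal{I}_{X/\mathbb{P}^{n+e}}(m))\subset R$. $X$ satisfies property $\mathbf{N}_{d,p}$ ($d\ge2$, $p\ge1$) if $\beta_{i,j}(X):=\dim_{\Bbbk}\operatorname{Tor}^R_i(R/I_X,\Bbbk)_{i+j}=0$ for all $i\le p$ and all $j\ge d$. Nondegenerate means not contained in a hyperplane. $\operatorname{Sec}(X)$ and $\operatorname{Tan}(X)$ denote the secant (line) variety and the tangent variety of $X$ in $\mathbb{P}^{n+e}$. Fibers of $\pi_q$ are taken scheme-theoretically: for $y\in\pi_q(X)$, $\pi_q^{-1}(y)$ is the intersection of $X$ with the line through $q$ corresponding to $y$; a $d$-secant line through $q$ is a line through $q$ whose scheme-theoretic intersection with $X$ has length $d$. $\langle F,q\rangle$ denotes the smallest linear subspace containing $F$ and $q$.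
   Formalization: In (c), "Sec(X) \ (Tan(X) ∩ X)" is corrected to "Sec(X) \ (Tan(X) ∪ X)": as q is never in X, the literal version excludes nothing and fails for a smooth plane conic with d = 2. In (a), F carries the scheme structure X ∩ ⟨F,q⟩. *)

theory Defs
  imports
    "HOL-Library.Poly_Mapping"
    "HOL-Library.Function_Algebras"
    "HOL-Computational_Algebra.Polynomial"
begin

section \<open>The graded polynomial ring\<close>

text \<open>
  A polynomial is a finitely supported map from exponent vectors to coefficients. The ring
  \<open>k[x\<^sub>0,\<dots>,x\<^sub>N]\<close> is the subset \<open>polys N\<close> of polynomials that use only the variables with index at
  most \<open>N\<close>.
\<close>

type_synonym 'k mpoly = "(nat \<Rightarrow>\<^sub>0 nat) \<Rightarrow>\<^sub>0 'k"

definition mon_deg :: "(nat \<Rightarrow>\<^sub>0 nat) \<Rightarrow> nat" where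
  "mon_deg t = (\<Sum>i\<in>Poly_Mapping.keys t. Poly_Mapping.lookup t i)"

definition polys :: "nat \<Rightarrow> ('k::field) mpoly set" where
  "polys N = {f. \<forall>t\<in>Poly_Mapping.keys f. Poly_Mapping.keys t \<subseteq> {..N}}"

text \<open>The zero polynomial is a form of every degree.\<close>

definition is_form :: "nat \<Rightarrow> nat \<Rightarrow> ('k::field) mpoly \<Rightarrow> bool" where
  "is_form N m f \<longleftrightarrow> f \<in> polys N \<and> (\<forall>t\<in>Poly_Mapping.keys f. mon_deg t = m)"

definition hom_comp :: "nat \<Rightarrow> ('k::field) mpoly \<Rightarrow> 'k mpoly" where
  "hom_comp m f =
     (\<Sum>t\<in>{t \<in> Poly_Mapping.keys f. mon_deg t = m}. Poly_Mapping.single t (Poly_Mapping.lookup f t))"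

definition peval :: "('k::field) mpoly \<Rightarrow> (nat \<Rightarrow> 'k) \<Rightarrow> 'k" where
  "peval f v = (\<Sum>t\<in>Poly_Mapping.keys f. Poly_Mapping.lookup f t *
                  (\<Prod>i\<in>Poly_Mapping.keys t. v i ^ Poly_Mapping.lookup t i))"

text \<open>
  If \<open>x\<^sub>i\<close> does not occur in the monomial \<open>t\<close>, the subtraction below truncates, but the
  coefficient is then zero.
\<close>

definition part_deriv :: "nat \<Rightarrow> ('k::field) mpoly \<Rightarrow> 'k mpoly" where
  "part_deriv i f = (\<Sum>t\<in>Poly_Mapping.keys f.
     Poly_Mapping.single (t - Poly_Mapping.single i 1)
       (of_nat (Poly_Mapping.lookup t i) * Poly_Mapping.lookup f t))"

definition pscale :: "'k::field \<Rightarrow> 'k mpoly \<Rightarrow> 'k mpoly" where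
  "pscale c f = Poly_Mapping.single 0 c * f"

definition ideal_sum :: "('k::field) mpoly set \<Rightarrow> 'k mpoly set \<Rightarrow> 'k mpoly set" where
  "ideal_sum I J = {f + g | f g. f \<in> I \<and> g \<in> J}"

definition principal :: "nat \<Rightarrow> ('k::field) mpoly \<Rightarrow> 'k mpoly set" where
  "principal N g = {g * h | h. h \<in> polys N}"

text \<open>
  Saturation with respect to the irrelevant ideal: two homogeneous ideals define the same closed
  subscheme of \<open>\<bbbP>\<^sup>N\<close> iff their saturations agree.
\<close>

definition saturation :: "nat \<Rightarrow> ('k::field) mpoly set \<Rightarrow> 'k mpoly set" where
  "saturation N J = {f \<in> polys N. \<exists>m. \<forall>g. is_form N m g \<longrightarrow> g * f \<in> J}"


section \<open>Vectors and dimensions of quotients\<close>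

definition vscale :: "'k::field \<Rightarrow> (nat \<Rightarrow> 'k) \<Rightarrow> (nat \<Rightarrow> 'k)" where
  "vscale c v = (\<lambda>i. c * v i)"

global_interpretation kv: vector_space "vscale :: 'k::field \<Rightarrow> (nat \<Rightarrow> 'k) \<Rightarrow> (nat \<Rightarrow> 'k)"
  by unfold_locales (auto simp: vscale_def fun_eq_iff algebra_simps)

text \<open>The coordinate space \<open>k\<^bsup>N+1\<^esup>\<close>.\<close>

definition kvec :: "nat \<Rightarrow> (nat \<Rightarrow> 'k::field) set" where
  "kvec N = {v. \<forall>i>N. v i = 0}"

text \<open>
  \<open>quot_dim s U W d\<close>: the quotient \<open>U/W\<close> of vector spaces has dimension \<open>d\<close>, i.e. there are
  \<open>b\<^sub>0,\<dots>,b\<^bsub>d-1\<^esub> \<in> U\<close> such that every element of \<open>U\<close> is congruent modulo \<open>W\<close> to a unique linear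
  combination of them.
\<close>

definition quot_dim :: "('k::field \<Rightarrow> 'v::ab_group_add \<Rightarrow> 'v) \<Rightarrow> 'v set \<Rightarrow> 'v set \<Rightarrow> nat \<Rightarrow> bool" where
  "quot_dim s U W d \<longleftrightarrow>
     (\<exists>b :: nat \<Rightarrow> 'v. (\<forall>i<d. b i \<in> U) \<and>
        (\<forall>u\<in>U. \<exists>!c. (\<forall>i\<ge>d. c i = 0) \<and> u - (\<Sum>i<d. s (c i) (b i)) \<in> W))"


section \<open>Projective space\<close>

text \<open>A point of \<open>\<bbbP>\<^sup>N\<close> is the set of all its vectors of homogeneous coordinates.\<close>

type_synonym 'k ppoint = "(nat \<Rightarrow> 'k) set"

definition proj_of :: "(nat \<Rightarrow> 'k::field) set \<Rightarrow> 'k ppoint set" where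
  "proj_of W = {{vscale c v | c. c \<noteq> 0} | v. v \<in> W \<and> v \<noteq> (\<lambda>_. 0)}"

abbreviation PN :: "nat \<Rightarrow> ('k::field) ppoint set" where
  "PN N \<equiv> proj_of (kvec N)"

definition zero_locus :: "nat \<Rightarrow> ('k::field) mpoly set \<Rightarrow> 'k ppoint set" where
  "zero_locus N S = {p \<in> PN N. \<forall>f\<in>S. \<forall>v\<in>p. peval f v = 0}"

definition zclosed :: "nat \<Rightarrow> ('k::field) ppoint set \<Rightarrow> bool" where
  "zclosed N Y \<longleftrightarrow> (\<exists>S. (\<forall>f\<in>S. \<exists>m. is_form N m f) \<and> Y = zero_locus N S)"

definition zclosure :: "nat \<Rightarrow> ('k::field) ppoint set \<Rightarrow> 'k ppoint set" where
  "zclosure N A = \<Inter> {Y. zclosed N Y \<and> A \<subseteq> Y}"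

definition irreducible_closed :: "nat \<Rightarrow> ('k::field) ppoint set \<Rightarrow> bool" where
  "irreducible_closed N Y \<longleftrightarrow> zclosed N Y \<and> Y \<noteq> {} \<and>
     (\<forall>A B. zclosed N A \<and> zclosed N B \<and> Y = A \<union> B \<longrightarrow> Y = A \<or> Y = B)"

definition closed_chain :: "nat \<Rightarrow> ('k::field) ppoint set \<Rightarrow> nat \<Rightarrow> (nat \<Rightarrow> 'k ppoint set) \<Rightarrow> bool" where
  "closed_chain N X n C \<longleftrightarrow>
     (\<forall>i\<le>n. irreducible_closed N (C i) \<and> C i \<subseteq> X) \<and> (\<forall>i<n. C i \<subset> C (Suc i))"

definition has_dim :: "nat \<Rightarrow> ('k::field) ppoint set \<Rightarrow> nat \<Rightarrow> bool" where
  "has_dim N X n \<longleftrightarrow> (\<exists>C. closed_chain N X n C) \<and> \<not> (\<exists>C. closed_chain N X (Suc n) C)"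

definition nondegenerate :: "nat \<Rightarrow> ('k::field) ppoint set \<Rightarrow> bool" where
  "nondegenerate N X \<longleftrightarrow> \<not> (\<exists>h. is_form N 1 h \<and> h \<noteq> 0 \<and> X \<subseteq> zero_locus N {h})"

text \<open>
  The homogeneous ideal of a reduced closed subset: the direct sum over \<open>m\<close> of the forms of degree
  \<open>m\<close> that vanish on it. An integral variety over an algebraically closed field is identified with
  its set of closed points, so this is \<open>I\<^sub>X = \<Oplus>\<^sub>m H\<^sup>0(\<I>\<^sub>X(m))\<close>.
\<close>

definition hideal :: "nat \<Rightarrow> ('k::field) ppoint set \<Rightarrow> 'k mpoly set" where
  "hideal N Y = {f \<in> polys N. \<forall>m. \<forall>p\<in>Y. \<forall>v\<in>p. peval (hom_comp m f) v = 0}"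

definition lin_subspace :: "nat \<Rightarrow> ('k::field) ppoint set \<Rightarrow> bool" where
  "lin_subspace N \<Lambda> \<longleftrightarrow> (\<exists>W. kv.subspace W \<and> W \<subseteq> kvec N \<and> \<Lambda> = proj_of W)"

definition lin_span :: "nat \<Rightarrow> ('k::field) ppoint set \<Rightarrow> 'k ppoint set" where
  "lin_span N A = \<Inter> {\<Lambda>. lin_subspace N \<Lambda> \<and> A \<subseteq> \<Lambda>}"

definition is_line :: "nat \<Rightarrow> ('k::field) ppoint set \<Rightarrow> bool" where
  "is_line N l \<longleftrightarrow> (\<exists>W. kv.subspace W \<and> W \<subseteq> kvec N \<and> kv.dim W = 2 \<and> l = proj_of W)"


section \<open>Graded free resolutions and graded Betti numbers\<close>

text \<open>
  A graded complex of finite free modules \<open>F\<^sub>i = \<Oplus>\<^bsub>b < rk i\<^esub> R(-dg i b)\<close> with an augmentation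
  \<open>F\<^sub>0 \<rightarrow> R/I\<close>. The differential \<open>F\<^bsub>i+1\<^esub> \<rightarrow> F\<^sub>i\<close> sends the basis element \<open>e\<^sub>b\<close> to the sum of
  \<open>df i b c\<close> times \<open>e\<^sub>c\<close> over \<open>c < rk i\<close>, and the augmentation sends the basis element \<open>e\<^sub>b\<close> of
  \<open>F\<^sub>0\<close> to the class of \<open>aug b\<close>.
\<close>

record (overloaded) 'k gfree =
  rk :: "nat \<Rightarrow> nat"
  dg :: "nat \<Rightarrow> nat \<Rightarrow> nat"
  df :: "nat \<Rightarrow> nat \<Rightarrow> nat \<Rightarrow> 'k mpoly"
  aug :: "nat \<Rightarrow> 'k mpoly"

definition free_mod :: "nat \<Rightarrow> ('k::field) gfree \<Rightarrow> nat \<Rightarrow> (nat \<Rightarrow> 'k mpoly) set" where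
  "free_mod N F i = {u. \<forall>b. if b < rk F i then u b \<in> polys N else u b = 0}"

definition diff_map :: "('k::field) gfree \<Rightarrow> nat \<Rightarrow> (nat \<Rightarrow> 'k mpoly) \<Rightarrow> (nat \<Rightarrow> 'k mpoly)" where
  "diff_map F i u = (\<lambda>c. if c < rk F i then \<Sum>b<rk F (Suc i). u b * df F i b c else 0)"

definition aug_map :: "('k::field) gfree \<Rightarrow> (nat \<Rightarrow> 'k mpoly) \<Rightarrow> 'k mpoly" where
  "aug_map F u = (\<Sum>b<rk F 0. u b * aug F b)"

definition graded_free_resolution :: "nat \<Rightarrow> ('k::field) mpoly set \<Rightarrow> 'k gfree \<Rightarrow> bool" where
  "graded_free_resolution N I F \<longleftrightarrow>
     (\<forall>b<rk F 0. is_form N (dg F 0 b) (aug F b)) \<and>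
     (\<forall>i. \<forall>b<rk F (Suc i). \<forall>c<rk F i. df F i b c = 0 \<or>
        (dg F i c \<le> dg F (Suc i) b \<and> is_form N (dg F (Suc i) b - dg F i c) (df F i b c))) \<and>
     (\<forall>f\<in>polys N. \<exists>u\<in>free_mod N F 0. f - aug_map F u \<in> I) \<and>
     {u \<in> free_mod N F 0. aug_map F u \<in> I} = diff_map F 0 ` free_mod N F 1 \<and>
     (\<forall>i. {u \<in> free_mod N F (Suc i). diff_map F i u = (\<lambda>_. 0)}
            = diff_map F (Suc i) ` free_mod N F (Suc (Suc i)))"

text \<open>
  \<open>F\<^sub>i \<otimes> k\<close> in degree \<open>m\<close>, and the differential \<open>F\<^bsub>i+1\<^esub> \<otimes> k \<rightarrow> F\<^sub>i \<otimes> k\<close>, whose matrix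
  consists of the constant terms of that of \<open>F\<close>.
\<close>

definition fib :: "('k::field) gfree \<Rightarrow> nat \<Rightarrow> nat \<Rightarrow> (nat \<Rightarrow> 'k) set" where
  "fib F i m = {w. \<forall>b. w b \<noteq> 0 \<longrightarrow> b < rk F i \<and> dg F i b = m}"

definition fib_map :: "('k::field) gfree \<Rightarrow> nat \<Rightarrow> (nat \<Rightarrow> 'k) \<Rightarrow> (nat \<Rightarrow> 'k)" where
  "fib_map F i w =
     (\<lambda>c. if c < rk F i then \<Sum>b<rk F (Suc i). w b * Poly_Mapping.lookup (df F i b c) 0 else 0)"

definition fib_ker :: "('k::field) gfree \<Rightarrow> nat \<Rightarrow> nat \<Rightarrow> (nat \<Rightarrow> 'k) set" where
  "fib_ker F i m =
     {w \<in> fib F i m. case i of 0 \<Rightarrow> True | Suc i' \<Rightarrow> fib_map F i' w = (\<lambda>_. 0)}"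

definition resolution_of :: "nat \<Rightarrow> ('k::field) mpoly set \<Rightarrow> 'k gfree" where
  "resolution_of N I = (SOME F. graded_free_resolution N I F)"

text \<open>
  \<open>has_betti N I i j b\<close>: the graded Betti number \<open>\<beta>\<^bsub>i,j\<^esub> = dim Tor\<^sub>i(R/I, k)\<^bsub>i+j\<^esub>\<close> equals \<open>b\<close>, where
  Tor is computed as the homology of \<open>F \<otimes> k\<close> for a graded free resolution \<open>F\<close> of \<open>R/I\<close>.
\<close>

definition has_betti :: "nat \<Rightarrow> ('k::field) mpoly set \<Rightarrow> nat \<Rightarrow> nat \<Rightarrow> nat \<Rightarrow> bool" where
  "has_betti N I i j b \<longleftrightarrow>
     (let F = resolution_of N I
      in quot_dim vscale (fib_ker F i (i + j)) (fib_map F i ` fib F (Suc i) (i + j)) b)"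

definition property_N :: "nat \<Rightarrow> ('k::field) ppoint set \<Rightarrow> nat \<Rightarrow> nat \<Rightarrow> bool" where
  "property_N N X d p \<longleftrightarrow> (\<forall>i\<le>p. \<forall>j\<ge>d. has_betti N (hideal N X) i j 0)"


section \<open>Secant and tangent varieties\<close>

definition secant_variety :: "nat \<Rightarrow> ('k::field) ppoint set \<Rightarrow> 'k ppoint set" where
  "secant_variety N X = zclosure N (\<Union> {lin_span N {x, y} | x y. x \<in> X \<and> y \<in> X \<and> x \<noteq> y})"

text \<open>The embedded projective Zariski tangent space; \<open>x\<close> may be a singular point of \<open>X\<close>.\<close>

definition tangent_space :: "nat \<Rightarrow> ('k::field) ppoint set \<Rightarrow> 'k ppoint \<Rightarrow> 'k ppoint set" where
  "tangent_space N X x =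
     {p \<in> PN N. \<forall>f\<in>hideal N X. \<forall>v\<in>x. \<forall>w\<in>p. (\<Sum>i\<le>N. peval (part_deriv i f) v * w i) = 0}"

definition tangent_variety :: "nat \<Rightarrow> ('k::field) ppoint set \<Rightarrow> 'k ppoint set" where
  "tangent_variety N X = (\<Union>x\<in>X. tangent_space N X x)"


section \<open>Lengths of finite schemes and hypersurfaces\<close>

text \<open>
  \<open>scheme_length N J d\<close>: the closed subscheme \<open>Z\<close> of \<open>\<bbbP>\<^sup>N\<close> defined by the homogeneous ideal \<open>J\<close> is
  finite of length \<open>d\<close>. If \<open>Z\<close> does not meet the hyperplane \<open>h = 0\<close>, then it is the spectrum of
  \<open>R/(J + (h - 1))\<close>, and its length is the dimension of this ring over \<open>k\<close>. A positive-dimensional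
  \<open>Z\<close> meets every hyperplane, and a finite \<open>Z\<close> misses some hyperplane because \<open>k\<close> is infinite.
\<close>

definition scheme_length :: "nat \<Rightarrow> ('k::field) mpoly set \<Rightarrow> nat \<Rightarrow> bool" where
  "scheme_length N J d \<longleftrightarrow>
     (\<exists>h. is_form N 1 h \<and> zero_locus N (insert h J) = {} \<and>
          quot_dim pscale (polys N) (ideal_sum J (principal N (h - 1))) d)"

text \<open>
  The closed subscheme with homogeneous ideal \<open>J\<close> and underlying set \<open>F\<close> is a hypersurface of
  degree \<open>d\<close> in the linear subspace \<open>\<Lambda>\<close>, namely the scheme of zeros in \<open>\<Lambda>\<close> of a form of degree
  \<open>d\<close> not vanishing identically on \<open>\<Lambda>\<close>; it need not be reduced.
\<close>

definition is_hypersurface ::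
    "nat \<Rightarrow> nat \<Rightarrow> ('k::field) ppoint set \<Rightarrow> 'k ppoint set \<Rightarrow> 'k mpoly set \<Rightarrow> bool" where
  "is_hypersurface N d \<Lambda> F J \<longleftrightarrow>
     (\<exists>G. is_form N d G \<and> G \<notin> hideal N \<Lambda> \<and> F = \<Lambda> \<inter> zero_locus N {G} \<and>
          saturation N J = saturation N (ideal_sum (hideal N \<Lambda>) (principal N G)))"


section \<open>Projection from a point and the secant locus\<close>

text \<open>
  A linear map \<open>k\<^bsup>N+1\<^esup> \<rightarrow> k\<^sup>N\<close> inducing the projection from the point \<open>q\<close>: it is onto and its kernel
  is the line of vectors \<open>q\<close> stands for. The values of \<open>A\<close> outside \<open>kvec N\<close> are irrelevant.
\<close>

definition proj_from :: "nat \<Rightarrow> ('k::field) ppoint \<Rightarrow> ((nat \<Rightarrow> 'k) \<Rightarrow> (nat \<Rightarrow> 'k)) \<Rightarrow> bool" where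
  "proj_from N q A \<longleftrightarrow> Vector_Spaces.linear vscale vscale A \<and>
     A ` kvec N = kvec (N - 1) \<and> {v \<in> kvec N. A v = (\<lambda>_. 0)} = insert (\<lambda>_. 0) q"

definition pmap :: "((nat \<Rightarrow> 'k) \<Rightarrow> (nat \<Rightarrow> 'k)) \<Rightarrow> ('k::field) ppoint \<Rightarrow> 'k ppoint" where
  "pmap A p = A ` p"

text \<open>The line through \<open>q\<close> corresponding to the point \<open>y\<close> of \<open>\<bbbP>\<^bsup>N-1\<^esup>\<close>.\<close>

definition line_over :: "nat \<Rightarrow> ('k::field) ppoint \<Rightarrow> ((nat \<Rightarrow> 'k) \<Rightarrow> (nat \<Rightarrow> 'k)) \<Rightarrow>
    'k ppoint \<Rightarrow> 'k ppoint set" where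
  "line_over N q A y = {p \<in> PN N. p = q \<or> pmap A p = y}"

text \<open>The ideal sum defines the scheme-theoretic intersection of \<open>X\<close> with the linear subspace \<open>\<Lambda>\<close>.\<close>

definition inter_ideal :: "nat \<Rightarrow> ('k::field) ppoint set \<Rightarrow> 'k ppoint set \<Rightarrow> 'k mpoly set" where
  "inter_ideal N X \<Lambda> = ideal_sum (hideal N X) (hideal N \<Lambda>)"

definition secant_locus :: "nat \<Rightarrow> ('k::field) ppoint set \<Rightarrow> 'k ppoint \<Rightarrow>
    ((nat \<Rightarrow> 'k) \<Rightarrow> (nat \<Rightarrow> 'k)) \<Rightarrow> nat \<Rightarrow> 'k ppoint set" where
  "secant_locus N X q A d =
     {x \<in> X. scheme_length N (inter_ideal N X (line_over N q A (pmap A x))) d}"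

definition is_secant_line :: "nat \<Rightarrow> ('k::field) ppoint set \<Rightarrow> 'k ppoint \<Rightarrow> nat \<Rightarrow> 'k ppoint set \<Rightarrow> bool" where
  "is_secant_line N X q d l \<longleftrightarrow> is_line N l \<and> q \<in> l \<and> scheme_length N (inter_ideal N X l) d"

end

theory Submission
  imports Defs "Jordan_Normal_Form.Determinant"
begin

text \<open>
  Let \<open>q = [w]\<close>, let \<open>I\<close> be the ideal of \<open>X\<close>, let \<open>M\<close> be the ideal of \<open>q\<close> in the polynomial ring, and
  let \<open>x0\<close> be a linear form with \<open>x0(w) = 1\<close>. As \<open>q \<notin> X\<close> and \<open>I\<close> is generated in degrees at most \<open>d\<close>,
  there is a form \<open>G \<in> I\<close> of degree \<open>d\<close> with \<open>G(w) = 1\<close>. Above degree \<open>d\<close>, multiplication by \<open>x0\<close> is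
  injective on \<open>I / (G, M I)\<close>: a relation \<open>x0 f \<in> M I\<close> is a syzygy of \<open>I\<close> in a degree above \<open>d + 1\<close>, hence
  a consequence of Koszul syzygies. It is nilpotent as well, since \<open>x0 ^ d - G \<in> M\<close>. So every form of
  \<open>I\<close> of degree above \<open>d\<close> vanishing at \<open>w\<close> lies in \<open>M I\<close>.

  It follows by induction on the degree that all of \<open>I\<close> restricts to multiples of \<open>G\<close> on those lines
  through \<open>q\<close> on which the forms of degree \<open>d\<close> do, and these lines, the \<open>d\<close>-secant ones, are singled out
  by linear equations. On the linear space \<open>\<Lambda>\<close> they fill, the ideals \<open>I\<close> and \<open>(G)\<close> agree. If \<open>\<Lambda>\<close> contains
  two of them, then the discriminant of \<open>G\<close> has a zero on the pencil they span, which yields a point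
  of \<open>X\<close> with a tangent passing through \<open>q\<close>.
\<close>

text \<open>The Betti numbers refer to a resolution picked by choice. It need not be minimal and
  \<open>F_0\<close> need not have rank one, so its existence has to be proved, and vanishing
  homology of \<open>F \<otimes> k\<close> is used in this form: a homogeneous boundary without
  constant terms is the boundary of a chain with coefficients in the irrelevant ideal. An element
  \<open>f\<close> of \<open>I\<close> enters the resolution as \<open>f * e\<close>, where
  \<open>e\<close> lifts 1. Injectivity of \<open>x0\<close> comes from evaluation at
  \<open>w\<close>: the relation gives a syzygy \<open>s = \<Sum> x_j z_j\<close> with syzygies
  \<open>z_j\<close>, and subtracting \<open>\<Sum> w_j z_j\<close> from the lift of
  \<open>f\<close> keeps its image and makes it vanish at \<open>w\<close>. As
  \<open>G(w) = 1\<close>, the polynomial \<open>G(v + X w)\<close> is monic of degree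
  \<open>d\<close> on every line through \<open>q\<close>, so division with remainder is uniform in
  \<open>v\<close>; lengths, cone and discriminant all refer to it. In positive characteristic its
  derivative may drop in degree or vanish, so the discriminant is taken from a matrix of fixed
  size.\<close>

lemma mpoly_sum_singles:
  "f = (\<Sum>t\<in>Poly_Mapping.keys f. Poly_Mapping.single t (Poly_Mapping.lookup f t))"
  by (rule poly_mapping_eqI) (auto simp: lookup_sum lookup_single when_def in_keys_iff)

text \<open>The case of a single term may use that \<open>t\<close> lies in the support of
  \<open>f\<close>, so conditions on the support of \<open>f\<close> remain available although the
  induction runs through arbitrary sums.\<close>

lemma mpoly_induct [case_names zero single add]:
  fixes f :: "('k::field) mpoly"
  assumes "P 0" "\<And>t c. t \<in> Poly_Mapping.keys f \<Longrightarrow> c \<noteq> 0 \<Longrightarrow> P (Poly_Mapping.single t c)"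
    "\<And>g h. P g \<Longrightarrow> P h \<Longrightarrow> P (g + h)"
  shows "P f"
proof -
  have "S \<subseteq> Poly_Mapping.keys f \<Longrightarrow>
      P (\<Sum>t\<in>S. Poly_Mapping.single t (Poly_Mapping.lookup f t))" for S
  proof (induction S rule: infinite_finite_induct)
    case (insert x F)
    then show ?case
      by (auto intro!: assms simp: in_keys_iff)
  qed (use assms in auto)
  from this[of "Poly_Mapping.keys f"] show ?thesis
    by (simp flip: mpoly_sum_singles)
qed

lemma mult_lookup_finite:
  fixes f g :: "('k::field) mpoly"
  shows "f * g = (\<Sum>s\<in>Poly_Mapping.keys f. \<Sum>t\<in>Poly_Mapping.keys g.
    Poly_Mapping.single (s + t) (Poly_Mapping.lookup f s * Poly_Mapping.lookup g t))"
  by (subst mpoly_sum_singles[of f], subst mpoly_sum_singles[of g])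
    (simp add: sum_product mult_single)

section \<open>Monomials and forms\<close>

lemma mon_deg_superset:
  "finite S \<Longrightarrow> Poly_Mapping.keys t \<subseteq> S \<Longrightarrow> mon_deg t = (\<Sum>i\<in>S. Poly_Mapping.lookup t i)"
  unfolding mon_deg_def by (rule sum.mono_neutral_left) (auto simp: in_keys_iff)

lemma mon_deg_zero [simp]: "mon_deg 0 = 0"
  by (simp add: mon_deg_def)

lemma mon_deg_add: "mon_deg (s + t) = mon_deg s + mon_deg t"
proof -
  let ?S = "Poly_Mapping.keys s \<union> Poly_Mapping.keys t"
  have "Poly_Mapping.keys (s + t) \<subseteq> ?S" by (rule keys_add)
  then show ?thesis
    by (simp add: mon_deg_superset[of ?S] lookup_add sum.distrib)
qed

lemma mon_deg_single [simp]: "mon_deg (Poly_Mapping.single i n) = n"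
  by (simp add: mon_deg_def)

lemma mon_deg_eq_0_iff: "mon_deg t = 0 \<longleftrightarrow> t = 0"
  by (auto simp: mon_deg_def in_keys_iff intro!: poly_mapping_eqI)

lemma keys_nonempty: "t \<noteq> 0 \<Longrightarrow> \<exists>i. i \<in> Poly_Mapping.keys t"
  by (rule ccontr) (auto simp: in_keys_iff intro!: poly_mapping_eqI)

lemma keys_add_nat: "Poly_Mapping.keys (s + t) = Poly_Mapping.keys s \<union> Poly_Mapping.keys (t :: nat \<Rightarrow>\<^sub>0 nat)"
  by (auto simp: in_keys_iff lookup_add)

lemma polys_0 [simp]: "0 \<in> polys N" and polys_1 [simp]: "1 \<in> polys N"
  by (auto simp: polys_def)

lemma polys_add [simp]: "f \<in> polys N \<Longrightarrow> g \<in> polys N \<Longrightarrow> f + g \<in> polys N"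
  using keys_add[of f g] by (force simp: polys_def)

lemma polys_uminus [simp]: "f \<in> polys N \<Longrightarrow> - f \<in> polys N"
  by (simp add: polys_def in_keys_iff)

lemma polys_diff [simp]: "f \<in> polys N \<Longrightarrow> g \<in> polys N \<Longrightarrow> f - g \<in> polys N"
  using polys_add[of f N "-g"] by simp

lemma polys_mult [simp]: "f \<in> polys N \<Longrightarrow> g \<in> polys N \<Longrightarrow> f * g \<in> polys N"
  using keys_mult[of f g] by (force simp: polys_def keys_add_nat)

lemma polys_sum [simp]: "(\<And>i. i \<in> S \<Longrightarrow> f i \<in> polys N) \<Longrightarrow> (\<Sum>i\<in>S. f i) \<in> polys N"
  by (induction S rule: infinite_finite_induct) auto

lemma polys_power [simp]: "f \<in> polys N \<Longrightarrow> f ^ n \<in> polys N"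
  by (induction n) auto

lemma polys_single [simp]: "Poly_Mapping.keys t \<subseteq> {..N} \<Longrightarrow> Poly_Mapping.single t c \<in> polys N"
  by (auto simp: polys_def)

lemma is_form_polys: "is_form N m f \<Longrightarrow> f \<in> polys N"
  by (simp add: is_form_def)

lemma is_form_0 [simp]: "is_form N m 0"
  by (simp add: is_form_def)

lemma is_form_1 [simp]: "is_form N 0 1"
  by (simp add: is_form_def)

lemma is_form_const [simp]: "is_form N 0 (Poly_Mapping.single 0 c)"
  by (simp add: is_form_def)

lemma is_form_add: "is_form N m f \<Longrightarrow> is_form N m g \<Longrightarrow> is_form N m (f + g)"
  using keys_add[of f g] by (auto simp: is_form_def)

lemma is_form_uminus: "is_form N m f \<Longrightarrow> is_form N m (- f)"
  by (simp add: is_form_def in_keys_iff)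

lemma is_form_diff: "is_form N m f \<Longrightarrow> is_form N m g \<Longrightarrow> is_form N m (f - g)"
  using is_form_add[of N m f "-g"] is_form_uminus[of N m g] by simp

lemma is_form_mult: "is_form N m f \<Longrightarrow> is_form N n g \<Longrightarrow> is_form N (m + n) (f * g)"
  using keys_mult[of f g] by (force simp: is_form_def mon_deg_add)

lemma is_form_sum: "(\<And>i. i \<in> S \<Longrightarrow> is_form N m (f i)) \<Longrightarrow> is_form N m (\<Sum>i\<in>S. f i)"
  by (induction S rule: infinite_finite_induct) (auto intro: is_form_add)

lemma is_form_power: "is_form N m f \<Longrightarrow> is_form N (n * m) (f ^ n)"
  by (induction n) (auto intro: is_form_mult)

lemma is_form_scale: "is_form N m f \<Longrightarrow> is_form N m (pscale c f)"
  using is_form_mult[OF is_form_const, of N m f c] by (simp add: pscale_def)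

lemma polys_scale [simp]: "f \<in> polys N \<Longrightarrow> pscale c f \<in> polys N"
  by (simp add: pscale_def)

lemma is_form_single: "Poly_Mapping.keys t \<subseteq> {..N} \<Longrightarrow> is_form N (mon_deg t) (Poly_Mapping.single t c)"
  by (auto simp: is_form_def)

section \<open>Homogeneous components\<close>

lemma lookup_hom_comp:
  "Poly_Mapping.lookup (hom_comp m f) t = (if mon_deg t = m then Poly_Mapping.lookup f t else 0)"
  by (auto simp: hom_comp_def lookup_sum lookup_single when_def in_keys_iff)

lemma hom_comp_0 [simp]: "hom_comp m 0 = 0"
  by (rule poly_mapping_eqI) (simp add: lookup_hom_comp)

lemma hom_comp_add: "hom_comp m (f + g) = hom_comp m f + hom_comp m g"
  by (rule poly_mapping_eqI) (simp add: lookup_hom_comp lookup_add)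

lemma hom_comp_sum: "hom_comp m (\<Sum>i\<in>S. f i) = (\<Sum>i\<in>S. hom_comp m (f i))"
  by (induction S rule: infinite_finite_induct) (simp_all add: hom_comp_add)

lemma hom_comp_single:
  "hom_comp m (Poly_Mapping.single t c) = (if mon_deg t = m then Poly_Mapping.single t c else 0)"
  by (rule poly_mapping_eqI) (auto simp: lookup_hom_comp lookup_single when_def)

lemma is_form_hom_comp [simp]: "f \<in> polys N \<Longrightarrow> is_form N m (hom_comp m f)"
  by (auto simp: is_form_def polys_def in_keys_iff lookup_hom_comp split: if_splits)

lemma polys_hom_comp [simp]: "f \<in> polys N \<Longrightarrow> hom_comp m f \<in> polys N"
  by (rule is_form_polys) (rule is_form_hom_comp)

lemma hom_comp_form: "is_form N n f \<Longrightarrow> hom_comp m f = (if m = n then f else 0)"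
  by (rule poly_mapping_eqI) (auto simp: is_form_def lookup_hom_comp in_keys_iff)

lemma hom_comp_mult_form:
  fixes f g :: "('k::field) mpoly"
  assumes "is_form N e g"
  shows "hom_comp m (f * g) = (if e \<le> m then hom_comp (m - e) f * g else 0)"
proof (induction f rule: mpoly_induct)
  case zero
  show ?case by simp
next
  case (single t c)
  have "Poly_Mapping.single t c * g =
      (\<Sum>s\<in>Poly_Mapping.keys g. Poly_Mapping.single (t + s) (c * Poly_Mapping.lookup g s))"
    using single(2) by (subst mult_lookup_finite) simp
  then have "hom_comp m (Poly_Mapping.single t c * g) =
      (if mon_deg t + e = m then Poly_Mapping.single t c * g else 0)"
    using assms by (simp add: hom_comp_sum hom_comp_single mon_deg_add is_form_def)
  then show ?case
    by (auto simp: hom_comp_single)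
next
  case (add a b)
  then show ?case by (simp add: hom_comp_add distrib_right)
qed

lemma sum_hom_comp:
  assumes "\<And>t. t \<in> Poly_Mapping.keys f \<Longrightarrow> mon_deg t \<le> M"
  shows "f = (\<Sum>m\<le>M. hom_comp m f)"
  by (rule poly_mapping_eqI) (use assms in \<open>auto simp: lookup_sum lookup_hom_comp in_keys_iff\<close>)

lemma mon_deg_bounded: "\<exists>M. \<forall>t\<in>Poly_Mapping.keys f. mon_deg t \<le> M"
  by (rule exI[of _ "Max (mon_deg ` Poly_Mapping.keys f)"]) auto

lemma form_decomp: obtains M where "f = (\<Sum>m\<le>M. hom_comp m f)"
  using mon_deg_bounded[of f] sum_hom_comp[of f] by blast

section \<open>Substitution\<close>

text \<open>Evaluation of a polynomial in a commutative \<open>k\<close>-algebra with structure map \<open>e\<close>.\<close>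

definition psub :: "('k::field \<Rightarrow> 'a::comm_ring_1) \<Rightarrow> 'k mpoly \<Rightarrow> (nat \<Rightarrow> 'a) \<Rightarrow> 'a" where
  "psub e f \<phi> = (\<Sum>t\<in>Poly_Mapping.keys f. e (Poly_Mapping.lookup f t) *
                  (\<Prod>i\<in>Poly_Mapping.keys t. \<phi> i ^ Poly_Mapping.lookup t i))"

definition mon_val :: "(nat \<Rightarrow> 'a::comm_ring_1) \<Rightarrow> (nat \<Rightarrow>\<^sub>0 nat) \<Rightarrow> 'a" where
  "mon_val \<phi> t = (\<Prod>i\<in>Poly_Mapping.keys t. \<phi> i ^ Poly_Mapping.lookup t i)"

lemma mon_val_superset:
  "finite S \<Longrightarrow> Poly_Mapping.keys t \<subseteq> S \<Longrightarrow> mon_val \<phi> t = (\<Prod>i\<in>S. \<phi> i ^ Poly_Mapping.lookup t i)"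
  unfolding mon_val_def by (rule prod.mono_neutral_left) (auto simp: in_keys_iff)

lemma mon_val_add: "mon_val \<phi> (s + t) = mon_val \<phi> s * mon_val \<phi> t"
proof -
  let ?S = "Poly_Mapping.keys s \<union> Poly_Mapping.keys t"
  show ?thesis
    by (simp add: mon_val_superset[of ?S] keys_add_nat lookup_add power_add prod.distrib)
qed

text \<open>Three target rings occur: the field itself for \<open>peval\<close>, \<open>k[X]\<close>
  for the restriction to a line, and \<open>k[X][T]\<close> for the restriction to a pencil of
  lines.\<close>

locale kalg =
  fixes e :: "'k::field \<Rightarrow> 'a::comm_ring_1"
  assumes e0: "e 0 = 0" and e1: "e 1 = 1"
    and e_add: "e (x + y) = e x + e y" and e_mult: "e (x * y) = e x * e y"
begin

lemma psub_0 [simp]: "psub e 0 \<phi> = 0"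
  by (simp add: psub_def)

lemma psub_single: "psub e (Poly_Mapping.single t c) \<phi> = e c * mon_val \<phi> t"
  by (simp add: psub_def mon_val_def e0)

lemma psub_const [simp]: "psub e (Poly_Mapping.single 0 c) \<phi> = e c"
  by (simp add: psub_single mon_val_def e0 e1)

lemma psub_1 [simp]: "psub e 1 \<phi> = 1"
  using psub_const[of 1 \<phi>] by (simp del: psub_const add: e1)

lemma psub_add [simp]: "psub e (f + g) \<phi> = psub e f \<phi> + psub e g \<phi>"
  unfolding psub_def
  by (rule setsum_keys_plus_distrib) (auto simp: algebra_simps e0 e_add)

lemma psub_sum: "psub e (\<Sum>i\<in>S. f i) \<phi> = (\<Sum>i\<in>S. psub e (f i) \<phi>)"
  by (induction S rule: infinite_finite_induct) simp_all

lemma psub_mult [simp]: "psub e (f * g) \<phi> = psub e f \<phi> * psub e g \<phi>"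
proof -
  have "psub e (f * g) \<phi> = (\<Sum>s\<in>Poly_Mapping.keys f. \<Sum>t\<in>Poly_Mapping.keys g.
      e (Poly_Mapping.lookup f s) * e (Poly_Mapping.lookup g t) * (mon_val \<phi> s * mon_val \<phi> t))"
    by (subst mult_lookup_finite) (simp add: psub_sum psub_single mon_val_add e_mult)
  also have "\<dots> = psub e f \<phi> * psub e g \<phi>"
    by (simp add: psub_def sum_product ac_simps flip: mon_val_def)
  finally show ?thesis .
qed

lemma psub_uminus [simp]: "psub e (- f) \<phi> = - psub e f \<phi>"
  using psub_add[of f "-f" \<phi>] by (simp add: eq_neg_iff_add_eq_0 add.commute del: psub_add)

lemma psub_diff [simp]: "psub e (f - g) \<phi> = psub e f \<phi> - psub e g \<phi>"
  using psub_add[of f "-g" \<phi>] by (simp del: psub_add)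

lemma psub_power [simp]: "psub e (f ^ n) \<phi> = psub e f \<phi> ^ n"
  by (induction n) simp_all

lemma psub_scale [simp]: "psub e (pscale c f) \<phi> = e c * psub e f \<phi>"
  by (simp add: pscale_def)

text \<open>Evaluating the variable of a line at a scalar, translating it and rescaling it are ring
  homomorphisms \<open>h\<close>, so each of them amounts to a change of the point of
  evaluation.\<close>

lemma psub_hom:
  assumes "h 0 = 0" "h 1 = 1" "\<And>x y. h (x + y) = h x + h y" "\<And>x y. h (x * y) = h x * h y"
  shows "h (psub e f \<phi>) = psub (\<lambda>c. h (e c)) f (\<lambda>i. h (\<phi> i))"
proof -
  have s: "h (\<Sum>i\<in>S. F i) = (\<Sum>i\<in>S. h (F i))" for S and F :: "'c \<Rightarrow> _"
    by (induction S rule: infinite_finite_induct) (simp_all add: assms)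
  have p: "h (\<Prod>i\<in>S. F i) = (\<Prod>i\<in>S. h (F i))" for S and F :: "'c \<Rightarrow> _"
    by (induction S rule: infinite_finite_induct) (simp_all add: assms)
  have w: "h (x ^ n) = h x ^ n" for x n
    by (induction n) (simp_all add: assms)
  show ?thesis
    by (simp add: psub_def s p w assms)
qed

lemma psub_form_scale:
  assumes "is_form N m f"
  shows "psub e f (\<lambda>i. c * \<phi> i) = c ^ m * psub e f \<phi>"
proof -
  have "(\<Prod>i\<in>Poly_Mapping.keys t. (c * \<phi> i) ^ Poly_Mapping.lookup t i) =
      c ^ m * (\<Prod>i\<in>Poly_Mapping.keys t. \<phi> i ^ Poly_Mapping.lookup t i)"
    if "t \<in> Poly_Mapping.keys f" for t
  proof -
    have "mon_deg t = m" using that assms by (auto simp: is_form_def)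
    then show ?thesis
      by (simp add: power_mult_distrib prod.distrib mon_deg_def flip: power_sum)
  qed
  then show ?thesis
    by (simp add: psub_def sum_distrib_left ac_simps cong: sum.cong)
qed

end

lemma peval_psub: "peval f v = psub (\<lambda>c. c) f v"
  by (simp add: peval_def psub_def)

global_interpretation kalg_id: kalg "\<lambda>c::'k::field. c" by unfold_locales (rule refl)+

global_interpretation kalg_poly: kalg "\<lambda>c::'k::field. [:c:]" by unfold_locales (auto simp: pCons_one)

lemmas peval_0 [simp] = kalg_id.psub_0[folded peval_psub]
lemmas peval_const [simp] = kalg_id.psub_const[folded peval_psub]
lemmas peval_1 [simp] = kalg_id.psub_1[folded peval_psub]
lemmas peval_add [simp] = kalg_id.psub_add[folded peval_psub]
lemmas peval_sum = kalg_id.psub_sum[folded peval_psub]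
lemmas peval_mult [simp] = kalg_id.psub_mult[folded peval_psub]
lemmas peval_diff [simp] = kalg_id.psub_diff[folded peval_psub]
lemmas peval_power [simp] = kalg_id.psub_power[folded peval_psub]
lemmas peval_scale [simp] = kalg_id.psub_scale[folded peval_psub]
lemmas peval_form_scale = kalg_id.psub_form_scale[folded peval_psub]

lemma peval_form_vscale: "is_form N m f \<Longrightarrow> peval f (vscale c v) = c ^ m * peval f v"
  unfolding vscale_def by (rule peval_form_scale)

text \<open>Makes taking the constant term a ring homomorphism, through the rules for
  \<open>peval\<close>.\<close>

lemma const_term_peval: "Poly_Mapping.lookup f 0 = peval f (\<lambda>_. 0)"
proof (induction f rule: mpoly_induct)
  case (single t c)
  show ?case
  proof (cases "t = 0")
    case False
    then obtain i where "i \<in> Poly_Mapping.keys t" using keys_nonempty by blast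
    then have "\<exists>i\<in>Poly_Mapping.keys t. (0::'a) ^ Poly_Mapping.lookup t i = 0"
      by (auto simp: in_keys_iff power_0_left)
    then have "mon_val (\<lambda>_. 0 :: 'a) t = 0"
      unfolding mon_val_def by (rule prod_zero[OF finite_keys])
    then show ?thesis
      using False kalg_id.psub_single[of t c "\<lambda>_. 0"] by (simp add: peval_psub lookup_single)
  qed simp
qed (simp_all add: lookup_add)

section \<open>Variables\<close>

definition pvar :: "nat \<Rightarrow> ('k::field) mpoly" where
  "pvar i = Poly_Mapping.single (Poly_Mapping.single i 1) 1"

lemma (in kalg) psub_pvar [simp]: "psub e (pvar i) \<phi> = \<phi> i"
  by (simp add: pvar_def psub_single mon_val_def e1)

lemmas peval_pvar [simp] = kalg_id.psub_pvar[folded peval_psub]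

lemma is_form_pvar [simp]: "i \<le> N \<Longrightarrow> is_form N 1 (pvar i)"
  unfolding pvar_def using is_form_single[of "Poly_Mapping.single i 1" N 1] by simp

lemma polys_pvar [simp]: "i \<le> N \<Longrightarrow> pvar i \<in> polys N"
  by (rule is_form_polys) (rule is_form_pvar)

text \<open>Every monomial other than 1 contains a variable, and one is split off from each
  term.\<close>

lemma const_term_0_expand:
  fixes f :: "('k::field) mpoly"
  assumes "f \<in> polys N" "Poly_Mapping.lookup f 0 = 0"
  shows "\<exists>g. (\<forall>j. g j \<in> polys N) \<and> f = (\<Sum>j\<le>N. pvar j * g j)"
proof -
  define Q where "Q f = (\<exists>g. (\<forall>j. g j \<in> polys N) \<and> f = (\<Sum>j\<le>N. pvar j * g j))" for f :: "'k mpoly"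
  have "Q f"
  proof (induction f rule: mpoly_induct)
    case zero
    show ?case unfolding Q_def by (rule exI[of _ "\<lambda>_. 0"]) simp
  next
    case (add g h)
    then obtain a b where "\<forall>j. a j \<in> polys N" "\<forall>j. b j \<in> polys N"
      "g = (\<Sum>j\<le>N. pvar j * a j)" "h = (\<Sum>j\<le>N. pvar j * b j)" unfolding Q_def by blast
    then show ?case unfolding Q_def
      by (intro exI[of _ "\<lambda>j. a j + b j"]) (simp add: algebra_simps sum.distrib)
  next
    case (single t c)
    have "t \<noteq> 0" using single assms by (auto simp: in_keys_iff)
    then obtain i where i: "i \<in> Poly_Mapping.keys t" using keys_nonempty by blast
    have tN: "Poly_Mapping.keys t \<subseteq> {..N}" using single assms by (auto simp: polys_def)
    define s where "s = t - Poly_Mapping.single i 1"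
    have ts: "t = Poly_Mapping.single i 1 + s"
      unfolding s_def using i
      by (intro poly_mapping_eqI) (auto simp: lookup_add lookup_minus lookup_single when_def in_keys_iff)
    have "Poly_Mapping.single t c = pvar i * Poly_Mapping.single s c"
      by (simp add: pvar_def mult_single ts)
    moreover have "Poly_Mapping.keys s \<subseteq> {..N}" using tN by (simp add: ts keys_add_nat)
    ultimately show ?case unfolding Q_def
      using i tN by (intro exI[of _ "\<lambda>j. if j = i then Poly_Mapping.single s c else 0"]) (auto simp: if_distrib[where f="\<lambda>x. _ * x"] cong: if_cong)
  qed
  then show ?thesis by (simp add: Q_def)
qed

lemma is_form_pvar_expand:
  assumes "is_form N (Suc m) f"
  shows "\<exists>g. (\<forall>j. is_form N m (g j)) \<and> f = (\<Sum>j\<le>N. pvar j * g j)"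
proof -
  have "Poly_Mapping.lookup f 0 = 0"
    using assms by (force simp: is_form_def in_keys_iff)
  then obtain g where g: "\<forall>j. g j \<in> polys N" "f = (\<Sum>j\<le>N. pvar j * g j)"
    using const_term_0_expand assms is_form_polys by blast
  have "f = hom_comp (Suc m) f" using assms by (simp add: hom_comp_form)
  also have "\<dots> = (\<Sum>j\<le>N. hom_comp (Suc m) (g j * pvar j))"
    by (subst g(2)) (simp only: hom_comp_sum mult.commute)
  also have "\<dots> = (\<Sum>j\<le>N. hom_comp m (g j) * pvar j)"
    using hom_comp_mult_form[OF is_form_pvar, of _ N "Suc m"]
    by (intro sum.cong refl) simp
  finally have "f = (\<Sum>j\<le>N. pvar j * hom_comp m (g j))" by (simp only: mult.commute)
  then show ?thesis using g(1) by (intro exI[of _ "\<lambda>j. hom_comp m (g j)"]) auto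
qed

section \<open>Dickson's lemma\<close>

text \<open>A monotone subsequence exists; if it decreases, it is constant from the place
  \<open>k0\<close> where its minimum is attained.\<close>

lemma nat_incseq_subseq:
  fixes s :: "nat \<Rightarrow> nat"
  shows "\<exists>\<psi>. strict_mono \<psi> \<and> incseq (\<lambda>k. s (\<psi> k))"
proof -
  obtain g where g: "strict_mono g" "monoseq (\<lambda>k. s (g k))"
    using seq_monosub by blast
  show ?thesis
  proof (cases "incseq (\<lambda>k. s (g k))")
    case False
    then have dec: "decseq (\<lambda>k. s (g k))" using g(2) by (simp add: monoseq_iff)
    obtain k0 where k0: "\<And>k. s (g k0) \<le> s (g k)"
      using ex_has_least_nat[of "\<lambda>_. True" 0 "\<lambda>k. s (g k)"] by auto
    have "s (g (k + k0)) = s (g k0)" for k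
      using k0[of "k + k0"] dec by (auto simp: decseq_def intro: antisym)
    moreover have "strict_mono (\<lambda>k. g (k + k0))"
      using g(1) by (auto simp: strict_mono_def)
    ultimately show ?thesis by (intro exI[of _ "\<lambda>k. g (k + k0)"]) (simp add: incseq_def)
  qed (use g in blast)
qed

lemma incseq_subseq_coordinates:
  fixes f :: "nat \<Rightarrow> nat \<Rightarrow> nat"
  shows "\<exists>\<phi>. strict_mono \<phi> \<and> (\<forall>i<n. incseq (\<lambda>k. f (\<phi> k) i))"
proof (induction n)
  case 0
  show ?case by (rule exI[of _ id]) (simp add: strict_mono_def)
next
  case (Suc n)
  then obtain \<phi> where \<phi>: "strict_mono \<phi>" "\<forall>i<n. incseq (\<lambda>k. f (\<phi> k) i)" by blast
  obtain \<psi> where \<psi>: "strict_mono \<psi>" "incseq (\<lambda>k. f (\<phi> (\<psi> k)) n)"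
    using nat_incseq_subseq[of "\<lambda>k. f (\<phi> k) n"] by blast
  have "incseq (\<lambda>k. f (\<phi> (\<psi> k)) i)" if "i < Suc n" for i
  proof (cases "i = n")
    case False
    then have "incseq (\<lambda>k. f (\<phi> k) i)" using \<phi> that by simp
    then show ?thesis using \<psi>(1) by (simp add: incseq_def strict_mono_less_eq)
  qed (use \<psi> in simp)
  moreover have "strict_mono (\<lambda>k. \<phi> (\<psi> k))"
    using \<phi>(1) \<psi>(1) by (simp add: strict_mono_def)
  ultimately show ?case by blast
qed

text \<open>\<open>E0\<close> consists of the elements of \<open>E\<close> minimal under
  divisibility. Infinitely many of them would contain two distinct comparable ones, and descent on
  the degree leads from any element to a minimal one.\<close>

lemma dickson:
  fixes E :: "(nat \<Rightarrow>\<^sub>0 nat) set"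
  assumes E: "\<And>t. t \<in> E \<Longrightarrow> Poly_Mapping.keys t \<subseteq> {..N}"
  shows "\<exists>E0\<subseteq>E. finite E0 \<and> (\<forall>t\<in>E. \<exists>s\<in>E0. \<exists>r. t = s + r)"
proof -
  define le where "le s t \<longleftrightarrow> (\<forall>i. Poly_Mapping.lookup s i \<le> Poly_Mapping.lookup t i)"
    for s t :: "nat \<Rightarrow>\<^sub>0 nat"
  define E0 where "E0 = {t \<in> E. \<forall>s\<in>E. le s t \<longrightarrow> s = t}"
  have diff: "t = s + (t - s)" if "le s t" for s t
    using that by (intro poly_mapping_eqI) (simp add: lookup_add lookup_minus le_def)
  have "finite E0"
  proof (rule ccontr)
    assume "infinite E0"
    then obtain g :: "nat \<Rightarrow> _" where g: "inj g" "range g \<subseteq> E0"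
      using infinite_countable_subset by blast
    obtain \<phi> where \<phi>: "strict_mono \<phi>" "\<forall>i<Suc N. incseq (\<lambda>k. Poly_Mapping.lookup (g (\<phi> k)) i)"
      using incseq_subseq_coordinates[of "Suc N" "\<lambda>k. Poly_Mapping.lookup (g k)"] by blast
    have gE: "g k \<in> E" for k using g(2) by (auto simp: E0_def)
    have "le (g (\<phi> 0)) (g (\<phi> 1))"
      unfolding le_def
    proof
      fix i
      show "Poly_Mapping.lookup (g (\<phi> 0)) i \<le> Poly_Mapping.lookup (g (\<phi> 1)) i"
      proof (cases "i \<le> N")
        case True
        then show ?thesis using \<phi>(2) by (simp add: incseq_def)
      next
        case False
        then have "i \<notin> Poly_Mapping.keys (g (\<phi> 0))" using E[OF gE, of "\<phi> 0"] by auto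
        then show ?thesis by (simp add: in_keys_iff)
      qed
    qed
    then have "g (\<phi> 0) = g (\<phi> 1)"
      using g(2) gE[of "\<phi> 0"] by (auto simp: E0_def)
    then have "\<phi> 0 = \<phi> 1" using g(1) by (auto dest: injD)
    moreover have "\<phi> 0 < \<phi> 1" using \<phi>(1) by (simp add: strict_mono_def)
    ultimately show False by simp
  qed
  moreover have "\<exists>s\<in>E0. le s t" if "t \<in> E" for t
    using that
  proof (induction "mon_deg t" arbitrary: t rule: less_induct)
    case less
    show ?case
    proof (cases "t \<in> E0")
      case True
      then show ?thesis by (auto simp: le_def)
    next
      case False
      then obtain s where s: "s \<in> E" "le s t" "s \<noteq> t" using less.prems by (auto simp: E0_def)
      have "t - s \<noteq> 0" using diff[OF s(2)] s(3) by auto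
      then have "mon_deg (t - s) > 0" using mon_deg_eq_0_iff[of "t - s"] by simp
      moreover have "mon_deg t = mon_deg s + mon_deg (t - s)"
        by (subst diff[OF s(2)]) (rule mon_deg_add)
      ultimately obtain s' where "s' \<in> E0" "le s' s" using less.hyps[of s] s(1) by auto
      then show ?thesis using s(2) by (meson le_def order_trans)
    qed
  qed
  moreover have "E0 \<subseteq> E" by (auto simp: E0_def)
  ultimately show ?thesis using diff by meson
qed

text \<open>Termination of the division in the finiteness theorem below rests on this, since
  reduction keeps the degree.\<close>

lemma finite_monomials:
  "finite {t :: nat \<Rightarrow>\<^sub>0 nat. Poly_Mapping.keys t \<subseteq> {..N} \<and> mon_deg t \<le> a}"
proof (rule finite_imageD)
  show "inj_on Poly_Mapping.lookup {t :: nat \<Rightarrow>\<^sub>0 nat. Poly_Mapping.keys t \<subseteq> {..N} \<and> mon_deg t \<le> a}"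
    by (auto simp: inj_on_def intro!: poly_mapping_eqI)
  have "Poly_Mapping.lookup t i \<le> mon_deg t" for t :: "nat \<Rightarrow>\<^sub>0 nat" and i
    by (cases "i \<in> Poly_Mapping.keys t") (auto simp: mon_deg_def in_keys_iff intro: member_le_sum)
  then have "Poly_Mapping.lookup ` {t :: nat \<Rightarrow>\<^sub>0 nat. Poly_Mapping.keys t \<subseteq> {..N} \<and> mon_deg t \<le> a}
      \<subseteq> {f. \<forall>i. (i \<in> {..N} \<longrightarrow> f i \<in> {..a}) \<and> (i \<notin> {..N} \<longrightarrow> f i = 0)}"
    by (auto simp: in_keys_iff intro: order_trans)
  then show "finite (Poly_Mapping.lookup ` {t :: nat \<Rightarrow>\<^sub>0 nat. Poly_Mapping.keys t \<subseteq> {..N} \<and> mon_deg t \<le> a})"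
    by (rule finite_subset) (rule finite_set_of_finite_funs; simp)
qed

section \<open>Graded submodules of free modules\<close>

definition fm :: "nat \<Rightarrow> nat \<Rightarrow> (nat \<Rightarrow> ('k::field) mpoly) set" where
  "fm N r = {u. \<forall>b. if b < r then u b \<in> polys N else u b = 0}"

text \<open>The component of degree \<open>a\<close> in the free module whose basis elements have degrees \<open>\<delta> b\<close>.\<close>

definition vcomp :: "(nat \<Rightarrow> nat) \<Rightarrow> nat \<Rightarrow> (nat \<Rightarrow> ('k::field) mpoly) \<Rightarrow> (nat \<Rightarrow> 'k mpoly)" where
  "vcomp \<delta> a u = (\<lambda>b. if \<delta> b \<le> a then hom_comp (a - \<delta> b) (u b) else 0)"

definition graded_sub :: "nat \<Rightarrow> nat \<Rightarrow> (nat \<Rightarrow> nat) \<Rightarrow> (nat \<Rightarrow> ('k::field) mpoly) set \<Rightarrow> bool" where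
  "graded_sub N r \<delta> P \<longleftrightarrow> P \<subseteq> fm N r \<and> (\<lambda>_. 0) \<in> P \<and>
     (\<forall>u\<in>P. \<forall>v\<in>P. (\<lambda>b. u b + v b) \<in> P) \<and>
     (\<forall>p\<in>polys N. \<forall>u\<in>P. (\<lambda>b. p * u b) \<in> P) \<and>
     (\<forall>a. \<forall>u\<in>P. vcomp \<delta> a u \<in> P)"

lemma graded_subD:
  assumes "graded_sub N r \<delta> P"
  shows "P \<subseteq> fm N r" "\<And>u v. u \<in> P \<Longrightarrow> v \<in> P \<Longrightarrow> (\<lambda>b. u b + v b) \<in> P"
    "\<And>p u. p \<in> polys N \<Longrightarrow> u \<in> P \<Longrightarrow> (\<lambda>b. p * u b) \<in> P" "\<And>u. u \<in> P \<Longrightarrow> vcomp \<delta> a u \<in> P"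
  using assms unfolding graded_sub_def by blast+

lemma fm_polys: "u \<in> fm N r \<Longrightarrow> u b \<in> polys N"
  by (cases "b < r") (auto simp: fm_def)

lemma fm_0: "u \<in> fm N r \<Longrightarrow> r \<le> b \<Longrightarrow> u b = 0"
  by (auto simp: fm_def)

lemma fm_add: "u \<in> fm N r \<Longrightarrow> v \<in> fm N r \<Longrightarrow> (\<lambda>b. u b + v b) \<in> fm N r"
  by (auto simp: fm_def)

lemma fm_diff: "u \<in> fm N r \<Longrightarrow> v \<in> fm N r \<Longrightarrow> (\<lambda>b. u b - v b) \<in> fm N r"
  by (auto simp: fm_def)

lemma fm_mult: "u \<in> fm N r \<Longrightarrow> p \<in> polys N \<Longrightarrow> (\<lambda>b. p * u b) \<in> fm N r"
  by (auto simp: fm_def)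

lemma fm_vcomp: "u \<in> fm N r \<Longrightarrow> vcomp \<delta> a u \<in> fm N r"
  by (auto simp: fm_def vcomp_def)

lemma vcomp_add: "vcomp \<delta> a (\<lambda>b. u b + v b) = (\<lambda>b. vcomp \<delta> a u b + vcomp \<delta> a v b)"
  by (auto simp: vcomp_def hom_comp_add)

lemma vcomp_mult_form:
  assumes "is_form N e p"
  shows "vcomp \<delta> a (\<lambda>b. p * u b) = (\<lambda>b. if e \<le> a then p * vcomp \<delta> (a - e) u b else 0)"
proof
  fix b
  have "hom_comp m (p * u b) = (if e \<le> m then p * hom_comp (m - e) (u b) else 0)" for m
    using hom_comp_mult_form[OF assms, of m "u b"] by (simp add: mult.commute)
  moreover have "a - \<delta> b - e = a - e - \<delta> b" by simp
  ultimately show "vcomp \<delta> a (\<lambda>b. p * u b) b = (if e \<le> a then p * vcomp \<delta> (a - e) u b else 0)"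
    by (auto simp: vcomp_def)
qed

lemma vcomp_form:
  assumes "u \<in> fm N r" "vcomp \<delta> a u = u"
  shows "if \<delta> b \<le> a then is_form N (a - \<delta> b) (u b) else u b = 0"
  using fun_cong[OF assms(2), of b] is_form_hom_comp[OF fm_polys[OF assms(1), of b], of "a - \<delta> b"]
  by (auto simp: vcomp_def split: if_splits)

lemma vcomp_decomp:
  assumes u: "u \<in> fm N r"
  shows "\<exists>M. \<forall>b. u b = (\<Sum>a\<le>M. vcomp \<delta> a u b)"
proof -
  have "\<forall>b. \<exists>M. \<forall>t\<in>Poly_Mapping.keys (u b). mon_deg t \<le> M"
    using mon_deg_bounded by blast
  then obtain m where m: "\<And>b. \<forall>t\<in>Poly_Mapping.keys (u b). mon_deg t \<le> m b" by metis
  define M where "M = (\<Sum>b<r. m b + \<delta> b)"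
  have "u b = (\<Sum>a\<le>M. vcomp \<delta> a u b)" for b
  proof (rule poly_mapping_eqI)
    fix t
    have "Poly_Mapping.lookup (\<Sum>a\<le>M. vcomp \<delta> a u b) t =
        (\<Sum>a\<le>M. if a = mon_deg t + \<delta> b then Poly_Mapping.lookup (u b) t else 0)"
      unfolding lookup_sum by (intro sum.cong refl) (auto simp: vcomp_def lookup_hom_comp)
    also have "\<dots> = Poly_Mapping.lookup (u b) t"
    proof (cases "Poly_Mapping.lookup (u b) t = 0")
      case False
      then have "b < r" using u by (auto simp: fm_def split: if_splits)
      then have "m b + \<delta> b \<le> M" unfolding M_def by (intro member_le_sum) auto
      moreover have "mon_deg t \<le> m b" using m False by (auto simp: in_keys_iff)
      ultimately show ?thesis by simp
    qed simp
    finally show "Poly_Mapping.lookup (u b) t = Poly_Mapping.lookup (\<Sum>a\<le>M. vcomp \<delta> a u b) t" ..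
  qed
  then show ?thesis by blast
qed

text \<open>With the basis vector \<open>e_b\<close> placed in degree \<open>\<delta>' b\<close>,
  the matrix \<open>D\<close> defines a map of degree 0, and such a map commutes with taking
  components.\<close>

lemma vcomp_lincomb:
  assumes "\<And>b. b < s \<Longrightarrow> D b \<in> fm N r \<and> vcomp \<delta> (\<delta>' b) (D b) = D b"
  shows "vcomp \<delta> a (\<lambda>c. \<Sum>b<s. u b * D b c) = (\<lambda>c. \<Sum>b<s. vcomp \<delta>' a u b * D b c)"
proof
  fix c
  have "(if \<delta> c \<le> a then hom_comp (a - \<delta> c) (u b * D b c) else 0) = vcomp \<delta>' a u b * D b c"
    if b: "b < s" for b
  proof (cases "\<delta> c \<le> \<delta>' b")
    case True
    then have "is_form N (\<delta>' b - \<delta> c) (D b c)"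
      using vcomp_form[of "D b" N r \<delta> "\<delta>' b" c] assms[OF b] by simp
    then show ?thesis
      using True by (auto simp: hom_comp_mult_form vcomp_def)
  next
    case False
    then have "D b c = 0"
      using vcomp_form[of "D b" N r \<delta> "\<delta>' b" c] assms[OF b] by simp
    then show ?thesis by simp
  qed
  then have *: "(\<Sum>b<s. if \<delta> c \<le> a then hom_comp (a - \<delta> c) (u b * D b c) else 0) =
      (\<Sum>b<s. vcomp \<delta>' a u b * D b c)" by (intro sum.cong) auto
  show "vcomp \<delta> a (\<lambda>c. \<Sum>b<s. u b * D b c) c = (\<Sum>b<s. vcomp \<delta>' a u b * D b c)"
    unfolding *[symmetric] by (simp add: vcomp_def hom_comp_sum)
qed

section \<open>Leading terms and finite generation\<close>

text \<open>The position decides before the monomial, and monomials are compared in the linear order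
  on exponent vectors, which is compatible with addition.\<close>

definition lead_ix :: "(nat \<Rightarrow> ('k::field) mpoly) \<Rightarrow> nat" where
  "lead_ix u = (LEAST b. u b \<noteq> 0)"

definition lead_mon :: "(nat \<Rightarrow> ('k::field) mpoly) \<Rightarrow> (nat \<Rightarrow>\<^sub>0 nat)" where
  "lead_mon u = Max (Poly_Mapping.keys (u (lead_ix u)))"

lemma lead_ix: "u \<noteq> (\<lambda>_. 0) \<Longrightarrow> u (lead_ix u) \<noteq> 0"
  unfolding lead_ix_def by (rule LeastI_ex) auto

lemma lead_ix_least: "b < lead_ix u \<Longrightarrow> u b = 0"
  unfolding lead_ix_def using not_less_Least by blast

lemma lead_mon_key: "u \<noteq> (\<lambda>_. 0) \<Longrightarrow> lead_mon u \<in> Poly_Mapping.keys (u (lead_ix u))"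
  unfolding lead_mon_def using lead_ix[of u] keys_nonempty by (intro Max_in) auto

lemma lead_mon_ge: "t \<in> Poly_Mapping.keys (u (lead_ix u)) \<Longrightarrow> t \<le> lead_mon u"
  unfolding lead_mon_def by simp

text \<open>Dickson's lemma is applied to the leading monomials of the homogeneous elements.\<close>

lemma graded_sub_finitely_generated:
  fixes P :: "(nat \<Rightarrow> ('k::field) mpoly) set"
  assumes P: "graded_sub N r \<delta> P"
  shows "\<exists>G. finite G \<and> G \<subseteq> P \<and> (\<forall>g\<in>G. \<exists>a. vcomp \<delta> a g = g) \<and>
    (\<forall>u\<in>P. \<exists>c. (\<forall>g. c g \<in> polys N) \<and> u = (\<lambda>b. \<Sum>g\<in>G. c g * g b))"
proof -
  define H where "H = {u \<in> P. u \<noteq> (\<lambda>_. 0) \<and> (\<exists>a. vcomp \<delta> a u = u)}"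
  have Pfm: "u \<in> fm N r" if "u \<in> P" for u using P that by (auto simp: graded_sub_def)
  have HP: "u \<in> P" "u \<noteq> (\<lambda>_. 0)" if "u \<in> H" for u using that by (auto simp: H_def)
  \<comment> \<open>Leading monomials are collected separately for each leading index, because one
    vector can reduce another only if both lead in the same coordinate.\<close>
  define E where "E b = lead_mon ` {u \<in> H. lead_ix u = b}" for b
  have "Poly_Mapping.keys t \<subseteq> {..N}" if tE: "t \<in> E b" for t b
  proof -
    from tE obtain u where u: "u \<in> H" "t = lead_mon u" unfolding E_def by blast
    then have "t \<in> Poly_Mapping.keys (u (lead_ix u))" using lead_mon_key HP by blast
    then show ?thesis using fm_polys[OF Pfm[OF HP(1)[OF u(1)]]] by (auto simp: polys_def)
  qed
  then have "\<exists>E0\<subseteq>E b. finite E0 \<and> (\<forall>t\<in>E b. \<exists>s\<in>E0. \<exists>r. t = s + r)" for b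
    by (rule dickson)
  then have "\<forall>b. \<exists>E0. E0 \<subseteq> E b \<and> finite E0 \<and> (\<forall>t\<in>E b. \<exists>s\<in>E0. \<exists>r. t = s + r)" by blast
  then obtain E0 where E0: "\<And>b. E0 b \<subseteq> E b" "\<And>b. finite (E0 b)"
    "\<And>b t. t \<in> E b \<Longrightarrow> \<exists>s\<in>E0 b. \<exists>r. t = s + r"
    unfolding choice_iff by meson
  have "\<exists>u. u \<in> H \<and> lead_ix u = b \<and> lead_mon u = t" if "t \<in> E0 b" for b t
    using E0(1)[of b] that by (auto simp: E_def)
  then have "\<forall>b t. \<exists>u. t \<in> E0 b \<longrightarrow> u \<in> H \<and> lead_ix u = b \<and> lead_mon u = t"
    by blast
  then obtain U where "\<forall>b t. t \<in> E0 b \<longrightarrow> U b t \<in> H \<and> lead_ix (U b t) = b \<and> lead_mon (U b t) = t"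
    unfolding choice_iff by blast
  then have U: "\<And>b t. t \<in> E0 b \<Longrightarrow> U b t \<in> H \<and> lead_ix (U b t) = b \<and> lead_mon (U b t) = t"
    by blast
  define G where "G = (\<Union>b<r. U b ` E0 b)"
  have finG: "finite G" unfolding G_def using E0(2) by auto
  have GH: "G \<subseteq> H" unfolding G_def using U by auto
  define Sp where "Sp = {(\<lambda>b. \<Sum>g\<in>G. c g * g b) | c. \<forall>g. c g \<in> polys N}"
  have Sp_add: "(\<lambda>b. u b + v b) \<in> Sp" if uv: "u \<in> Sp" "v \<in> Sp" for u v
  proof -
    obtain c c' where "\<forall>g. c g \<in> polys N" "\<forall>g. c' g \<in> polys N"
      "u = (\<lambda>b. \<Sum>g\<in>G. c g * g b)" "v = (\<lambda>b. \<Sum>g\<in>G. c' g * g b)"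
      using uv by (auto simp: Sp_def)
    then show ?thesis unfolding Sp_def
      by (intro CollectI exI[of _ "\<lambda>g. c g + c' g"]) (auto simp: distrib_right sum.distrib)
  qed
  have Sp_0: "(\<lambda>_. 0) \<in> Sp" unfolding Sp_def by (intro CollectI exI[of _ "\<lambda>_. 0"]) auto
  have Sp_gen: "(\<lambda>b. p * g b) \<in> Sp" if "g \<in> G" "p \<in> polys N" for p g
    unfolding Sp_def using that finG
    by (intro CollectI exI[of _ "\<lambda>h. if h = g then p else 0"])
      (auto simp: if_distrib[where f="\<lambda>x. x * _"] cong: if_cong)
  have hom: "u \<in> Sp" if ua: "u \<in> P" "vcomp \<delta> a u = u" for u a
  proof -
    \<comment> \<open>The leading monomials met while reducing a vector of degree \<open>a\<close>
      all lie in this finite set.\<close>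
    define T where "T = {t :: nat \<Rightarrow>\<^sub>0 nat. Poly_Mapping.keys t \<subseteq> {..N} \<and> mon_deg t \<le> a}"
    have finT: "finite T" unfolding T_def by (rule finite_monomials)
    \<comment> \<open>\<open>K\<close> exceeds the number of monomials in \<open>T\<close>, so
      \<open>rank\<close> encodes a lexicographic measure: moving the leading index to the right
      outweighs every change of the leading monomial.\<close>
    define K where "K = Suc (card T)"
    define rank where "rank u = (r - lead_ix u) * K + card {s \<in> T. s < lead_mon u}"
      for u :: "nat \<Rightarrow> 'k mpoly"
    show ?thesis using ua
    proof (induction "rank u" arbitrary: u rule: less_induct)
      case less
      show ?case
      proof (cases "u = (\<lambda>_. 0)")
        case False
        define b t where "b = lead_ix u" and "t = lead_mon u"
        have uH: "u \<in> H" using less.prems False by (auto simp: H_def)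
        have ub: "u b \<noteq> 0" using lead_ix False b_def by blast
        have br: "b < r" using ub fm_0[OF Pfm[OF less.prems(1)], of b] by (rule_tac ccontr) simp
        have "t \<in> E b" using uH by (auto simp: E_def b_def t_def)
        then obtain s \<rho> where s: "s \<in> E0 b" "t = s + \<rho>" using E0(3) by blast
        define g where "g = U b s"
        have gH: "g \<in> H" and gb: "lead_ix g = b" and gs: "lead_mon g = s"
          using U[OF s(1)] by (auto simp: g_def)
        have gG: "g \<in> G" using s(1) br by (auto simp: G_def g_def)
        obtain a' where a': "vcomp \<delta> a' g = g" using gH by (auto simp: H_def)
        have tk: "t \<in> Poly_Mapping.keys (u b)" using lead_mon_key False by (auto simp: t_def b_def)
        have sk: "s \<in> Poly_Mapping.keys (g b)" using lead_mon_key[of g] HP(2)[OF gH] gb gs by auto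
        have ut: "\<delta> b \<le> a" "is_form N (a - \<delta> b) (u b)"
          using vcomp_form[OF Pfm[OF less.prems(1)] less.prems(2), of b] ub by (auto split: if_splits)
        have gt: "\<delta> b \<le> a'" "is_form N (a' - \<delta> b) (g b)"
          using vcomp_form[OF Pfm[OF HP(1)[OF gH]] a', of b] sk by (auto split: if_splits)
        have "mon_deg t = a - \<delta> b" "mon_deg s = a' - \<delta> b"
          using ut gt tk sk by (auto simp: is_form_def)
        moreover have "mon_deg t = mon_deg s + mon_deg \<rho>" by (simp add: s(2) mon_deg_add)
        \<comment> \<open>Hence the multiple of \<open>g\<close> subtracted below is homogeneous of
          degree \<open>a\<close>, like \<open>u\<close>, and so is the reduced vector
          \<open>v\<close>.\<close>
        ultimately have aa': "a = a' + mon_deg \<rho>" using ut(1) gt(1) by linarith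
        have tN: "Poly_Mapping.keys t \<subseteq> {..N}" using ut(2) tk by (auto simp: is_form_def polys_def)
        then have \<rho>N: "Poly_Mapping.keys \<rho> \<subseteq> {..N}" using s(2) by (simp add: keys_add_nat)
        define c where "c = Poly_Mapping.lookup (u b) t / Poly_Mapping.lookup (g b) s"
        define p where "p = Poly_Mapping.single \<rho> c"
        have p: "is_form N (mon_deg \<rho>) p" "p \<in> polys N" unfolding p_def using \<rho>N by (auto intro: is_form_single)
        define v where "v = (\<lambda>b. u b + (- p) * g b)"
        have vP: "v \<in> P" unfolding v_def
          by (rule graded_subD(2)[OF P less.prems(1)
            graded_subD(3)[OF P polys_uminus[OF p(2)] HP(1)[OF gH]]])
        have va: "vcomp \<delta> a v = v"
          unfolding v_def vcomp_add vcomp_mult_form[OF is_form_uminus[OF p(1)]]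
          using less.prems(2) a' aa' by simp
        have vb0: "v b' = 0" if "b' < b" for b'
          using that lead_ix_least[of b' u] lead_ix_least[of b' g] gb by (simp add: v_def b_def)
        have lk: "Poly_Mapping.lookup (p * g b) (\<rho> + x) = c * Poly_Mapping.lookup (g b) x" for x
        proof -
          have "p * g b = (\<Sum>y\<in>Poly_Mapping.keys (g b). Poly_Mapping.single (\<rho> + y) (c * Poly_Mapping.lookup (g b) y))"
            by (subst mpoly_sum_singles[of "g b"]) (simp add: p_def sum_distrib_left mult_single)
          then show ?thesis by (simp add: lookup_sum lookup_single when_def in_keys_iff)
        qed
        have vt: "t \<notin> Poly_Mapping.keys (v b)"
          using lk[of s] s(2) sk by (simp add: in_keys_iff v_def lookup_add lookup_minus c_def add.commute)
        have vle: "x \<le> t" if "x \<in> Poly_Mapping.keys (v b)" for x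
        proof -
          have "x \<in> Poly_Mapping.keys (u b) \<or> x \<in> Poly_Mapping.keys (p * g b)"
            using that by (auto simp: in_keys_iff v_def lookup_minus)
          then show ?thesis
          proof
            assume "x \<in> Poly_Mapping.keys (u b)"
            then show ?thesis using lead_mon_ge[of x u] by (simp add: b_def t_def)
          next
            assume "x \<in> Poly_Mapping.keys (p * g b)"
            then obtain y where y: "y \<in> Poly_Mapping.keys (g b)" "x = \<rho> + y"
              using keys_mult[of p "g b"] by (auto simp: p_def split: if_splits)
            then have "y \<le> s" using lead_mon_ge[of y g] gb gs by simp
            then show ?thesis using y(2) s(2) by (simp add: add.commute add_left_mono)
          qed
        qed
        have "v \<in> Sp"
        proof (cases "v = (\<lambda>_. 0)")
          case True
          then show ?thesis using Sp_0 by simp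
        next
          case v0: False
          have "lead_ix v \<ge> b" using vb0 lead_ix[OF v0] by (meson not_less)
          have "rank v < rank u"
          proof (cases "lead_ix v = b")
            case True
            then have "lead_mon v \<in> Poly_Mapping.keys (v b)" using lead_mon_key[OF v0] by simp
            then have "lead_mon v < t" using vle vt by (metis order_less_le)
            moreover have "lead_mon v \<in> T"
            proof -
              have "is_form N (a - \<delta> b) (v b)"
                using vcomp_form[OF Pfm[OF vP] va, of b] ut(1) by simp
              then show ?thesis using \<open>lead_mon v \<in> Poly_Mapping.keys (v b)\<close>
                by (auto simp: is_form_def polys_def T_def)
            qed
            ultimately have "{s \<in> T. s < lead_mon v} \<subset> {s \<in> T. s < t}" by auto
            then have "card {s \<in> T. s < lead_mon v} < card {s \<in> T. s < t}"
              using finT by (intro psubset_card_mono) auto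
            then show ?thesis using True by (simp add: rank_def b_def t_def)
          next
            case False
            then have "r - lead_ix u \<ge> Suc (r - lead_ix v)" using \<open>lead_ix v \<ge> b\<close> br b_def by linarith
            then have "Suc (r - lead_ix v) * K \<le> (r - lead_ix u) * K" by (rule mult_le_mono1)
            moreover have "card {s \<in> T. s < lead_mon v} < K"
              unfolding K_def using finT by (simp add: less_Suc_eq_le card_mono)
            ultimately show ?thesis by (simp add: rank_def)
          qed
          then show ?thesis using less.hyps vP va by blast
        qed
        then have "(\<lambda>b. v b + p * g b) \<in> Sp" using Sp_add Sp_gen[OF gG p(2)] by blast
        then show ?thesis by (simp add: v_def)
      qed (use Sp_0 in simp)
    qed
  qed
  have "u \<in> Sp" if u: "u \<in> P" for u
  proof -
    obtain M where M: "\<And>b. u b = (\<Sum>a\<le>M. vcomp \<delta> a u b)" using vcomp_decomp[OF Pfm[OF u]] by blast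
    have vv: "vcomp \<delta> a (vcomp \<delta> a u) = vcomp \<delta> a u" for a
      by (auto simp: vcomp_def hom_comp_form[OF is_form_hom_comp[OF fm_polys[OF Pfm[OF u]]]])
    have "(\<lambda>b. \<Sum>a<n. vcomp \<delta> a u b) \<in> Sp" for n
    proof (induction n)
      case (Suc n)
      have "vcomp \<delta> n u \<in> Sp" using hom[OF _ vv] P u by (auto simp: graded_sub_def)
      from Sp_add[OF Suc this] show ?case by simp
    qed (use Sp_0 in simp)
    from this[of "Suc M"] have "(\<lambda>b. \<Sum>a\<le>M. vcomp \<delta> a u b) \<in> Sp"
      by (simp only: lessThan_Suc_atMost)
    moreover have "u = (\<lambda>b. \<Sum>a\<le>M. vcomp \<delta> a u b)" by (rule ext) (rule M)
    ultimately show ?thesis by (rule ssubst[where P="\<lambda>x. x \<in> Sp", rotated])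
  qed
  then have "\<forall>u\<in>P. \<exists>c. (\<forall>g. c g \<in> polys N) \<and> u = (\<lambda>b. \<Sum>g\<in>G. c g * g b)"
    by (auto simp: Sp_def)
  moreover have "G \<subseteq> P" "\<forall>g\<in>G. \<exists>a. vcomp \<delta> a g = g" using GH by (auto simp: H_def)
  ultimately show ?thesis using finG by blast
qed

section \<open>Presentations and kernels\<close>

lemma graded_sub_lincomb_mem:
  fixes s :: nat
  assumes P: "graded_sub N r \<delta> P" and D: "\<And>b. b < s \<Longrightarrow> D b \<in> P" and u: "\<And>b. u b \<in> polys N"
  shows "(\<lambda>c. \<Sum>b<s. u b * D b c) \<in> P"
  using D
proof (induction s)
  case 0
  show ?case using P by (simp add: graded_sub_def)
next
  case (Suc s)
  have "(\<lambda>c. \<Sum>b<s. u b * D b c) \<in> P" using Suc by simp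
  moreover have "(\<lambda>c. u s * D s c) \<in> P" using P u Suc.prems[of s] by (simp add: graded_sub_def)
  ultimately have "(\<lambda>c. (\<Sum>b<s. u b * D b c) + u s * D s c) \<in> P"
    by (rule graded_subD(2)[OF P])
  then show ?case by simp
qed

lemma graded_sub_presentation:
  fixes P :: "(nat \<Rightarrow> ('k::field) mpoly) set"
  assumes P: "graded_sub N r \<delta> P"
  shows "\<exists>s \<delta>' D. (\<forall>b<s. D b \<in> fm N r \<and> vcomp \<delta> (\<delta>' b) (D b) = D b) \<and>
    P = (\<lambda>u c. \<Sum>b<s. u b * D b c) ` fm N s"
proof -
  obtain G where G: "finite G" "G \<subseteq> P" "\<And>g. g \<in> G \<Longrightarrow> \<exists>a. vcomp \<delta> a g = g"
    "\<And>u. u \<in> P \<Longrightarrow> \<exists>c. (\<forall>g. c g \<in> polys N) \<and> u = (\<lambda>b. \<Sum>g\<in>G. c g * g b)"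
    using graded_sub_finitely_generated[OF P] by blast
  obtain D where D: "bij_betw D {..<card G} G"
    using ex_bij_betw_nat_finite[OF G(1)] by (auto simp: atLeast0LessThan)
  obtain \<alpha> where \<alpha>: "\<And>g. g \<in> G \<Longrightarrow> vcomp \<delta> (\<alpha> g) g = g" using G(3) by metis
  have DG: "D b \<in> G" if "b < card G" for b using D that by (auto simp: bij_betw_def)
  have "P = (\<lambda>u c. \<Sum>b<card G. u b * D b c) ` fm N (card G)"
  proof (intro equalityI subsetI)
    fix u assume "u \<in> P"
    then obtain c where c: "\<forall>g. c g \<in> polys N" "u = (\<lambda>b. \<Sum>g\<in>G. c g * g b)" using G(4) by blast
    have "(\<Sum>g\<in>G. c g * g x) = (\<Sum>b<card G. c (D b) * D b x)" for x
      by (rule sum.reindex_bij_betw[OF D, symmetric])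
    also have "\<dots> x = (\<Sum>b<card G. (if b < card G then c (D b) else 0) * D b x)" for x
      by (intro sum.cong) auto
    finally have "u = (\<lambda>x. \<Sum>b<card G. (if b < card G then c (D b) else 0) * D b x)"
      using c(2) by auto
    moreover have "(\<lambda>b. if b < card G then c (D b) else 0) \<in> fm N (card G)"
      using c(1) by (auto simp: fm_def)
    ultimately show "u \<in> (\<lambda>u c. \<Sum>b<card G. u b * D b c) ` fm N (card G)"
      by (rule image_eqI)
  next
    fix u assume "u \<in> (\<lambda>u c. \<Sum>b<card G. u b * D b c) ` fm N (card G)"
    then obtain v where v: "v \<in> fm N (card G)" "u = (\<lambda>c. \<Sum>b<card G. v b * D b c)" by blast
    show "u \<in> P" unfolding v(2)
      by (rule graded_sub_lincomb_mem[OF P]) (use DG G(2) fm_polys[OF v(1)] in auto)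
  qed
  moreover have "\<forall>b<card G. D b \<in> fm N r \<and> vcomp \<delta> (\<alpha> (D b)) (D b) = D b"
    using DG G(2) P \<alpha> by (auto simp: graded_sub_def)
  ultimately show ?thesis
    by (intro exI[of _ "card G"] exI[of _ "\<lambda>b. \<alpha> (D b)"] exI[of _ D]) blast
qed

lemma graded_sub_kernel:
  assumes D: "\<And>b. b < s \<Longrightarrow> D b \<in> fm N r \<and> vcomp \<delta> (\<delta>' b) (D b) = D b"
  shows "graded_sub N s \<delta>' {u \<in> fm N s. (\<lambda>c. \<Sum>b<s. u b * D b c) = (\<lambda>_. 0)}"
  unfolding graded_sub_def
proof (intro conjI ballI allI)
  let ?K = "{u \<in> fm N s. (\<lambda>c. \<Sum>b<s. u b * D b c) = (\<lambda>_. 0)}"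
  show "?K \<subseteq> fm N s" by blast
  show "(\<lambda>_. 0) \<in> ?K" by (auto simp: fm_def)
  show "(\<lambda>b. u b + v b) \<in> ?K" if "u \<in> ?K" "v \<in> ?K" for u v
    using that by (auto simp: fm_add distrib_right sum.distrib fun_eq_iff)
  show "(\<lambda>b. p * u b) \<in> ?K" if "p \<in> polys N" "u \<in> ?K" for p u
    using that by (auto simp: fm_mult mult.assoc fun_eq_iff simp flip: sum_distrib_left)
  show "vcomp \<delta>' a u \<in> ?K" if "u \<in> ?K" for a u
    using that by (auto simp: fm_vcomp vcomp_def[of \<delta>] simp flip: vcomp_lincomb[OF D])
qed

section \<open>Existence of graded free resolutions\<close>

lemma free_mod_fm: "free_mod N F i = fm N (rk F i)"
  by (simp add: free_mod_def fm_def)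

text \<open>\<open>resolution_of\<close> is a choice operator, so nothing follows about Betti
  numbers before this. Covering a submodule by a free module and passing to the kernel alternate;
  each cover depends on the previous kernel, hence dependent choice on triples of rank, degrees and
  submodule to be covered.\<close>

theorem graded_free_resolution_exists:
  fixes I :: "('k::field) mpoly set"
  assumes I: "I \<subseteq> polys N" "0 \<in> I" "\<And>f g. f \<in> I \<Longrightarrow> g \<in> I \<Longrightarrow> f + g \<in> I"
    "\<And>f g. f \<in> polys N \<Longrightarrow> g \<in> I \<Longrightarrow> f * g \<in> I" "\<And>m f. f \<in> I \<Longrightarrow> hom_comp m f \<in> I"
  shows "\<exists>F. graded_free_resolution N I F"
proof -
  \<comment> \<open>\<open>F_0\<close> is the ring itself, with generator in degree 0, and the first
    submodule to be covered is \<open>I\<close>, as vectors with one coordinate.\<close>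
  define P0 where "P0 = {u \<in> fm N 1. u 0 \<in> I}"
  have P0: "graded_sub N 1 (\<lambda>_. 0) P0"
    unfolding graded_sub_def P0_def using I
    by (auto simp: fm_add fm_mult fm_vcomp vcomp_def) (auto simp: fm_def)
  define gens where "gens r \<delta> P s \<delta>' D \<longleftrightarrow>
      (\<forall>b<s. D b \<in> fm N r \<and> vcomp \<delta> (\<delta>' b) (D b) = D b) \<and> P = (\<lambda>u c. \<Sum>b<s. u b * D b c) ` fm N s"
    for r \<delta> and P :: "(nat \<Rightarrow> 'k mpoly) set" and s \<delta>' D
  define ok where "ok n x \<longleftrightarrow> (case x of (r, \<delta>, P) \<Rightarrow> graded_sub N r \<delta> P) \<and> (n = 0 \<longrightarrow> x = (1, \<lambda>_. 0, P0))"
    for n :: nat and x :: "nat \<times> (nat \<Rightarrow> nat) \<times> (nat \<Rightarrow> 'k mpoly) set"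
  define step where "step x y \<longleftrightarrow> (case x of (r, \<delta>, P) \<Rightarrow> case y of (s, \<delta>', K) \<Rightarrow>
      \<exists>D. gens r \<delta> P s \<delta>' D \<and> K = {u \<in> fm N s. (\<lambda>c. \<Sum>b<s. u b * D b c) = (\<lambda>_. 0)})"
    for x y :: "nat \<times> (nat \<Rightarrow> nat) \<times> (nat \<Rightarrow> 'k mpoly) set"
  have "\<exists>f. \<forall>n. ok n (f n) \<and> step (f n) (f (Suc n))"
  proof (rule dependent_nat_choice[where Q="\<lambda>_. step"])
    show "\<exists>x. ok 0 x" using P0 by (auto simp: ok_def)
    fix x n assume "ok n x"
    then obtain r \<delta> P where x: "x = (r, \<delta>, P)" "graded_sub N r \<delta> P" by (cases x) (auto simp: ok_def)
    obtain s \<delta>' D where D: "gens r \<delta> P s \<delta>' D"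
      using graded_sub_presentation[OF x(2)] unfolding gens_def by blast
    then have "graded_sub N s \<delta>' {u \<in> fm N s. (\<lambda>c. \<Sum>b<s. u b * D b c) = (\<lambda>_. 0)}"
      by (intro graded_sub_kernel) (auto simp: gens_def)
    then show "\<exists>y. ok (Suc n) y \<and> step x y"
      using D by (intro exI[of _ "(s, \<delta>', {u \<in> fm N s. (\<lambda>c. \<Sum>b<s. u b * D b c) = (\<lambda>_. 0)})"])
        (auto simp: ok_def step_def x)
  qed
  then obtain f where f: "\<And>n. ok n (f n)" "\<And>n. step (f n) (f (Suc n))" by blast
  define r \<delta> P where "r n = fst (f n)" and "\<delta> n = fst (snd (f n))" and "P n = snd (snd (f n))" for n
  have "\<exists>D. gens (r n) (\<delta> n) (P n) (r (Suc n)) (\<delta> (Suc n)) D \<and>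
      P (Suc n) = {u \<in> fm N (r (Suc n)). (\<lambda>c. \<Sum>b<r (Suc n). u b * D b c) = (\<lambda>_. 0)}" for n
    using f(2)[of n] by (auto simp: step_def r_def \<delta>_def P_def split: prod.splits)
  then have "\<exists>D. \<forall>n. gens (r n) (\<delta> n) (P n) (r (Suc n)) (\<delta> (Suc n)) (D n) \<and>
      P (Suc n) = {u \<in> fm N (r (Suc n)). (\<lambda>c. \<Sum>b<r (Suc n). u b * D n b c) = (\<lambda>_. 0)}"
    by (intro choice allI)
  then obtain D where D: "\<And>n. gens (r n) (\<delta> n) (P n) (r (Suc n)) (\<delta> (Suc n)) (D n)"
    and K: "\<And>n. P (Suc n) = {u \<in> fm N (r (Suc n)). (\<lambda>c. \<Sum>b<r (Suc n). u b * D n b c) = (\<lambda>_. 0)}"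
    by blast
  have start: "r 0 = 1" "\<delta> 0 = (\<lambda>_. 0)" "P 0 = P0"
    using f(1)[of 0] by (auto simp: ok_def r_def \<delta>_def P_def)
  define F where "F = \<lparr>rk = r, dg = \<delta>, df = D, aug = \<lambda>_. 1\<rparr>"
  have rkF: "rk F = r" by (simp add: F_def)
  have Dfm: "D n b \<in> fm N (r n)" if "b < r (Suc n)" for n b using D[of n] that by (auto simp: gens_def)
  have diff: "diff_map F n u = (\<lambda>c. \<Sum>b<r (Suc n). u b * D n b c)" for n u
    using fm_0[OF Dfm] by (auto simp: diff_map_def F_def fun_eq_iff intro!: sum.neutral[symmetric])
  have im: "P n = diff_map F n ` free_mod N F (Suc n)" for n
  proof -
    have "diff_map F n = (\<lambda>u c. \<Sum>b<r (Suc n). u b * D n b c)" by (rule ext) (rule diff)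
    then show ?thesis using D[of n] by (simp add: gens_def free_mod_fm rkF)
  qed
  have "is_form N (dg F 0 b) (aug F b)" if "b < rk F 0" for b
    using that by (simp add: F_def start)
  moreover have "df F i b c = 0 \<or> (dg F i c \<le> dg F (Suc i) b \<and> is_form N (dg F (Suc i) b - dg F i c) (df F i b c))"
    if "b < rk F (Suc i)" for i b c
    using vcomp_form[OF Dfm, of b i "\<delta> i" "\<delta> (Suc i) b" c] D[of i] that by (auto simp: F_def gens_def split: if_splits)
  moreover have "\<exists>u\<in>free_mod N F 0. f - aug_map F u \<in> I" if "f \<in> polys N" for f
    using that I(2) by (intro bexI[of _ "\<lambda>b. if b = 0 then f else 0"])
      (auto simp: aug_map_def F_def start free_mod_fm fm_def)
  moreover have "{u \<in> free_mod N F 0. aug_map F u \<in> I} = diff_map F 0 ` free_mod N F 1"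
    using im[of 0] by (simp add: start P0_def free_mod_fm aug_map_def F_def)
  moreover have "{u \<in> free_mod N F (Suc i). diff_map F i u = (\<lambda>_. 0)}
            = diff_map F (Suc i) ` free_mod N F (Suc (Suc i))" for i
    using im[of "Suc i"] K[of i] by (simp add: free_mod_fm diff rkF)
  ultimately have "graded_free_resolution N I F"
    unfolding graded_free_resolution_def by blast
  then show ?thesis by blast
qed

section \<open>Vanishing Betti numbers\<close>

lemma vcomp_idem:
  assumes "u \<in> fm N r"
  shows "vcomp \<delta> a (vcomp \<delta> a u) = vcomp \<delta> a u"
proof
  fix b
  show "vcomp \<delta> a (vcomp \<delta> a u) b = vcomp \<delta> a u b"
    using hom_comp_form[OF is_form_hom_comp[OF fm_polys[OF assms, of b]], of "a - \<delta> b" "a - \<delta> b"]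
    by (simp add: vcomp_def)
qed

locale hom_ideal =
  fixes N :: nat and I :: "('k::field) mpoly set"
  assumes I_polys: "f \<in> I \<Longrightarrow> f \<in> polys N" and I_0: "0 \<in> I"
    and I_add: "f \<in> I \<Longrightarrow> g \<in> I \<Longrightarrow> f + g \<in> I"
    and I_mult: "f \<in> polys N \<Longrightarrow> g \<in> I \<Longrightarrow> f * g \<in> I"
    and I_hom: "f \<in> I \<Longrightarrow> hom_comp m f \<in> I"
begin

lemma I_scale: "f \<in> I \<Longrightarrow> pscale c f \<in> I"
  unfolding pscale_def by (rule I_mult) auto

lemma I_uminus: "f \<in> I \<Longrightarrow> - f \<in> I"
  using I_mult[of "-1" f] by simp

lemma I_diff: "f \<in> I \<Longrightarrow> g \<in> I \<Longrightarrow> f - g \<in> I"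
  using I_add[OF _ I_uminus, of f g] by simp

end

locale resolved_ideal = hom_ideal N I for N and I :: "('k::field) mpoly set" +
  fixes F :: "'k gfree"
  assumes res: "graded_free_resolution N I F"
begin

lemmas res_conj = res[unfolded graded_free_resolution_def]

lemma aug_form: "b < rk F 0 \<Longrightarrow> is_form N (dg F 0 b) (aug F b)"
  using conjunct1[OF res_conj] by simp

lemma df_form: "b < rk F (Suc i) \<Longrightarrow> c < rk F i \<Longrightarrow> df F i b c = 0 \<or>
    (dg F i c \<le> dg F (Suc i) b \<and> is_form N (dg F (Suc i) b - dg F i c) (df F i b c))"
  using conjunct1[OF conjunct2[OF res_conj]] by simp

lemma aug_onto: "f \<in> polys N \<Longrightarrow> \<exists>u\<in>free_mod N F 0. f - aug_map F u \<in> I"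
  using conjunct1[OF conjunct2[OF conjunct2[OF res_conj]]] by simp

lemma exact0: "{u \<in> free_mod N F 0. aug_map F u \<in> I} = diff_map F 0 ` free_mod N F 1"
  using conjunct1[OF conjunct2[OF conjunct2[OF conjunct2[OF res_conj]]]] .

lemma exact: "{u \<in> free_mod N F (Suc i). diff_map F i u = (\<lambda>_. 0)} = diff_map F (Suc i) ` free_mod N F (Suc (Suc i))"
  by (rule conjunct2[OF conjunct2[OF conjunct2[OF conjunct2[OF res_conj]]], THEN spec])

text \<open>The record constrains \<open>df i b c\<close> only for indices within the ranks. Zeros
  beyond them make each \<open>dfx i b\<close> a vector of the free module.\<close>

definition dfx :: "nat \<Rightarrow> nat \<Rightarrow> nat \<Rightarrow> 'k mpoly" where
  "dfx i b c = (if c < rk F i then df F i b c else 0)"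

lemma diff_map_dfx: "diff_map F i u = (\<lambda>c. \<Sum>b<rk F (Suc i). u b * dfx i b c)"
  by (rule ext) (simp add: diff_map_def dfx_def)

lemma dfx:
  assumes "b < rk F (Suc i)"
  shows "dfx i b \<in> fm N (rk F i) \<and> vcomp (dg F i) (dg F (Suc i) b) (dfx i b) = dfx i b"
proof
  show "dfx i b \<in> fm N (rk F i)"
  proof -
    have "df F i b c \<in> polys N" if "c < rk F i" for c
      using df_form[OF assms that] is_form_polys by force
    then show ?thesis by (simp add: fm_def dfx_def)
  qed
  show "vcomp (dg F i) (dg F (Suc i) b) (dfx i b) = dfx i b"
  proof
    fix c
    show "vcomp (dg F i) (dg F (Suc i) b) (dfx i b) c = dfx i b c"
      using df_form[OF assms, of c] by (auto simp: vcomp_def dfx_def hom_comp_form)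
  qed
qed

lemma diff_map_vcomp:
  "diff_map F i (vcomp (dg F (Suc i)) a u) = vcomp (dg F i) a (diff_map F i u)"
  unfolding diff_map_dfx by (rule vcomp_lincomb[symmetric]) (rule dfx)

lemma diff_map_diff: "diff_map F i (\<lambda>b. u b - v b) = (\<lambda>c. diff_map F i u c - diff_map F i v c)"
  by (simp add: diff_map_dfx left_diff_distrib sum_subtractf)

lemma diff_map_mult: "diff_map F i (\<lambda>b. p * u b) = (\<lambda>c. p * diff_map F i u c)"
  by (simp add: diff_map_dfx sum_distrib_left mult.assoc)

lemma diff_map_sum: "diff_map F i (\<lambda>b. \<Sum>j\<in>S. u j b) = (\<lambda>c. \<Sum>j\<in>S. diff_map F i (u j) c)"
proof
  fix c
  show "diff_map F i (\<lambda>b. \<Sum>j\<in>S. u j b) c = (\<Sum>j\<in>S. diff_map F i (u j) c)"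
    unfolding diff_map_dfx sum_distrib_right by (rule sum.swap)
qed

lemma diff_map_free_mod: "u \<in> free_mod N F (Suc i) \<Longrightarrow> diff_map F i u \<in> free_mod N F i"
  using fm_polys[OF conjunct1[OF dfx]] fm_polys[of u N]
  by (auto simp: free_mod_fm fm_def diff_map_dfx intro!: polys_sum polys_mult sum.neutral)
    (simp add: dfx_def)

lemma diff_diff: "u \<in> free_mod N F (Suc (Suc i)) \<Longrightarrow> diff_map F i (diff_map F (Suc i) u) = (\<lambda>_. 0)"
  using exact[of i] by blast

text \<open>
  If \<open>F \<otimes> k\<close> has no homology at \<open>F\<^bsub>i+1\<^esub>\<close> in degree \<open>a\<close>, the constant terms of a lift of \<open>z\<close> can be
  removed by a boundary, so that \<open>z\<close> lies in the irrelevant ideal times the image.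
\<close>

lemma image_in_irrelevant_multiple:
  assumes B: "quot_dim vscale (fib_ker F (Suc i) a) (fib_map F (Suc i) ` fib F (Suc (Suc i)) a) 0"
    and u: "u \<in> free_mod N F (Suc i)" and z: "z = diff_map F i u"
    and hz: "vcomp (dg F i) a z = z" and c0: "\<And>c. Poly_Mapping.lookup (z c) 0 = 0"
  shows "\<exists>v. (\<forall>j. v j \<in> free_mod N F (Suc i)) \<and> z = (\<lambda>c. \<Sum>j\<le>N. pvar j * diff_map F i (v j) c)"
proof -
  let ?l = "\<lambda>f::'k mpoly. Poly_Mapping.lookup f 0"
  \<comment> \<open>The assumption on homology concerns degree \<open>a\<close> only, so the lift is
    made homogeneous.\<close>
  define u0 where "u0 = vcomp (dg F (Suc i)) a u"
  have u0: "u0 \<in> free_mod N F (Suc i)" using u by (simp add: u0_def free_mod_fm fm_vcomp)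
  have z0: "diff_map F i u0 = z" unfolding u0_def diff_map_vcomp using z hz by simp
  define x where "x b = ?l (u0 b)" for b
  have "b < rk F (Suc i) \<and> dg F (Suc i) b = a" if "x b \<noteq> 0" for b
  proof
    show "b < rk F (Suc i)"
      using that fm_0[OF u0[unfolded free_mod_fm], of b] by (rule_tac ccontr) (simp add: x_def)
    show "dg F (Suc i) b = a"
      using that by (auto simp: x_def u0_def vcomp_def lookup_hom_comp split: if_splits)
  qed
  then have "x \<in> fib F (Suc i) a" by (auto simp: fib_def)
  moreover have "fib_map F i x c = 0" for c
  proof (cases "c < rk F i")
    case True
    then have "fib_map F i x c = ?l (z c)"
      unfolding z0[symmetric] by (simp add: fib_map_def diff_map_def x_def const_term_peval peval_sum)
    then show ?thesis using c0 by simp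
  qed (simp add: fib_map_def)
  ultimately have "x \<in> fib_ker F (Suc i) a" by (auto simp: fib_ker_def)
  \<comment> \<open>For dimension 0 the linear combination in \<open>quot_dim\<close> is empty, so
    every cycle lies in the image.\<close>
  then have "x \<in> fib_map F (Suc i) ` fib F (Suc (Suc i)) a"
    using B by (auto simp: quot_dim_def)
  then obtain w where w: "w \<in> fib F (Suc (Suc i)) a" "x = fib_map F (Suc i) w" by blast
  \<comment> \<open>The chain \<open>w\<close> over the field is lifted to constant polynomials;
    subtracting its boundary kills the constant terms of the lift and does not affect the image
    \<open>z\<close>.\<close>
  define \<omega> :: "nat \<Rightarrow> 'k mpoly" where "\<omega> b = Poly_Mapping.single 0 (w b)" for b
  have \<omega>: "\<omega> \<in> free_mod N F (Suc (Suc i))"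
  proof -
    have "w b = 0" if "\<not> b < rk F (Suc (Suc i))" for b using w(1) that by (auto simp: fib_def)
    then show ?thesis by (simp add: \<omega>_def free_mod_def)
  qed
  define u1 where "u1 = (\<lambda>b. u0 b - diff_map F (Suc i) \<omega> b)"
  have u1: "u1 \<in> free_mod N F (Suc i)"
    using u0 diff_map_free_mod[OF \<omega>] by (simp add: u1_def free_mod_fm fm_diff)
  have z1: "diff_map F i u1 = z"
    unfolding u1_def diff_map_diff using z0 diff_diff[OF \<omega>] by simp
  have "?l (u1 b) = 0" for b
  proof (cases "b < rk F (Suc i)")
    case True
    then have "?l (diff_map F (Suc i) \<omega> b) = fib_map F (Suc i) w b"
      by (simp add: fib_map_def diff_map_def \<omega>_def const_term_peval peval_sum)
    then show ?thesis using w(2) x_def[of b] by (simp add: u1_def lookup_minus)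
  next
    case False
    then show ?thesis using u1 by (simp add: free_mod_def)
  qed
  then have "\<forall>b. \<exists>g. (\<forall>j. g j \<in> polys N) \<and> u1 b = (\<Sum>j\<le>N. pvar j * g j)"
    using const_term_0_expand fm_polys u1 unfolding free_mod_fm by blast
  then obtain g where g: "\<And>b j. g b j \<in> polys N" "\<And>b. u1 b = (\<Sum>j\<le>N. pvar j * g b j)"
    unfolding choice_iff by blast
  define v where "v j b = (if b < rk F (Suc i) then g b j else 0)" for j b
  have "u1 = (\<lambda>b. \<Sum>j\<le>N. pvar j * v j b)"
  proof
    fix b
    show "u1 b = (\<Sum>j\<le>N. pvar j * v j b)"
      using g(2)[of b] u1 by (cases "b < rk F (Suc i)") (simp_all add: v_def free_mod_def)
  qed
  then have "z = (\<lambda>c. \<Sum>j\<le>N. pvar j * diff_map F i (v j) c)"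
    unfolding z1[symmetric] by (simp only: diff_map_sum diff_map_mult)
  moreover have "v j \<in> free_mod N F (Suc i)" for j using g(1) by (simp add: v_def free_mod_def)
  ultimately show ?thesis by blast
qed

lemma aug_map_mult: "aug_map F (\<lambda>b. p * u b) = p * aug_map F u"
  by (simp add: aug_map_def sum_distrib_left mult.assoc)

lemma aug_map_sum: "aug_map F (\<lambda>b. \<Sum>j\<in>S. u j b) = (\<Sum>j\<in>S. aug_map F (u j))"
  unfolding aug_map_def sum_distrib_right by (rule sum.swap)

lemma aug_map_vcomp: "aug_map F (vcomp (dg F 0) a u) = hom_comp a (aug_map F u)"
  unfolding aug_map_def hom_comp_sum
proof (rule sum.cong)
  fix b assume "b \<in> {..<rk F 0}"
  then have "is_form N (dg F 0 b) (aug F b)" by (simp add: aug_form)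
  from hom_comp_mult_form[OF this, of a "u b"]
  show "vcomp (dg F 0) a u b * aug F b = hom_comp a (u b * aug F b)"
    by (simp add: vcomp_def)
qed simp

lemma aug_diff: "u \<in> free_mod N F (Suc 0) \<Longrightarrow> aug_map F (diff_map F 0 u) \<in> I"
  using exact0 by auto

text \<open>\<open>F_0\<close> may have several generators, so the unit of \<open>R/I\<close> has to
  be lifted. In degree 0 the lift maps to 1 exactly and not only modulo \<open>I\<close>, since a
  proper ideal contains no nonzero constant.\<close>

lemma unit_lift:
  assumes "1 \<notin> I"
  shows "\<exists>e\<in>free_mod N F 0. vcomp (dg F 0) 0 e = e \<and> aug_map F e = 1"
proof -
  obtain u where u: "u \<in> free_mod N F 0" "1 - aug_map F u \<in> I"
    using aug_onto[OF polys_1] by blast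
  define e where "e = vcomp (dg F 0) 0 u"
  have "vcomp (dg F 0) 0 e = e"
    unfolding e_def using u(1) by (simp add: free_mod_fm vcomp_idem)
  moreover have "e \<in> free_mod N F 0" using u(1) by (simp add: e_def free_mod_fm fm_vcomp)
  moreover have "aug_map F e = 1"
  proof -
    define f where "f = hom_comp 0 (1 - aug_map F u)"
    have fI: "f \<in> I" using u(2) I_hom by (simp add: f_def)
    have f0: "f = Poly_Mapping.single 0 (Poly_Mapping.lookup f 0)"
      by (rule poly_mapping_eqI) (auto simp: f_def lookup_hom_comp mon_deg_eq_0_iff lookup_single when_def)
    have "Poly_Mapping.lookup f 0 = 0"
    proof (rule ccontr)
      assume nz: "Poly_Mapping.lookup f 0 \<noteq> 0"
      have "pscale (inverse (Poly_Mapping.lookup f 0)) f = 1"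
        by (subst (2) f0) (simp add: pscale_def mult_single nz)
      then show False using I_scale[OF fI] assms by metis
    qed
    then have "f = 0" using f0 by simp
    moreover have "hom_comp 0 (1 - aug_map F u) + hom_comp 0 (aug_map F u) = hom_comp 0 1"
      by (simp flip: hom_comp_add)
    moreover have "hom_comp 0 (1::'k mpoly) = 1" by (simp add: hom_comp_form[OF is_form_1])
    ultimately show ?thesis by (simp add: e_def aug_map_vcomp f_def)
  qed
  ultimately show ?thesis by blast
qed

end

section \<open>Forms vanishing at a point\<close>

locale pointed =
  fixes N :: nat and w :: "nat \<Rightarrow> 'k::field" and i0 :: nat
  assumes i0: "i0 \<le> N" and w_i0: "w i0 = 1"
begin

abbreviation x0 :: "'k mpoly" where "x0 \<equiv> pvar i0"

text \<open>These linear forms generate the ideal of the point \<open>w\<close>; \<open>y i0 = 0\<close>.\<close>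

definition y :: "nat \<Rightarrow> 'k mpoly" where
  "y j = pvar j - pscale (w j) x0"

lemma is_form_y: "j \<le> N \<Longrightarrow> is_form N 1 (y j)"
  unfolding y_def using i0 by (intro is_form_diff is_form_scale is_form_pvar)

lemma polys_y [simp]: "j \<le> N \<Longrightarrow> y j \<in> polys N"
  by (rule is_form_polys) (rule is_form_y)

lemma peval_y: "peval (y j) v = v j - w j * v i0"
  by (simp add: y_def)

lemma peval_y_w [simp]: "peval (y j) w = 0"
  by (simp add: y_def w_i0)

text \<open>Modulo the \<open>y j\<close> each variable \<open>pvar j\<close> equals
  \<open>w j\<close> times \<open>x0\<close>, so a form of degree \<open>m\<close> becomes a scalar
  times \<open>x0 ^ m\<close>; the value at \<open>w\<close>, where \<open>x0\<close> is 1,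
  identifies the scalar. The clause for \<open>m = 0\<close> compensates the truncated
  \<open>m - 1\<close>, which would let nonzero constants through.\<close>

lemma form_expand_at_point:
  "is_form N m f \<Longrightarrow> \<exists>h. (\<forall>j. is_form N (m - 1) (h j) \<and> (m = 0 \<longrightarrow> h j = 0)) \<and>
    f = pscale (peval f w) (x0 ^ m) + (\<Sum>j\<le>N. y j * h j)"
proof (induction m arbitrary: f)
  case 0
  have "f = Poly_Mapping.single 0 (Poly_Mapping.lookup f 0)"
    using 0 by (intro poly_mapping_eqI) (auto simp: is_form_def mon_deg_eq_0_iff lookup_single when_def in_keys_iff)
  then obtain c where "f = Poly_Mapping.single 0 c" by blast
  then show ?case by (intro exI[of _ "\<lambda>_. 0"]) (simp add: pscale_def)
next
  case (Suc m)
  obtain g where g: "\<And>j. is_form N m (g j)" "f = (\<Sum>j\<le>N. pvar j * g j)"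
    using is_form_pvar_expand[OF Suc.prems] by blast
  define G where "G = (\<Sum>j\<le>N. pscale (w j) (g j))"
  have "is_form N m G" unfolding G_def by (intro is_form_sum is_form_scale g)
  then obtain h where h: "\<And>j. is_form N (m - 1) (h j) \<and> (m = 0 \<longrightarrow> h j = 0)"
    "G = pscale (peval G w) (x0 ^ m) + (\<Sum>j\<le>N. y j * h j)" using Suc.IH by blast
  have "pvar j * g j = x0 * pscale (w j) (g j) + y j * g j" for j
    by (simp add: y_def pscale_def algebra_simps)
  then have fG: "f = x0 * G + (\<Sum>j\<le>N. y j * g j)"
    unfolding g(2) G_def by (simp add: sum.distrib sum_distrib_left)
  have "peval G w = peval f w" by (simp add: fG w_i0 peval_sum)
  then have "f = x0 * (pscale (peval f w) (x0 ^ m) + (\<Sum>j\<le>N. y j * h j)) + (\<Sum>j\<le>N. y j * g j)"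
    using fG h(2) by simp
  also have "\<dots> = pscale (peval f w) (x0 ^ Suc m) + (\<Sum>j\<le>N. y j * (x0 * h j + g j))"
    by (simp add: pscale_def algebra_simps sum.distrib sum_distrib_left)
  finally have *: "f = pscale (peval f w) (x0 ^ Suc m) + (\<Sum>j\<le>N. y j * (x0 * h j + g j))" .
  have "is_form N m (x0 * h j + g j)" for j
  proof (cases "m = 0")
    case False
    then show ?thesis
      using is_form_mult[OF is_form_pvar[OF i0] conjunct1[OF h(1)[of j]]] g(1)[of j] by (auto intro: is_form_add)
  qed (use g(1) h(1) in auto)
  then show ?case using *
    by (intro exI[of _ "\<lambda>j. x0 * h j + g j"]) auto
qed

lemma form_vanishing_at_point:
  assumes "is_form N m f" "peval f w = 0"
  shows "\<exists>h. (\<forall>j. is_form N (m - 1) (h j)) \<and> f = (\<Sum>j\<le>N. y j * h j)"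
  using form_expand_at_point[OF assms(1)] assms(2) by (auto simp: pscale_def)

end

section \<open>Cancellation of a linear form modulo the ideal of a point\<close>

text \<open>Here \<open>a\<close> is the total degree \<open>i + j\<close>. Thus \<open>B1\<close>
  is the vanishing of \<open>Tor_1\<close> above degree \<open>d\<close>, and \<open>B2\<close> that
  of \<open>Tor_2\<close> above degree \<open>d + 1\<close>.\<close>

locale betti_ideal = resolved_ideal N I F + pointed N w i0
  for N and I :: "('k::field) mpoly set" and F and w :: "nat \<Rightarrow> 'k" and i0 +
  fixes d :: nat
  assumes I_proper: "1 \<notin> I" and d_pos: "d > 0"
    and B1: "a > d \<Longrightarrow> quot_dim vscale (fib_ker F (Suc 0) a) (fib_map F (Suc 0) ` fib F (Suc (Suc 0)) a) 0"
    and B2: "a > Suc d \<Longrightarrow> quot_dim vscale (fib_ker F (Suc (Suc 0)) a)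
      (fib_map F (Suc (Suc 0)) ` fib F (Suc (Suc (Suc 0))) a) 0"
begin

lemma hom_comp_expand:
  assumes "is_form N m f" "m > 0" "f = (\<Sum>j\<le>N. l j * g j)" "\<And>j. j \<le> N \<Longrightarrow> is_form N 1 (l j)"
  shows "f = (\<Sum>j\<le>N. l j * hom_comp (m - 1) (g j))"
proof -
  have "f = hom_comp m f" using assms(1) by (simp add: hom_comp_form)
  also have "\<dots> = (\<Sum>j\<le>N. hom_comp m (g j * l j))"
    by (subst assms(3)) (simp only: hom_comp_sum mult.commute)
  also have "\<dots> = (\<Sum>j\<le>N. hom_comp (m - 1) (g j) * l j)"
    using assms(2) by (intro sum.cong refl) (simp add: hom_comp_mult_form[OF assms(4)])
  finally show ?thesis by (simp only: mult.commute)
qed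

text \<open>Since \<open>e\<close> maps to 1, the vector \<open>f * e\<close> maps to
  \<open>f\<close>, so exactness at \<open>F_0\<close> makes it a boundary.\<close>

lemma lift_form:
  assumes e: "e \<in> free_mod N F 0" "vcomp (dg F 0) 0 e = e" "aug_map F e = 1"
    and f: "f \<in> I" "is_form N m f"
  shows "\<exists>u\<in>free_mod N F (Suc 0). vcomp (dg F (Suc 0)) m u = u \<and> diff_map F 0 u = (\<lambda>c. f * e c)"
proof -
  have "(\<lambda>c. f * e c) \<in> {u \<in> free_mod N F 0. aug_map F u \<in> I}"
    using e f I_polys by (simp add: aug_map_mult free_mod_fm fm_mult)
  then obtain u where u: "u \<in> free_mod N F (Suc 0)" "diff_map F 0 u = (\<lambda>c. f * e c)"
    unfolding exact0 by auto
  have "vcomp (dg F 0) m (\<lambda>c. f * e c) = (\<lambda>c. f * e c)"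
    using vcomp_mult_form[OF f(2), of "dg F 0" m e] e(2) by simp
  then have "diff_map F 0 (vcomp (dg F (Suc 0)) m u) = (\<lambda>c. f * e c)"
    using u(2) by (simp add: diff_map_vcomp)
  moreover have "vcomp (dg F (Suc 0)) m (vcomp (dg F (Suc 0)) m u) = vcomp (dg F (Suc 0)) m u"
    using u(1) by (simp add: free_mod_fm vcomp_idem)
  moreover have "vcomp (dg F (Suc 0)) m u \<in> free_mod N F (Suc 0)"
    using u(1) by (simp add: free_mod_fm fm_vcomp)
  ultimately show ?thesis by blast
qed

text \<open>Vanishing of \<open>Tor_1\<close> in degree \<open>m\<close> means that \<open>I\<close>
  has no minimal generator there.\<close>

lemma generated_in_degree_le:
  assumes f: "f \<in> I" "is_form N m f" and m: "m > d"
  shows "\<exists>g. (\<forall>j. g j \<in> I \<and> is_form N (m - 1) (g j)) \<and> f = (\<Sum>j\<le>N. pvar j * g j)"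
proof -
  obtain e where e: "e \<in> free_mod N F 0" "vcomp (dg F 0) 0 e = e" "aug_map F e = 1"
    using unit_lift[OF I_proper] by blast
  obtain u where u: "u \<in> free_mod N F (Suc 0)" "diff_map F 0 u = (\<lambda>c. f * e c)"
    using lift_form[OF e f] by blast
  have "Poly_Mapping.lookup f 0 = 0" using f(2) m by (force simp: is_form_def in_keys_iff)
  then have "\<And>c. Poly_Mapping.lookup (f * e c) 0 = 0" by (simp add: const_term_peval)
  moreover have "vcomp (dg F 0) m (\<lambda>c. f * e c) = (\<lambda>c. f * e c)"
    using vcomp_mult_form[OF f(2), of "dg F 0" m e] e(2) by simp
  ultimately obtain v where v: "\<And>j. v j \<in> free_mod N F (Suc 0)"
    "(\<lambda>c. f * e c) = (\<lambda>c. \<Sum>j\<le>N. pvar j * diff_map F 0 (v j) c)"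
    using image_in_irrelevant_multiple[OF B1[OF m] u(1) u(2)[symmetric]] by blast
  have "f = aug_map F (\<lambda>c. f * e c)" by (simp add: aug_map_mult e(3))
  also have "\<dots> = (\<Sum>j\<le>N. pvar j * aug_map F (diff_map F 0 (v j)))"
    unfolding v(2) by (simp only: aug_map_sum aug_map_mult)
  finally have "f = (\<Sum>j\<le>N. pvar j * hom_comp (m - 1) (aug_map F (diff_map F 0 (v j))))"
    using m f(2) by (intro hom_comp_expand is_form_pvar) auto
  then show ?thesis
    using aug_diff[OF v(1)] I_hom I_polys
    by (intro exI[of _ "\<lambda>j. hom_comp (m - 1) (aug_map F (diff_map F 0 (v j)))"]) auto
qed

text \<open>Membership of a form of degree \<open>m\<close> in the product of \<open>I\<close> and the ideal of the point \<open>w\<close>.\<close>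

definition yI :: "nat \<Rightarrow> 'k mpoly \<Rightarrow> bool" where
  "yI m f \<longleftrightarrow> (\<exists>h. (\<forall>j. h j \<in> I \<and> is_form N (m - 1) (h j)) \<and> f = (\<Sum>j\<le>N. y j * h j))"

lemma cancel_x0:
  assumes f: "f \<in> I" "is_form N m f" and m: "m > d" and x0f: "yI (Suc m) (x0 * f)"
  shows "yI m f"
proof -
  let ?d0 = "dg F 0" and ?d1 = "dg F (Suc 0)" and ?D = "diff_map F 0"
  obtain g where g: "\<And>j. g j \<in> I" "\<And>j. is_form N m (g j)" "x0 * f = (\<Sum>j\<le>N. y j * g j)"
    using x0f by (auto simp: yI_def)
  obtain e where e: "e \<in> free_mod N F 0" "vcomp ?d0 0 e = e" "aug_map F e = 1"
    using unit_lift[OF I_proper] by blast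
  obtain u where u: "u \<in> fm N (rk F (Suc 0))" "vcomp ?d1 m u = u" "?D u = (\<lambda>c. f * e c)"
    using lift_form[OF e f] unfolding free_mod_fm by blast
  have "\<forall>j. \<exists>u. u \<in> fm N (rk F (Suc 0)) \<and> vcomp ?d1 m u = u \<and> ?D u = (\<lambda>c. g j * e c)"
    using lift_form[OF e g(1) g(2)] unfolding free_mod_fm by blast
  then obtain U where U: "\<And>j. U j \<in> fm N (rk F (Suc 0))" "\<And>j. vcomp ?d1 m (U j) = U j"
    "\<And>j. ?D (U j) = (\<lambda>c. g j * e c)"
    unfolding choice_iff by blast
  \<comment> \<open>The relation between \<open>x0 * f\<close> and the \<open>y j * g j\<close>,
    lifted to \<open>F_1\<close>. Its boundary is 0, so it is a syzygy of degree
    \<open>m + 1\<close>, which exceeds \<open>d + 1\<close>.\<close>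
  define s where "s = (\<lambda>b. x0 * u b - (\<Sum>j\<le>N. y j * U j b))"
  have s_fm: "s \<in> free_mod N F (Suc 0)"
    using fm_0[OF u(1)] fm_0[OF U(1)]
    by (auto simp: s_def free_mod_fm fm_def
      intro!: polys_diff polys_mult polys_sum polys_y polys_pvar i0 fm_polys[OF u(1)] fm_polys[OF U(1)])
  have "?D s = (\<lambda>c. x0 * (f * e c) - (\<Sum>j\<le>N. y j * (g j * e c)))"
    unfolding s_def diff_map_diff diff_map_sum diff_map_mult u(3) U(3) ..
  also have "\<dots> = (\<lambda>_. 0)"
  proof
    fix c
    have "x0 * (f * e c) = (\<Sum>j\<le>N. y j * g j) * e c" by (simp only: g(3) flip: mult.assoc)
    then show "x0 * (f * e c) - (\<Sum>j\<le>N. y j * (g j * e c)) = 0"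
      by (simp add: sum_distrib_right mult.assoc)
  qed
  finally have "s \<in> diff_map F (Suc 0) ` free_mod N F (Suc (Suc 0))"
    using s_fm unfolding exact[symmetric] by simp
  then obtain t where t: "t \<in> free_mod N F (Suc (Suc 0))" "s = diff_map F (Suc 0) t" by blast
  have hc: "vcomp ?d1 (Suc m) (\<lambda>b. l * v b) = (\<lambda>b. l * vcomp ?d1 m v b)" if "is_form N 1 l" for l :: "'k mpoly" and v
    using vcomp_mult_form[OF that, of ?d1 "Suc m" v] by simp
  have vcomp_diff': "vcomp ?d1 (Suc m) (\<lambda>b. a b - c b) = (\<lambda>b. vcomp ?d1 (Suc m) a b - vcomp ?d1 (Suc m) c b)" for a c
    using vcomp_add[of ?d1 "Suc m" "\<lambda>b. a b - c b" c] by (simp add: fun_eq_iff)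
  have vcomp_sum': "vcomp ?d1 n (\<lambda>b. \<Sum>j\<le>N. a j b) = (\<lambda>b. \<Sum>j\<le>N. vcomp ?d1 n (a j) b)" for n a
    by (auto simp: vcomp_def hom_comp_sum)
  have s_hom: "vcomp ?d1 (Suc m) s = s"
    unfolding s_def vcomp_diff' vcomp_sum' using hc[OF is_form_pvar[OF i0]] hc[OF is_form_y] u(2) U(2)
    by simp
  have "Poly_Mapping.lookup (s b) 0 = 0" for b
    by (simp add: s_def const_term_peval peval_sum peval_y)
  then obtain v where v: "\<And>j. v j \<in> free_mod N F (Suc (Suc 0))"
    "s = (\<lambda>c. \<Sum>j\<le>N. pvar j * diff_map F (Suc 0) (v j) c)"
    using image_in_irrelevant_multiple[OF B2 t s_hom] m by auto
  define z where "z j = vcomp ?d1 m (diff_map F (Suc 0) (v j))" for j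
  have dv: "diff_map F (Suc 0) (v j) \<in> fm N (rk F (Suc 0))" for j
    using diff_map_free_mod[OF v(1)] by (simp add: free_mod_fm)
  have z_fm: "z j \<in> fm N (rk F (Suc 0))" for j unfolding z_def by (rule fm_vcomp[OF dv])
  have z_hom: "vcomp ?d1 m (z j) = z j" for j
    unfolding z_def by (rule vcomp_idem[OF dv])
  have z_0: "?D (z j) = (\<lambda>_. 0)" for j
    unfolding z_def diff_map_vcomp diff_diff[OF v(1)] by (auto simp: vcomp_def)
  have sz: "s = (\<lambda>c. \<Sum>j\<le>N. pvar j * z j c)"
  proof -
    have "s = vcomp ?d1 (Suc m) s" using s_hom by simp
    also have "\<dots> = (\<lambda>c. \<Sum>j\<le>N. pvar j * z j c)"
      by (subst v(2)) (simp add: vcomp_sum' hc[OF is_form_pvar] z_def)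
    finally show ?thesis .
  qed
  \<comment> \<open>Subtracting syzygies does not change the image. At \<open>w\<close>, where
    \<open>x0\<close> is 1 and the \<open>y j\<close> vanish, the two expressions for
    \<open>s\<close> say that \<open>u\<close> equals the sum of the \<open>w j * z j\<close>; so
    \<open>q\<close> vanishes at \<open>w\<close>.\<close>
  define q where "q = (\<lambda>b. u b - (\<Sum>j\<le>N. pscale (w j) (z j b)))"
  have q_fm: "q \<in> fm N (rk F (Suc 0))"
    using u(1) z_fm fm_polys[OF z_fm] by (auto simp: q_def fm_def pscale_def)
  have q_hom: "vcomp ?d1 m q = q"
  proof
    fix b
    have "vcomp ?d1 m (\<lambda>b. pscale (w j) (z j b)) = (\<lambda>b. pscale (w j) (z j b))" for j
      using vcomp_mult_form[OF is_form_const, of ?d1 m "w j" "z j"] z_hom by (simp add: pscale_def)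
    then have "vcomp ?d1 m (\<lambda>b. \<Sum>j\<le>N. pscale (w j) (z j b)) = (\<lambda>b. \<Sum>j\<le>N. pscale (w j) (z j b))"
      by (simp add: vcomp_sum')
    then have S: "vcomp ?d1 m (\<lambda>b. \<Sum>j\<le>N. pscale (w j) (z j b)) b = (\<Sum>j\<le>N. pscale (w j) (z j b))"
      by (rule fun_cong)
    have "vcomp ?d1 m (\<lambda>b. q b + (\<Sum>j\<le>N. pscale (w j) (z j b))) b = u b"
      using fun_cong[OF u(2), of b] by (simp add: q_def)
    then show "vcomp ?d1 m q b = q b"
      unfolding vcomp_add S by (simp add: q_def eq_diff_eq)
  qed
  have q_w: "peval (q b) w = 0" for b
  proof -
    have "x0 * u b - (\<Sum>j\<le>N. y j * U j b) = (\<Sum>j\<le>N. pvar j * z j b)"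
      using fun_cong[OF sz, of b] by (simp add: s_def)
    then have "peval (x0 * u b - (\<Sum>j\<le>N. y j * U j b)) w = peval (\<Sum>j\<le>N. pvar j * z j b) w" by simp
    then show ?thesis by (simp add: q_def peval_sum w_i0)
  qed
  have "\<exists>h. (\<forall>j. h j \<in> polys N) \<and> q b = (\<Sum>j\<le>N. y j * h j)" for b
  proof (cases "?d1 b \<le> m")
    case True
    then have "is_form N (m - ?d1 b) (q b)" using vcomp_form[OF q_fm q_hom, of b] by simp
    from form_vanishing_at_point[OF this q_w] show ?thesis by (blast dest: is_form_polys)
  next
    case False
    then have "q b = 0" using vcomp_form[OF q_fm q_hom, of b] by simp
    then show ?thesis by (intro exI[of _ "\<lambda>_. 0"]) simp
  qed
  then have "\<forall>b. \<exists>h. (\<forall>j. h j \<in> polys N) \<and> q b = (\<Sum>j\<le>N. y j * h j)" by blast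
  then obtain h where h: "\<And>b j. h b j \<in> polys N" "\<And>b. q b = (\<Sum>j\<le>N. y j * h b j)"
    unfolding choice_iff by blast
  define H where "H j b = (if b < rk F (Suc 0) then h b j else 0)" for j b
  have H: "H j \<in> free_mod N F (Suc 0)" for j using h(1) by (simp add: H_def free_mod_def)
  have qH: "q = (\<lambda>b. \<Sum>j\<le>N. y j * H j b)"
  proof
    fix b
    show "q b = (\<Sum>j\<le>N. y j * H j b)"
      using h(2)[of b] fm_0[OF q_fm, of b] by (cases "b < rk F (Suc 0)") (simp_all add: H_def)
  qed
  have "?D q = (\<lambda>c. f * e c)"
    unfolding q_def diff_map_diff diff_map_sum pscale_def diff_map_mult z_0 u(3) by simp
  then have "(\<lambda>c. f * e c) = (\<lambda>c. \<Sum>j\<le>N. y j * ?D (H j) c)"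
    unfolding qH diff_map_sum diff_map_mult by simp
  then have "aug_map F (\<lambda>c. f * e c) = (\<Sum>j\<le>N. y j * aug_map F (?D (H j)))"
    by (simp only: aug_map_sum aug_map_mult)
  then have "f = (\<Sum>j\<le>N. y j * aug_map F (?D (H j)))" by (simp add: aug_map_mult e(3))
  then have "f = (\<Sum>j\<le>N. y j * hom_comp (m - 1) (aug_map F (?D (H j))))"
    using m f(2) by (intro hom_comp_expand is_form_y) auto
  then show ?thesis
    unfolding yI_def using aug_diff[OF H] I_hom I_polys
    by (intro exI[of _ "\<lambda>j. hom_comp (m - 1) (aug_map F (?D (H j)))"]) auto
qed

lemma cancel_x0_power:
  assumes "f \<in> I" "is_form N m f" "m > d" "yI (m + k) (x0 ^ k * f)"
  shows "yI m f"
  using assms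
proof (induction k)
  case (Suc k)
  have 1: "is_form N (m + k) (x0 ^ k * f)"
    using is_form_mult[OF is_form_power[OF is_form_pvar[OF i0], of k] Suc.prems(2)] by (simp add: add.commute[of m])
  have 2: "x0 ^ k * f \<in> I" by (rule I_mult) (use Suc.prems(1) i0 in auto)
  have 3: "yI (Suc (m + k)) (x0 * (x0 ^ k * f))" using Suc.prems(4) by (simp add: mult.assoc)
  have "m + k > d" using Suc.prems(3) by simp
  from cancel_x0[OF 2 1 this 3] have "yI (m + k) (x0 ^ k * f)" .
  with Suc show ?case by simp
qed simp

text \<open>
  Multiplication by \<open>x0\<close> on the quotient of \<open>I\<close> by \<open>G\<close> and the multiples of the \<open>y j\<close> is injective
  above degree \<open>d\<close>, and it is nilpotent because \<open>x0 ^ d\<close> is congruent to \<open>G\<close> modulo the ideal of the point.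
\<close>

lemma forms_vanishing_at_point_above_d:
  assumes G: "G \<in> I" "is_form N d G" "peval G w = 1"
    and f: "f \<in> I" "is_form N m f" "peval f w = 0" and m: "m > d"
  shows "yI m f"
proof -
  have "is_form N d (x0 ^ d - G)"
    using is_form_power[OF is_form_pvar[OF i0], of d] G(2) by (intro is_form_diff) auto
  then obtain a where a: "\<And>j. is_form N (d - 1) (a j)" "x0 ^ d - G = (\<Sum>j\<le>N. y j * a j)"
    using form_vanishing_at_point[of d "x0 ^ d - G"] G(3) w_i0 by auto
  obtain b where b: "\<And>j. is_form N (m - 1) (b j)" "f = (\<Sum>j\<le>N. y j * b j)"
    using form_vanishing_at_point[OF f(2,3)] by blast
  define h where "h j = a j * f + b j * G" for j
  \<comment> \<open>In each of the two products one factor vanishes at \<open>w\<close> and the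
    other lies in \<open>I\<close>.\<close>
  have "x0 ^ d * f = (x0 ^ d - G) * f + f * G" by (simp add: algebra_simps)
  also have "(x0 ^ d - G) * f = (\<Sum>j\<le>N. y j * (a j * f))"
    by (simp add: a(2) sum_distrib_right mult.assoc)
  also have "f * G = (\<Sum>j\<le>N. y j * (b j * G))"
    by (subst b(2)) (simp add: sum_distrib_right mult.assoc)
  finally have "x0 ^ d * f = (\<Sum>j\<le>N. y j * h j)"
    by (simp add: h_def sum.distrib distrib_left)
  moreover have "is_form N (m + d - 1) (h j)" for j
    using is_form_mult[OF b(1)[of j] G(2)] is_form_mult[OF a(1)[of j] f(2)] m d_pos
    by (auto simp: h_def add.commute intro: is_form_add)
  moreover have "h j \<in> I" for j
    unfolding h_def using f(1) G(1) a(1) b(1) by (auto intro!: I_add I_mult dest: is_form_polys)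
  ultimately have "yI (m + d) (x0 ^ d * f)" unfolding yI_def by blast
  then show ?thesis using cancel_x0_power f m by blast
qed

end

section \<open>Restriction to lines\<close>

lemma infinite_alg_closed_field: "infinite (UNIV :: 'k::alg_closed_field set)"
proof
  assume fin: "finite (UNIV :: 'k set)"
  define p where "p = (\<Prod>a\<in>UNIV. [:-a, 1:]) + (1 :: 'k poly)"
  have deg: "degree (\<Prod>a\<in>UNIV. [:-a, 1:] :: 'k poly) = card (UNIV :: 'k set)"
    by (subst degree_prod_eq_sum_degree) auto
  moreover have "card (UNIV :: 'k set) > 0" using fin by (simp add: card_gt_0_iff)
  ultimately have "degree p > 0"
    unfolding p_def by (subst degree_add_eq_left) auto
  then obtain x where "poly p x = 0" using alg_closed_imp_poly_has_root by blast
  moreover have "poly p x = 1"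
    using fin by (simp add: p_def poly_prod prod_zero_iff)
  ultimately show False by simp
qed

lemma poly_eq_0_if_all_zero:
  fixes p :: "('k::alg_closed_field) poly"
  shows "(\<And>x. poly p x = 0) \<Longrightarrow> p = 0"
  using poly_roots_finite[of p] infinite_alg_closed_field[where 'k='k] by (cases "p = 0") auto

lemma coeff_mult_top:
  assumes "degree p \<le> m" "degree q \<le> n"
  shows "coeff (p * q) (m + n) = coeff p m * coeff q n"
proof -
  have "coeff p i * coeff q (m + n - i) = 0" if "i \<noteq> m" for i
  proof (cases "i < m")
    case True
    then have "coeff q (m + n - i) = 0" using assms(2) by (intro coeff_eq_0) linarith
    then show ?thesis by simp
  next
    case False
    then have "coeff p i = 0" using assms(1) that by (intro coeff_eq_0) linarith
    then show ?thesis by simp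
  qed
  then have "(\<Sum>i\<le>m + n. coeff p i * coeff q (m + n - i)) =
      (\<Sum>i\<in>{m}. coeff p i * coeff q (m + n - i))"
    by (intro sum.mono_neutral_right) auto
  then show ?thesis by (simp add: coeff_mult)
qed

lemma poly_mod_sum_left:
  fixes g :: "('k::field) poly"
  shows "(\<Sum>i\<in>S. f i) mod g = (\<Sum>i\<in>S. f i mod g)"
  by (induction S rule: infinite_finite_induct) (simp_all add: poly_mod_add_left)

text \<open>The univariate polynomial \<open>f(a + X b)\<close>.\<close>

definition lin :: "('k::field) mpoly \<Rightarrow> (nat \<Rightarrow> 'k) \<Rightarrow> (nat \<Rightarrow> 'k) \<Rightarrow> 'k poly" where
  "lin f a b = psub (\<lambda>c. [:c:]) f (\<lambda>i. [:a i, b i:])"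

lemma lin_0 [simp]: "lin 0 a b = 0" and lin_1 [simp]: "lin 1 a b = 1"
  and lin_add [simp]: "lin (f + g) a b = lin f a b + lin g a b"
  and lin_mult [simp]: "lin (f * g) a b = lin f a b * lin g a b"
  and lin_diff [simp]: "lin (f - g) a b = lin f a b - lin g a b"
  and lin_uminus [simp]: "lin (- f) a b = - lin f a b"
  and lin_power [simp]: "lin (f ^ n) a b = lin f a b ^ n"
  and lin_scale [simp]: "lin (pscale c f) a b = Polynomial.smult c (lin f a b)"
  and lin_pvar [simp]: "lin (pvar i) a b = [:a i, b i:]"
  by (simp_all add: lin_def)

lemma lin_sum: "lin (\<Sum>i\<in>S. f i) a b = (\<Sum>i\<in>S. lin (f i) a b)"
  by (simp add: lin_def kalg_poly.psub_sum)

lemma poly_lin: "poly (lin f a b) x = peval f (\<lambda>i. a i + x * b i)"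
  unfolding lin_def peval_psub by (subst kalg_poly.psub_hom[where h="\<lambda>p. poly p x"]) simp_all

text \<open>The coefficient is taken at the formal degree \<open>m\<close>; it is the value of
  \<open>f\<close> at \<open>b\<close>, the point at infinity of the parametrised line.\<close>

lemma lin_form:
  assumes "is_form N m f"
  shows "degree (lin f a b) \<le> m" and "coeff (lin f a b) m = peval f b"
proof -
  have prod: "degree (\<Prod>i\<in>S. [:a i, b i:] ^ n i) \<le> (\<Sum>i\<in>S. n i) \<and>
      coeff (\<Prod>i\<in>S. [:a i, b i:] ^ n i) (\<Sum>i\<in>S. n i) = (\<Prod>i\<in>S. b i ^ n i)" for S and n :: "nat \<Rightarrow> nat"
  proof (induction S rule: infinite_finite_induct)
    case (insert x S)
    have pow: "degree ([:a x, b x:] ^ k) \<le> k \<and> coeff ([:a x, b x:] ^ k) k = b x ^ k" for k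
    proof (induction k)
      case (Suc k)
      have "degree [:a x, b x:] \<le> 1" by simp
      then show ?case
        using Suc coeff_mult_top[of "[:a x, b x:]" 1 "[:a x, b x:] ^ k" k]
          degree_mult_le[of "[:a x, b x:]" "[:a x, b x:] ^ k"]
        by (simp add: numeral_2_eq_2 le_trans)
    qed simp
    show ?case
    proof
      show "degree (\<Prod>i\<in>insert x S. [:a i, b i:] ^ n i) \<le> (\<Sum>i\<in>insert x S. n i)"
        using insert order_trans[OF degree_mult_le add_mono[OF conjunct1[OF pow] conjunct1[OF insert.IH]]]
        by simp
      show "coeff (\<Prod>i\<in>insert x S. [:a i, b i:] ^ n i) (\<Sum>i\<in>insert x S. n i) =
          (\<Prod>i\<in>insert x S. b i ^ n i)"
        using insert coeff_mult_top[OF conjunct1[OF pow] conjunct1[OF insert.IH]] pow by simp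
    qed
  qed auto
  have key: "degree ([:Poly_Mapping.lookup f t:] * mon_val (\<lambda>i. [:a i, b i:]) t) \<le> m \<and>
      coeff ([:Poly_Mapping.lookup f t:] * mon_val (\<lambda>i. [:a i, b i:]) t) m =
        Poly_Mapping.lookup f t * mon_val b t" if "t \<in> Poly_Mapping.keys f" for t
    using prod[of "Poly_Mapping.lookup t" "Poly_Mapping.keys t"] that assms
    by (auto simp: mon_val_def is_form_def mon_deg_def intro: order_trans[OF degree_smult_le])
  have lin: "lin f a b = (\<Sum>t\<in>Poly_Mapping.keys f. [:Poly_Mapping.lookup f t:] * mon_val (\<lambda>i. [:a i, b i:]) t)"
    by (simp add: lin_def psub_def mon_val_def)
  show "degree (lin f a b) \<le> m"
    unfolding lin by (rule degree_sum_le) (use key in auto)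
  show "coeff (lin f a b) m = peval f b"
    unfolding lin coeff_sum peval_psub psub_def mon_val_def[symmetric]
    by (intro sum.cong refl) (use key in blast)
qed

section \<open>Points and linear subspaces\<close>

definition pt :: "(nat \<Rightarrow> 'k::field) \<Rightarrow> 'k ppoint" where
  "pt v = {vscale c v | c. c \<noteq> 0}"

lemma pt_self [simp]: "v \<in> pt v"
  unfolding pt_def by (rule CollectI, rule exI[of _ 1]) (simp add: vscale_def)

lemma proj_of_pt: "proj_of W = pt ` (W - {\<lambda>_. 0})"
  by (auto simp: proj_of_def pt_def)

lemma vscale_eq_0: "vscale c v = (\<lambda>_. 0) \<longleftrightarrow> c = 0 \<or> v = (\<lambda>_. 0)"
  by (auto simp: vscale_def fun_eq_iff)

lemma pt_vscale:
  assumes c: "c \<noteq> 0"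
  shows "pt (vscale c v) = pt v"
proof -
  have 1: "vscale a (vscale c v) = vscale (a * c) v" for a by (simp add: vscale_def mult.assoc)
  have 2: "vscale a v = vscale (a / c) (vscale c v)" for a unfolding 1 using c by simp
  show ?thesis
  proof (intro equalityI subsetI)
    fix u assume "u \<in> pt (vscale c v)"
    then obtain a where "a \<noteq> 0" "u = vscale (a * c) v" unfolding pt_def 1 by blast
    moreover have "a * c \<noteq> 0" using \<open>a \<noteq> 0\<close> c by simp
    ultimately show "u \<in> pt v" unfolding pt_def by blast
  next
    fix u assume "u \<in> pt v"
    then obtain a where a: "a \<noteq> 0" "u = vscale a v" unfolding pt_def by blast
    have "u = vscale (a / c) (vscale c v)" using a(2) 2[of a] by (rule trans)
    moreover have "a / c \<noteq> 0" using a c by simp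
    ultimately show "u \<in> pt (vscale c v)" unfolding pt_def by blast
  qed
qed

lemma pt_in_proj_of:
  assumes "kv.subspace W" "v \<noteq> (\<lambda>_. 0)"
  shows "pt v \<in> proj_of W \<longleftrightarrow> v \<in> W"
proof
  assume "pt v \<in> proj_of W"
  then obtain u where u: "u \<in> W" "pt v = pt u" by (auto simp: proj_of_pt)
  then have "v \<in> pt u" using pt_self[of v] by simp
  then show "v \<in> W" using u(1) assms(1) by (auto simp: pt_def kv.subspace_scale)
qed (use assms in \<open>auto simp: proj_of_pt\<close>)

lemma pt_in_proj_of_nz:
  assumes "kv.subspace W" "v \<in> W" "v \<noteq> (\<lambda>_. 0)" shows "pt v \<in> proj_of W"
  using assms by (auto simp: proj_of_pt)

lemma subspace_kvec: "kv.subspace (kvec N)"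
  by (auto simp: kv.subspace_def kvec_def vscale_def)

lemma PN_E:
  assumes "p \<in> PN N" obtains v where "v \<in> kvec N" "v \<noteq> (\<lambda>_. 0)" "p = pt v"
  using assms by (auto simp: proj_of_pt)

lemma peval_form_pt:
  assumes "is_form N m f"
  shows "(\<forall>u\<in>pt v. peval f u = 0) \<longleftrightarrow> peval f v = 0"
  using peval_form_vscale[OF assms] pt_self[of v] by (auto simp: pt_def)

lemma hom_ideal_hideal: "hom_ideal N (hideal N Y)"
proof
  show "f \<in> polys N" if "f \<in> hideal N Y" for f using that by (simp add: hideal_def)
  show "0 \<in> hideal N Y" by (simp add: hideal_def)
  show "f + g \<in> hideal N Y" if "f \<in> hideal N Y" "g \<in> hideal N Y" for f g
    using that by (simp add: hideal_def hom_comp_add)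
  show "f * g \<in> hideal N Y" if f: "f \<in> polys N" and g: "g \<in> hideal N Y" for f g
  proof -
    have gp: "g \<in> polys N" using g by (simp add: hideal_def)
    obtain M where M: "g = (\<Sum>i\<le>M. hom_comp i g)" using form_decomp by blast
    have "peval (hom_comp m (f * g)) v = 0" if "p \<in> Y" "v \<in> p" for m p v
    proof -
      have "hom_comp m (f * g) = (\<Sum>i\<le>M. hom_comp m (f * hom_comp i g))"
        by (subst M) (simp add: sum_distrib_left hom_comp_sum)
      also have "\<dots> = (\<Sum>i\<le>M. if i \<le> m then hom_comp (m - i) f * hom_comp i g else 0)"
        by (intro sum.cong refl) (rule hom_comp_mult_form[OF is_form_hom_comp[OF gp]])
      finally show ?thesis using g that by (auto simp: peval_sum hideal_def intro!: sum.neutral)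
    qed
    then show ?thesis using f gp by (simp add: hideal_def)
  qed
  show "hom_comp m f \<in> hideal N Y" if "f \<in> hideal N Y" for m f
    using that hom_comp_form[OF is_form_hom_comp, of f N] by (auto simp: hideal_def)
qed

lemma form_in_hideal:
  assumes "is_form N m f"
  shows "f \<in> hideal N Y \<longleftrightarrow> (\<forall>p\<in>Y. \<forall>v\<in>p. peval f v = 0)"
  using assms hom_comp_form[OF assms] by (auto simp: hideal_def is_form_polys)

lemma form_in_hideal_proj_of:
  assumes "is_form N m f"
  shows "f \<in> hideal N (proj_of W) \<longleftrightarrow> (\<forall>v\<in>W. v \<noteq> (\<lambda>_. 0) \<longrightarrow> peval f v = 0)"
  unfolding form_in_hideal[OF assms] proj_of_pt using peval_form_pt[OF assms] by auto

lemma hideal_peval: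
  assumes "f \<in> hideal N Y" "p \<in> Y" "v \<in> p" shows "peval f v = 0"
proof -
  obtain M where M: "f = (\<Sum>i\<le>M. hom_comp i f)" using form_decomp by blast
  show ?thesis by (subst M) (use assms in \<open>auto simp: peval_sum hideal_def\<close>)
qed

section \<open>The cone over the secant locus\<close>

text \<open>\<open>X_zeros\<close> is closedness of \<open>X\<close> in the form used below:
  \<open>X\<close> is cut out by the forms in its ideal.\<close>

locale secant_setup = betti_ideal N "hideal N X" F w i0 d
  for N and X :: "('k::alg_closed_field) ppoint set" and F and w :: "nat \<Rightarrow> 'k" and i0 d +
  fixes G :: "'k mpoly"
  assumes X_PN: "X \<subseteq> PN N"
    and X_zeros: "p \<in> PN N \<Longrightarrow> (\<And>f m v. f \<in> hideal N X \<Longrightarrow> is_form N m f \<Longrightarrow> v \<in> p \<Longrightarrow> peval f v = 0) \<Longrightarrow> p \<in> X"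
    and w_kvec: "w \<in> kvec N"
    and G_I: "G \<in> hideal N X" and G_form: "is_form N d G" and G_w: "peval G w = 1"
begin

abbreviation I :: "'k mpoly set" where "I \<equiv> hideal N X"

lemma w_nz: "w \<noteq> (\<lambda>_. 0)"
  using w_i0 by (metis zero_neq_one)

lemma pt_X:
  assumes "v \<in> kvec N" "v \<noteq> (\<lambda>_. 0)"
  shows "pt v \<in> X \<longleftrightarrow> (\<forall>f\<in>I. peval f v = 0)"
proof
  assume "\<forall>f\<in>I. peval f v = 0"
  then show "pt v \<in> X"
    using assms peval_form_pt by (intro X_zeros) (auto simp: proj_of_pt, blast)
qed (auto intro: hideal_peval)

text \<open>
  If the line through \<open>v\<close> and \<open>w\<close> is \<open>d\<close>-secant, all forms of degree \<open>d\<close> in \<open>I\<close> restrict to multiples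
  of \<open>G\<close> on it. Comparing the coefficients of \<open>X\<^sup>d\<^sup>-\<^sup>1\<close> gives equations that are linear in \<open>v\<close>.
\<close>

definition V :: "(nat \<Rightarrow> 'k) set" where
  "V = {v \<in> kvec N. \<forall>f\<in>I. is_form N d f \<longrightarrow> peval f w = 0 \<longrightarrow> coeff (lin f v w) (d - 1) = 0}"

text \<open>As \<open>w i0 = 1\<close>, a multiple of \<open>w\<close> can only be the one by
  \<open>v i0\<close>. The zero vector is included.\<close>

definition on_q :: "(nat \<Rightarrow> 'k) \<Rightarrow> bool" where
  "on_q v \<longleftrightarrow> v = vscale (v i0) w"

lemma lin_y: "lin (y j) v w = [:v j - w j * v i0:]"
  by (simp add: y_def w_i0)

lemma on_q_iff: "v \<in> kvec N \<Longrightarrow> on_q v \<longleftrightarrow> (\<forall>j\<le>N. v j - w j * v i0 = 0)"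
  using w_kvec unfolding on_q_def fun_eq_iff vscale_def kvec_def
  by (auto simp: algebra_simps) (metis mult_zero_right not_le)

lemma on_q_vscale_w: "on_q (vscale c w)"
  by (simp add: on_q_def vscale_def w_i0)

text \<open>On \<open>v + X w\<close> each \<open>y j\<close> is the constant
  \<open>v j - w j * v i0\<close>, and a form of degree \<open>m - 1\<close> has its value at
  \<open>w\<close> as top coefficient. Writing \<open>f\<close> in terms of the \<open>y j\<close>
  gives an \<open>\<alpha>\<close> independent of \<open>v\<close>, whence linearity in
  \<open>v\<close>.\<close>

lemma coeff_lin_vanishing:
  assumes "is_form N m f" "peval f w = 0"
  shows "\<exists>\<alpha>. \<forall>v. coeff (lin f v w) (m - 1) = (\<Sum>j\<le>N. (v j - w j * v i0) * \<alpha> j)"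
proof -
  obtain h where h: "\<And>j. is_form N (m - 1) (h j)" "f = (\<Sum>j\<le>N. y j * h j)"
    using form_vanishing_at_point[OF assms] by blast
  have "coeff (lin f v w) (m - 1) = (\<Sum>j\<le>N. (v j - w j * v i0) * peval (h j) w)" for v
    by (simp add: h(2) lin_sum lin_y coeff_sum lin_form(2)[OF h(1), unfolded One_nat_def])
  then show ?thesis by (intro exI[of _ "\<lambda>j. peval (h j) w"]) blast
qed

lemma subspace_V: "kv.subspace V"
  unfolding kv.subspace_def
proof (intro conjI ballI allI)
  have sub: "0 \<in> kvec N" "\<And>u v. u \<in> kvec N \<Longrightarrow> v \<in> kvec N \<Longrightarrow> u + v \<in> kvec N"
    "\<And>c v. v \<in> kvec N \<Longrightarrow> vscale c v \<in> kvec N"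
    using subspace_kvec[of N] unfolding kv.subspace_def by blast+
  show "0 \<in> V" unfolding V_def
  proof (intro CollectI conjI ballI impI sub)
    fix f assume "f \<in> I" "is_form N d f" "peval f w = 0"
    then obtain \<alpha> where \<alpha>: "\<And>v. coeff (lin f v w) (d - 1) = (\<Sum>j\<le>N. (v j - w j * v i0) * \<alpha> j)"
      using coeff_lin_vanishing by blast
    show "coeff (lin f 0 w) (d - 1) = 0" unfolding \<alpha> by simp
  qed
  show "u + v \<in> V" if uv: "u \<in> V" "v \<in> V" for u v
    unfolding V_def
  proof (intro CollectI conjI ballI impI)
    show "u + v \<in> kvec N" using uv sub by (auto simp: V_def)
    fix f assume f: "f \<in> I" "is_form N d f" "peval f w = 0"
    then obtain \<alpha> where \<alpha>: "\<And>v. coeff (lin f v w) (d - 1) = (\<Sum>j\<le>N. (v j - w j * v i0) * \<alpha> j)"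
      using coeff_lin_vanishing by blast
    have "coeff (lin f (u + v) w) (d - 1) =
        coeff (lin f u w) (d - 1) + coeff (lin f v w) (d - 1)"
      unfolding \<alpha> by (simp add: algebra_simps sum.distrib sum_subtractf)
    then show "coeff (lin f (u + v) w) (d - 1) = 0" using uv f by (simp add: V_def)
  qed
  show "vscale c v \<in> V" if v: "v \<in> V" for c v
    unfolding V_def
  proof (intro CollectI conjI ballI impI)
    show "vscale c v \<in> kvec N" using v sub by (auto simp: V_def)
    fix f assume f: "f \<in> I" "is_form N d f" "peval f w = 0"
    then obtain \<alpha> where \<alpha>: "\<And>v. coeff (lin f v w) (d - 1) = (\<Sum>j\<le>N. (v j - w j * v i0) * \<alpha> j)"
      using coeff_lin_vanishing by blast
    have "coeff (lin f (vscale c v) w) (d - 1) = c * coeff (lin f v w) (d - 1)"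
      unfolding \<alpha> vscale_def sum_distrib_left by (intro sum.cong refl) (simp add: algebra_simps)
    then show "coeff (lin f (vscale c v) w) (d - 1) = 0" using v f by (simp add: V_def)
  qed
qed

lemma w_V: "w \<in> V"
  unfolding V_def
proof (intro CollectI conjI ballI impI w_kvec)
  fix f assume "f \<in> I" "is_form N d f" "peval f w = 0"
  then obtain \<alpha> where \<alpha>: "\<And>v. coeff (lin f v w) (d - 1) = (\<Sum>j\<le>N. (v j - w j * v i0) * \<alpha> j)"
    using coeff_lin_vanishing by blast
  show "coeff (lin f w w) (d - 1) = 0" unfolding \<alpha> by (simp add: w_i0)
qed

lemma V_kvec: "V \<subseteq> kvec N"
  by (auto simp: V_def)

lemma lin_G: "degree (lin G v w) = d" "coeff (lin G v w) d = 1" "lin G v w \<noteq> 0"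
proof -
  show c: "coeff (lin G v w) d = 1" using lin_form(2)[OF G_form] G_w by simp
  then have "d \<le> degree (lin G v w)" by (intro le_degree) simp
  then show "degree (lin G v w) = d" using lin_form(1)[OF G_form, of v w] by simp
  show "lin G v w \<noteq> 0" using c by auto
qed

text \<open>Makes a form vanish at \<open>w\<close> without changing it modulo \<open>G\<close>, so
  that the result on forms of \<open>I\<close> vanishing at \<open>w\<close> applies.\<close>

lemma reduced_form:
  assumes "f \<in> I" "is_form N m f" "m \<ge> d"
  defines "f' \<equiv> f - pscale (peval f w) (x0 ^ (m - d) * G)"
  shows "f' \<in> I" "is_form N m f'" "peval f' w = 0"
proof -
  have x: "x0 ^ (m - d) * G \<in> I" by (rule I_mult) (use i0 G_I in auto)
  show "f' \<in> I" unfolding f'_def by (rule I_diff[OF assms(1) I_scale[OF x]])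
  have "is_form N (m - d + d) (x0 ^ (m - d) * G)"
    using is_form_mult[OF is_form_power[OF is_form_pvar[OF i0], of "m - d"] G_form] by simp
  then show "is_form N m f'" unfolding f'_def using assms by (intro is_form_diff is_form_scale) auto
  show "peval f' w = 0" by (simp add: f'_def G_w w_i0)
qed

text \<open>The following survives multiplication by \<open>x0\<close>, which is why the remainder vanishes altogether below.\<close>

lemma top_coeff_mod_G:
  assumes v: "v \<in> V"
  shows "m \<ge> d \<Longrightarrow> f \<in> I \<Longrightarrow> is_form N m f \<Longrightarrow>
    coeff (lin f v w mod lin G v w) (d - 1) = 0"
proof (induction m arbitrary: f rule: dec_induct)
  case base
  let ?p = "f - pscale (peval f w) (x0 ^ (d - d) * G)"
  note p = reduced_form[OF base order_refl]
  \<comment> \<open>The coefficient of \<open>X^d\<close> is the value at \<open>w\<close>, which is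
    now 0, so the restriction is its own remainder.\<close>
  have "degree (lin ?p v w) \<le> d" "coeff (lin ?p v w) d = 0"
    using lin_form[OF p(2), of v w] p(3) by simp_all
  then have "degree (lin ?p v w) < degree (lin G v w)"
    unfolding lin_G(1) using d_pos by (metis coeff_0_degree_minus_1 degree_0 diff_less le_neq_implies_less leading_coeff_0_iff less_one zero_less_one linorder_not_less)
  then have "lin ?p v w mod lin G v w = lin ?p v w" by (rule mod_poly_less)
  moreover have "lin f v w mod lin G v w = lin ?p v w mod lin G v w"
    by (simp add: poly_mod_diff_left mod_smult_left)
  moreover have "coeff (lin ?p v w) (d - 1) = 0" using v p by (auto simp: V_def)
  ultimately show ?case by simp
next
  case (step m)
  note p = reduced_form[OF step.prems le_SucI[OF step.hyps(1)]]
  obtain h where h: "\<And>j. h j \<in> I" "\<And>j. is_form N m (h j)"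
    "f - pscale (peval f w) (x0 ^ (Suc m - d) * G) = (\<Sum>j\<le>N. y j * h j)"
    using forms_vanishing_at_point_above_d[OF G_I G_form G_w p] step.hyps by (auto simp: yI_def)
  have "lin f v w mod lin G v w = lin (f - pscale (peval f w) (x0 ^ (Suc m - d) * G)) v w mod lin G v w"
    by (simp add: poly_mod_diff_left mod_smult_left)
  \<comment> \<open>Each \<open>y j\<close> is constant on the line, so the remainder is a linear
    combination of remainders of forms of degree \<open>m\<close> in \<open>I\<close>.\<close>
  also have "\<dots> = (\<Sum>j\<le>N. Polynomial.smult (v j - w j * v i0) (lin (h j) v w mod lin G v w))"
    unfolding h(3) by (simp add: lin_sum lin_y poly_mod_sum_left mod_smult_left)
  finally show ?case using step.IH[OF h(1,2)] by (simp add: coeff_sum)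
qed

theorem lin_G_dvd:
  assumes v: "v \<in> V" "\<not> on_q v" and f: "f \<in> I"
  shows "lin G v w dvd lin f v w"
proof -
  let ?g = "lin G v w"
  have big: "?g dvd lin f v w" if f: "f \<in> I" "is_form N m f" and m: "m \<ge> d" for f m
  proof (rule ccontr)
    assume nd: "\<not> ?g dvd lin f v w"
    define r where "r = lin f v w mod ?g"
    have r0: "r \<noteq> 0" using nd by (simp add: r_def dvd_eq_mod_eq_0)
    have "degree r < d" using degree_mod_less'[OF lin_G(3), of "lin f v w" v] r0 lin_G(1) by (simp add: r_def)
    \<comment> \<open>\<open>x0\<close> restricts to the monic polynomial
      \<open>[:v i0, 1:]\<close>, so multiplication by \<open>x0 ^ k\<close> raises a nonzero
      remainder to degree exactly \<open>d - 1\<close>, where its coefficient is known to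
      vanish.\<close>
    define k where "k = d - 1 - degree r"
    have k: "k + degree r = d - 1" using \<open>degree r < d\<close> by (simp add: k_def)
    let ?s = "[:v i0, 1:] ^ k * r"
    have deg: "degree ?s = d - 1"
      using k r0 by (simp add: degree_mult_eq degree_power_eq)
    have "is_form N (k + m) (x0 ^ k * f)"
      using is_form_mult[OF is_form_power[OF is_form_pvar[OF i0], of k] f(2)] by simp
    moreover have "x0 ^ k * f \<in> I" by (rule I_mult) (use i0 f in auto)
    ultimately have "coeff (lin (x0 ^ k * f) v w mod ?g) (d - 1) = 0"
      using m by (intro top_coeff_mod_G[OF v(1), of "k + m"]) auto
    moreover have "lin (x0 ^ k * f) v w mod ?g = ?s mod ?g"
      by (simp add: r_def mod_mult_right_eq w_i0)
    moreover have "?s mod ?g = ?s"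
      by (rule mod_poly_less) (use deg lin_G(1) d_pos in simp)
    ultimately have "coeff ?s (degree ?s) = 0" using deg by simp
    then show False using r0 by (simp add: leading_coeff_0_iff)
  qed
  \<comment> \<open>For forms of degree below \<open>d\<close>: this \<open>y j\<close> is a nonzero
    constant on the line, so its powers raise the degree to \<open>d\<close> without affecting
    divisibility.\<close>
  obtain j where j: "j \<le> N" "v j - w j * v i0 \<noteq> 0"
    using v V_kvec on_q_iff by blast
  have all: "?g dvd lin f v w" if f: "f \<in> I" "is_form N m f" for f m
  proof (cases "m \<ge> d")
    case False
    have "is_form N (d - m + m) (y j ^ (d - m) * f)"
      using is_form_mult[OF is_form_power[OF is_form_y[OF j(1)], of "d - m"] f(2)] by simp
    moreover have "y j ^ (d - m) * f \<in> I" by (rule I_mult) (use j f in auto)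
    ultimately have "?g dvd lin (y j ^ (d - m) * f) v w" using False by (intro big) auto
    also have "lin (y j ^ (d - m) * f) v w = Polynomial.smult ((v j - w j * v i0) ^ (d - m)) (lin f v w)"
      by (simp add: lin_y poly_const_pow)
    finally show ?thesis using j(2) by (simp add: dvd_smult_iff)
  qed (use big f in blast)
  obtain M where M: "f = (\<Sum>i\<le>M. hom_comp i f)" using form_decomp by blast
  show ?thesis
    by (subst M) (auto simp: lin_sum intro!: dvd_sum all[OF I_hom[OF f] is_form_hom_comp[OF I_polys[OF f]]])
qed

abbreviation \<Lambda> :: "'k ppoint set" where "\<Lambda> \<equiv> proj_of V"

text \<open>On a line of the cone an element of \<open>I\<close> is divisible by a polynomial of
  degree \<open>d\<close>, so forms of lower degree, and those of degree \<open>d\<close> vanishing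
  at \<open>w\<close>, vanish on the whole cone. Above degree \<open>d\<close>, subtracting a
  multiple of \<open>G\<close> leaves a combination of the \<open>y j\<close> with coefficients in
  \<open>I\<close> of lower degree.\<close>

theorem ideal_on_cone:
  assumes V: "\<exists>v\<in>V. \<not> on_q v"
  shows "ideal_sum I (hideal N \<Lambda>) = ideal_sum (hideal N \<Lambda>) (principal N G)"
proof -
  interpret L: hom_ideal N "hideal N \<Lambda>" by (rule hom_ideal_hideal)
  let ?S = "ideal_sum (hideal N \<Lambda>) (principal N G)"
  have S_I: "l \<in> ?S" if "l \<in> hideal N \<Lambda>" for l
    unfolding ideal_sum_def principal_def using that polys_0
    by (intro CollectI exI[of _ l] exI[of _ 0]) force
  have S_G: "G * h \<in> ?S" if "h \<in> polys N" for h
    unfolding ideal_sum_def principal_def using that L.I_0 by force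
  have S_iff: "a \<in> ?S \<longleftrightarrow> (\<exists>l\<in>hideal N \<Lambda>. \<exists>h\<in>polys N. a = l + G * h)" for a
    by (auto simp: ideal_sum_def principal_def)
  have S_add: "a + b \<in> ?S" if ab: "a \<in> ?S" "b \<in> ?S" for a b
  proof -
    obtain l h l' h' where *: "l \<in> hideal N \<Lambda>" "h \<in> polys N" "a = l + G * h"
      "l' \<in> hideal N \<Lambda>" "h' \<in> polys N" "b = l' + G * h'"
      using ab unfolding S_iff by blast
    then have "a + b = (l + l') + G * (h + h')" by (simp add: algebra_simps)
    then show ?thesis unfolding S_iff using * L.I_add polys_add by blast
  qed
  have S_mult: "p * a \<in> ?S" if p: "p \<in> polys N" and a: "a \<in> ?S" for p a
  proof -
    obtain l h where *: "l \<in> hideal N \<Lambda>" "h \<in> polys N" "a = l + G * h"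
      using a unfolding S_iff by blast
    then have "p * a = p * l + G * (p * h)" by (simp add: algebra_simps)
    then show ?thesis unfolding S_iff using * p L.I_mult polys_mult by blast
  qed
  have S_sum: "(\<Sum>j\<le>n. a j) \<in> ?S" if "\<And>j. j \<le> n \<Longrightarrow> a j \<in> ?S" for a and n :: nat
    using that by (induction n) (auto intro: S_add)
  have low: "f \<in> hideal N \<Lambda>" if f: "f \<in> I" "is_form N m f" "m < d \<or> m = d \<and> peval f w = 0" for f m
  proof -
    have lin0: "lin f v w = 0" if v: "v \<in> V" "\<not> on_q v" for v
    proof (rule ccontr)
      assume nz: "lin f v w \<noteq> 0"
      have "degree (lin f v w) < d"
      proof (cases "m < d")
        case False
        then have "coeff (lin f v w) d = 0" "degree (lin f v w) \<le> d"
          using lin_form[OF f(2), of v w] f(3) by auto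
        then show ?thesis using nz by (metis leading_coeff_0_iff le_neq_implies_less)
      qed (use lin_form(1)[OF f(2), of v w] in simp)
      moreover have "degree (lin G v w) \<le> degree (lin f v w)"
        using lin_G_dvd[OF v f(1)] nz by (rule dvd_imp_degree_le)
      ultimately show False using lin_G(1) by simp
    qed
    \<comment> \<open>The value at \<open>w\<close> is read off as a top coefficient on one line of
      the cone, hence the assumption that there is such a line.\<close>
    obtain v0 where v0: "v0 \<in> V" "\<not> on_q v0" using V by blast
    have fw: "peval f w = 0" using lin0[OF v0] lin_form(2)[OF f(2), of v0 w] by simp
    have "peval f v = 0" if "v \<in> V" for v
    proof (cases "on_q v")
      case True
      then show ?thesis using peval_form_vscale[OF f(2), of "v i0" w] fw by (metis mult_zero_right on_q_def)
    next
      case False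
      have "peval f v = poly (lin f v w) 0" by (simp add: poly_lin)
      then show ?thesis using lin0[OF that False] by simp
    qed
    then show ?thesis by (simp add: form_in_hideal_proj_of[OF f(2)])
  qed
  have high: "f \<in> ?S" if "m \<ge> d" "f \<in> I" "is_form N m f" for f m
    using that
  proof (induction m arbitrary: f rule: dec_induct)
    case base
    note p = reduced_form[OF base order_refl]
    have "f - pscale (peval f w) (x0 ^ (d - d) * G) \<in> ?S"
      by (intro S_I low[OF p(1,2)]) (use p(3) in simp)
    then have "f - pscale (peval f w) (x0 ^ (d - d) * G) + G * Poly_Mapping.single 0 (peval f w) \<in> ?S"
      by (intro S_add S_G) auto
    then show ?case by (simp add: pscale_def mult.commute)
  next
    case (step m)
    note p = reduced_form[OF step.prems le_SucI[OF step.hyps(1)]]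
    obtain h where h: "\<And>j. h j \<in> I" "\<And>j. is_form N m (h j)"
      "f - pscale (peval f w) (x0 ^ (Suc m - d) * G) = (\<Sum>j\<le>N. y j * h j)"
      using forms_vanishing_at_point_above_d[OF G_I G_form G_w p] step.hyps by (auto simp: yI_def)
    have "(\<Sum>j\<le>N. y j * h j) + G * pscale (peval f w) (x0 ^ (Suc m - d)) \<in> ?S"
      using i0 step.IH[OF h(1,2)] by (intro S_add S_G S_sum S_mult) auto
    then show ?case unfolding h(3)[symmetric] by (simp add: pscale_def algebra_simps)
  qed
  have form: "f \<in> ?S" if "f \<in> I" "is_form N m f" for f m
    using that high low[OF that] S_I by (cases "m \<ge> d") auto
  have I_S: "f \<in> ?S" if f: "f \<in> I" for f
  proof -
    obtain M where M: "f = (\<Sum>i\<le>M. hom_comp i f)" using form_decomp by blast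
    show ?thesis
      by (subst M) (intro S_sum form[OF I_hom[OF f] is_form_hom_comp[OF I_polys[OF f]]])
  qed
  show ?thesis
  proof
    show "ideal_sum I (hideal N \<Lambda>) \<subseteq> ?S"
      using I_S S_I S_add by (auto simp: ideal_sum_def[of I])
    show "?S \<subseteq> ideal_sum I (hideal N \<Lambda>)"
    proof
      fix a assume "a \<in> ?S"
      then obtain l h where "l \<in> hideal N \<Lambda>" "h \<in> polys N" "a = l + G * h"
        by (auto simp: ideal_sum_def principal_def)
      then show "a \<in> ideal_sum I (hideal N \<Lambda>)"
        using I_mult[OF _ G_I, of h] unfolding ideal_sum_def
        by (intro CollectI exI[of _ "h * G"] exI[of _ l]) (simp add: algebra_simps)
    qed
  qed
qed

end

section \<open>Linear algebra\<close>

text \<open>The system is padded with zero rows to a square matrix; every term of the Leibniz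
  expansion meets the zero row \<open>k\<close>, so the determinant vanishes. The solution is
  extended by 0, as the coefficient functions of \<open>quot_dim\<close> are.\<close>

lemma homogeneous_system_solution:
  fixes M :: "nat \<Rightarrow> nat \<Rightarrow> 'k::field"
  assumes kd: "k < d"
  shows "\<exists>x. (\<exists>i<d. x i \<noteq> 0) \<and> (\<forall>i\<ge>d. x i = 0) \<and> (\<forall>j<k. (\<Sum>i<d. x i * M i j) = 0)"
proof -
  define A where "A = mat d d (\<lambda>(j, i). if j < k then M i j else 0)"
  have A: "A \<in> carrier_mat d d" by (simp add: A_def)
  have z: "(\<Prod>i = 0..<d. A $$ (i, p i)) = 0" if "p permutes {0..<d}" for p
  proof (rule prod_zero)
    have "p k < d" using permutes_in_image[OF that, of k] kd by simp
    then show "\<exists>i\<in>{0..<d}. A $$ (i, p i) = 0"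
      using kd by (intro bexI[of _ k]) (auto simp: A_def)
  qed simp
  have "det A = (\<Sum>p\<in>{p. p permutes {0..<d}}. 0)"
    unfolding det_def'[OF A]
    by (rule sum.cong[OF refl]) (simp only: mem_Collect_eq z mult_zero_right)
  then have "det A = 0" by simp
  then obtain v where v: "v \<in> carrier_vec d" "v \<noteq> 0\<^sub>v d" "A *\<^sub>v v = 0\<^sub>v d"
    using det_0_iff_vec_prod_zero_field[OF A] by blast
  define x where "x i = (if i < d then v $ i else 0)" for i
  have "\<exists>i<d. x i \<noteq> 0"
  proof (rule ccontr)
    assume "\<not> (\<exists>i<d. x i \<noteq> 0)"
    then have "v = 0\<^sub>v d" using v(1) by (intro eq_vecI) (auto simp: x_def)
    then show False using v(2) by simp
  qed
  moreover have "(\<Sum>i<d. x i * M i j) = 0" if j: "j < k" for j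
  proof -
    have "(A *\<^sub>v v) $ j = (\<Sum>i<d. x i * M i j)"
      using j kd v(1) by (simp add: A_def scalar_prod_def x_def mult.commute atLeast0LessThan)
    then show ?thesis using v(3) j kd by simp
  qed
  ultimately show ?thesis by (intro exI[of _ x]) (auto simp: x_def)
qed

lemma ex1_unique: "\<exists>!x. P x \<Longrightarrow> P x \<Longrightarrow> P y \<Longrightarrow> x = y"
  by blast

text \<open>With fewer than \<open>d\<close> generators the \<open>b i\<close> satisfy a nontrivial
  linear relation modulo \<open>W\<close>, which would be a second representation of 0.\<close>

lemma quot_dim_le:
  fixes W :: "('k::field) mpoly set"
  assumes q: "quot_dim pscale U W d"
    and W: "0 \<in> W" "\<And>a b. a \<in> W \<Longrightarrow> b \<in> W \<Longrightarrow> a + b \<in> W" "\<And>c a. a \<in> W \<Longrightarrow> pscale c a \<in> W"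
    and U: "0 \<in> U"
    and t: "\<And>u. u \<in> U \<Longrightarrow> \<exists>c. u - (\<Sum>j<k. pscale (c j) (t j)) \<in> W"
  shows "d \<le> k"
proof (rule ccontr)
  assume "\<not> d \<le> k"
  then have kd: "k < d" by simp
  obtain b where b0: "(\<forall>i<d. b i \<in> U) \<and>
      (\<forall>u\<in>U. \<exists>!c. (\<forall>i\<ge>d. c i = 0) \<and> u - (\<Sum>i<d. pscale (c i) (b i)) \<in> W)"
    using q unfolding quot_dim_def by (elim exE)
  have b1: "b i \<in> U" if "i < d" for i using conjunct1[OF b0] that by simp
  note b2 = conjunct2[OF b0, THEN bspec]
  have "\<forall>i. \<exists>c. i < d \<longrightarrow> b i - (\<Sum>j<k. pscale (c j) (t j)) \<in> W" using t[OF b1] by blast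
  then obtain M where M: "\<And>i. i < d \<Longrightarrow> b i - (\<Sum>j<k. pscale (M i j) (t j)) \<in> W"
    unfolding choice_iff by blast
  obtain x where x: "\<exists>i<d. x i \<noteq> 0" "\<forall>i\<ge>d. x i = 0" "\<And>j. j < k \<Longrightarrow> (\<Sum>i<d. x i * M i j) = 0"
    using homogeneous_system_solution[OF kd, of M] by blast
  have Wsum: "(\<Sum>i<n. a i) \<in> W" if "\<And>i. i < n \<Longrightarrow> a i \<in> W" for a and n :: nat
    using that by (induction n) (auto intro: W)
  have pscale_distrib: "pscale c (f - g) = pscale c f - pscale c g"
    "pscale c (pscale c' f) = pscale (c * c') f" "pscale (- c) f = - pscale c f" for c c' and f g :: "'k mpoly"
    by (simp_all add: pscale_def algebra_simps mult_single single_uminus flip: mult.assoc)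
  have pscale_sum: "pscale c (\<Sum>i\<in>S. f i) = (\<Sum>i\<in>S. pscale c (f i))"
    "pscale (\<Sum>i\<in>S. g i) h = (\<Sum>i\<in>S. pscale (g i) h)" for c S and f :: "nat \<Rightarrow> 'k mpoly" and g h
    by (induction S rule: infinite_finite_induct) (simp_all add: pscale_def algebra_simps single_add)
  have "(\<Sum>i<d. pscale (- x i) (b i - (\<Sum>j<k. pscale (M i j) (t j)))) \<in> W"
    by (intro Wsum W(3) M)
  also have "(\<Sum>i<d. pscale (- x i) (b i - (\<Sum>j<k. pscale (M i j) (t j)))) =
      - (\<Sum>i<d. pscale (x i) (b i)) + (\<Sum>i<d. \<Sum>j<k. pscale (x i * M i j) (t j))"
    by (simp add: pscale_distrib pscale_sum sum.distrib sum_subtractf sum_negf)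
  also have "(\<Sum>i<d. \<Sum>j<k. pscale (x i * M i j) (t j)) = (\<Sum>j<k. pscale (\<Sum>i<d. x i * M i j) (t j))"
    by (subst sum.swap) (simp add: pscale_sum)
  also have "\<dots> = 0" using x(3) by (simp add: pscale_def)
  finally have "0 - (\<Sum>i<d. pscale (x i) (b i)) \<in> W" by simp
  moreover have "0 - (\<Sum>i<d. pscale 0 (b i)) \<in> W" using W(1) by (simp add: pscale_def)
  ultimately have "x = (\<lambda>_. 0)" using x(2) by (intro ex1_unique[OF b2[OF U]]) simp_all
  then show False using x(1) by simp
qed

lemma sum_fun_apply: "(\<Sum>i\<in>S. f i) x = (\<Sum>i\<in>S. f i x)"
  for f :: "'a \<Rightarrow> 'b \<Rightarrow> 'c::comm_monoid_add"
  by (induction S rule: infinite_finite_induct) (simp_all add: plus_fun_def zero_fun_def)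

text \<open>Shows that a linear subspace is cut out by the linear forms vanishing on it: a basis of
  \<open>S\<close> stays independent after adding \<open>u\<close>, and a functional is prescribed
  on it.\<close>

lemma separating_form:
  assumes S: "kv.subspace S" and u: "u \<in> kvec N" "u \<notin> S"
  shows "\<exists>l. is_form N 1 l \<and> (\<forall>v\<in>S \<inter> kvec N. peval l v = (0 :: 'k::field)) \<and> peval l u = 1"
proof -
  interpret vp: vector_space_pair "vscale :: 'k \<Rightarrow> _" "vscale :: 'k \<Rightarrow> _" by unfold_locales
  obtain B where B: "B \<subseteq> S" "kv.independent B" "S \<subseteq> kv.span B"
    using kv.maximal_independent_subset[of S] by blast
  have spB: "kv.span B = S" using B S by (meson kv.span_minimal subset_antisym)
  have uB: "u \<notin> B" using u(2) B(1) by blast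
  have "kv.independent (insert u B)" using kv.independent_insert[of u B] u(2) B(2) uB spB by simp
  \<comment> \<open>\<open>g\<close> takes values in the coordinate space itself; its coordinate 0
    serves as the functional.\<close>
  then obtain g where g: "Vector_Spaces.linear vscale vscale g"
    "\<forall>x\<in>insert u B. g x = (if x = u then (\<lambda>_. 1) else (\<lambda>_. 0 :: 'k))"
    using vp.linear_independent_extend[of "insert u B" "\<lambda>x. if x = u then (\<lambda>_. 1) else (\<lambda>_. 0)"] by blast
  interpret g: Vector_Spaces.linear vscale vscale g by (rule g(1))
  define e where "e i = (\<lambda>j. if j = i then 1 else 0 :: 'k)" for i :: nat
  define l where "l = (\<Sum>i\<le>N. pscale (g (e i) 0) (pvar i))"
  have lv: "peval l v = g v 0" if v: "v \<in> kvec N" for v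
  proof -
    have "v = (\<Sum>i\<le>N. vscale (v i) (e i))"
    proof
      fix j
      have "(\<Sum>i\<le>N. vscale (v i) (e i)) j = (\<Sum>i\<le>N. if i = j then v i else 0)"
        by (simp add: sum_fun_apply vscale_def e_def if_distrib cong: if_cong)
      also have "\<dots> = v j" using v by (auto simp: kvec_def)
      finally show "v j = (\<Sum>i\<le>N. vscale (v i) (e i)) j" ..
    qed
    then have "g v = (\<Sum>i\<le>N. vscale (v i) (g (e i)))"
      by (metis (mono_tags, lifting) g.scale g.sum sum.cong)
    then have "g v 0 = (\<Sum>i\<le>N. v i * g (e i) 0)" by (simp add: sum_fun_apply vscale_def)
    then show ?thesis by (simp add: l_def peval_sum mult.commute)
  qed
  have "g v = (\<lambda>_. 0)" if "v \<in> S" for v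
  proof -
    have "v \<in> kv.span B" using that spB by simp
    then show ?thesis
    proof (induction rule: kv.span_induct_alt)
      case base
      then show ?case using g.zero by (simp add: zero_fun_def)
    next
      case (step c x y)
      have "g x = (\<lambda>_. 0)" using g(2) step(1) uB by auto
      then show ?case using step g.add[of "vscale c x" y] g.scale[of c x] by (simp add: vscale_def plus_fun_def)
    qed
  qed
  then have "\<forall>v\<in>S \<inter> kvec N. peval l v = 0" using lv by simp
  moreover have "peval l u = 1" using lv[OF u(1)] g(2) by simp
  moreover have "is_form N 1 l" unfolding l_def by (intro is_form_sum is_form_scale is_form_pvar) simp
  ultimately show ?thesis by blast
qed

abbreviation lc :: "'k::field \<Rightarrow> (nat \<Rightarrow> 'k) \<Rightarrow> 'k \<Rightarrow> (nat \<Rightarrow> 'k) \<Rightarrow> (nat \<Rightarrow> 'k)" where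
  "lc s a t b \<equiv> (\<lambda>i. s * a i + t * b i)"

definition sp2 :: "(nat \<Rightarrow> 'k::field) \<Rightarrow> (nat \<Rightarrow> 'k) \<Rightarrow> (nat \<Rightarrow> 'k) set" where
  "sp2 a b = {lc s a t b | s t. True}"

lemma sp2_span: "sp2 a b = kv.span {a, b}"
proof -
  have "x \<in> kv.span {a, b} \<longleftrightarrow> (\<exists>s t. x = lc s a t b)" for x
    unfolding kv.span_insert kv.span_singleton
    by (auto simp: kv.span_insert vscale_def fun_eq_iff image_iff) (metis add.commute diff_add_cancel, metis add_diff_cancel_left')
  then show ?thesis by (auto simp: sp2_def)
qed

lemma subspace_sp2: "kv.subspace (sp2 a b)"
  by (simp add: sp2_span kv.subspace_span)

lemma sp2_I: "lc s a t b \<in> sp2 a b"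
  by (auto simp: sp2_def)

lemma sp2_mem: "a \<in> sp2 a b" "b \<in> sp2 a b"
  using sp2_I[of 1 a 0 b] sp2_I[of 0 a 1 b] by simp_all

lemma sp2_subset: "kv.subspace S \<Longrightarrow> a \<in> S \<Longrightarrow> b \<in> S \<Longrightarrow> sp2 a b \<subseteq> S"
  unfolding sp2_span by (rule kv.span_minimal) auto

section \<open>Coordinate rings of lines\<close>

lemma linear_form_expand:
  assumes "is_form N 1 l"
  shows "\<exists>c. l = (\<Sum>j\<le>N. pscale (c j) (pvar j))"
proof -
  obtain g where g: "\<And>j. is_form N 0 (g j)" "l = (\<Sum>j\<le>N. pvar j * g j)"
    using is_form_pvar_expand[of N 0 l] assms by auto
  have "g j = Poly_Mapping.single 0 (Poly_Mapping.lookup (g j) 0)" for j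
    using g(1)[of j]
    by (intro poly_mapping_eqI) (auto simp: is_form_def mon_deg_eq_0_iff lookup_single when_def in_keys_iff)
  then have "pvar j * g j = pscale (Poly_Mapping.lookup (g j) 0) (pvar j)" for j
    unfolding pscale_def by (metis mult.commute)
  then have "l = (\<Sum>j\<le>N. pscale (Poly_Mapping.lookup (g j) 0) (pvar j))" by (simp add: g(2))
  then show ?thesis by (intro exI[of _ "\<lambda>j. Poly_Mapping.lookup (g j) 0"])
qed

lemma peval_linear_form:
  assumes "is_form N 1 l"
  shows "peval l (lc s a t b) = s * peval l a + t * peval l b"
proof -
  obtain c where "l = (\<Sum>j\<le>N. pscale (c j) (pvar j))" using linear_form_expand[OF assms] by blast
  then show ?thesis by (simp add: peval_sum sum_distrib_left algebra_simps flip: sum.distrib)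
qed

lemma lin_linear_form:
  assumes "is_form N 1 l"
  shows "lin l a b = [:peval l a, peval l b:]"
proof (rule poly_eqI)
  fix n :: nat
  have 0: "coeff (lin l a b) 0 = peval l a"
    using poly_lin[of l a b 0] by (simp add: poly_0_coeff_0)
  consider "n = 0" | "n = 1" | "n > 1" using linorder_neqE_nat[of n 1] less_one[of n] by blast
  then show "coeff (lin l a b) n = coeff [:peval l a, peval l b:] n"
  proof cases
    case 3
    then have "coeff (lin l a b) n = 0"
      using lin_form(1)[OF assms, of a b] by (intro coeff_eq_0) simp
    then show ?thesis using 3 by (simp add: coeff_eq_0)
  qed (use 0 lin_form(2)[OF assms, of a b] in simp_all)
qed

text \<open>Up to scaling, the vectors \<open>a + x b\<close> miss only the multiples of
  \<open>b\<close>, where the value is governed by the coefficient of \<open>X^m\<close>.\<close>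

lemma form_vanishes_on_sp2:
  assumes f: "is_form N m f" and lin: "lin f a b = 0" and u: "u \<in> sp2 a b"
  shows "peval f u = 0"
proof -
  obtain s t where st: "u = lc s a t b" using u by (auto simp: sp2_def)
  show ?thesis
  proof (cases "s = 0")
    case True
    have "peval f b = 0" using lin_form(2)[OF f, of a b] lin by simp
    then show ?thesis using peval_form_scale[OF f, of t b] True by (simp add: st)
  next
    case False
    have "peval f (\<lambda>i. a i + t / s * b i) = 0" using poly_lin[of f a b "t / s"] lin by simp
    moreover have "u = (\<lambda>i. s * (a i + t / s * b i))" using False by (simp add: st distrib_left)
    ultimately show ?thesis using peval_form_scale[OF f, of s "\<lambda>i. a i + t / s * b i"] by simp
  qed
qed

lemma lin_hideal_sp2:
  fixes a b :: "nat \<Rightarrow> 'k::alg_closed_field"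
  assumes f: "f \<in> hideal N (proj_of (sp2 a b))" and indep: "\<And>x. (\<lambda>i. a i + x * b i) \<noteq> (\<lambda>_. 0)"
  shows "lin f a b = 0"
proof (rule poly_eq_0_if_all_zero)
  fix x
  let ?u = "\<lambda>i. a i + x * b i"
  have "?u \<in> sp2 a b" using sp2_I[of 1 a x b] by simp
  then have "pt ?u \<in> proj_of (sp2 a b)" using indep by (intro pt_in_proj_of_nz subspace_sp2) auto
  then show "poly (lin f a b) x = 0" unfolding poly_lin by (rule hideal_peval[OF f]) simp
qed

text \<open>
  The ideal of the line together with \<open>h - 1\<close> is the kernel of \<open>f \<mapsto> f(a + X b)\<close>: multiplying the
  components of \<open>f\<close> by powers of \<open>h\<close> makes \<open>f\<close> homogeneous without changing its class.
\<close>

lemma lin_kernel: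
  fixes a b :: "nat \<Rightarrow> 'k::alg_closed_field"
  assumes h: "is_form N 1 h" "peval h a = 1" "peval h b = 0" and p: "p \<in> polys N" and lin: "lin p a b = 0"
  shows "\<exists>l\<in>hideal N (proj_of (sp2 a b)). \<exists>r\<in>polys N. p = l + (h - 1) * r"
proof -
  obtain M where M: "p = (\<Sum>m\<le>M. hom_comp m p)" using form_decomp by blast
  have hp: "h \<in> polys N" using h(1) is_form_polys by blast
  define l where "l = (\<Sum>m\<le>M. h ^ (M - m) * hom_comp m p)"
  \<comment> \<open>Collects the quotients of \<open>h ^ k - 1\<close> by \<open>h - 1\<close>,
    which are geometric sums.\<close>
  define r where "r = - (\<Sum>m\<le>M. (\<Sum>i<M - m. h ^ i) * hom_comp m p)"
  have lh: "lin h a b = 1" using h by (simp add: lin_linear_form[OF h(1)] pCons_one)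
  have "lin l a b = (\<Sum>m\<le>M. lin (hom_comp m p) a b)" by (simp add: l_def lin_sum lh)
  also have "\<dots> = lin p a b" by (subst (2) M) (simp add: lin_sum)
  finally have l0: "lin l a b = 0" using lin by simp
  have "is_form N M (h ^ (M - m) * hom_comp m p)" if "m \<le> M" for m
    using is_form_mult[OF is_form_power[OF h(1), of "M - m"] is_form_hom_comp[OF p, of m]] that by simp
  then have lM: "is_form N M l" unfolding l_def by (intro is_form_sum) auto
  have "l \<in> hideal N (proj_of (sp2 a b))"
    unfolding form_in_hideal_proj_of[OF lM] using form_vanishes_on_sp2[OF lM l0] by blast
  moreover have "r \<in> polys N" unfolding r_def using hp p by auto
  moreover have "p = l + (h - 1) * r"
  proof -
    have "(h - 1) * r = (\<Sum>m\<le>M. (1 - h ^ (M - m)) * hom_comp m p)"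
      unfolding r_def mult_minus_right sum_distrib_left sum_negf[symmetric]
    proof (intro sum.cong refl)
      fix m
      have "1 - h ^ (M - m) = - ((h - 1) * (\<Sum>i<M - m. h ^ i))"
        using power_diff_1_eq[of h "M - m"] by (simp add: algebra_simps)
      then show "- ((h - 1) * ((\<Sum>i<M - m. h ^ i) * hom_comp m p)) = (1 - h ^ (M - m)) * hom_comp m p"
        by (simp add: mult.assoc)
    qed
    then have "l + (h - 1) * r = (\<Sum>m\<le>M. hom_comp m p)"
      by (simp add: l_def algebra_simps flip: sum.distrib)
    then show ?thesis using M by simp
  qed
  ultimately show ?thesis by blast
qed

text \<open>The alternative \<open>r = 0\<close> covers \<open>n = 0\<close>, because the zero
  polynomial has degree 0.\<close>

lemma sum_coeff_monom:
  fixes r :: "('k::field) poly"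
  assumes "degree r < n \<or> r = 0"
  shows "(\<Sum>i<n. Polynomial.smult (coeff r i) ([:0, 1:] ^ i)) = r"
proof (rule poly_eqI)
  fix j
  have "[:0, 1:] ^ i = (monom 1 i :: 'k poly)" for i by (simp add: monom_altdef)
  then have "coeff (\<Sum>i<n. Polynomial.smult (coeff r i) ([:0, 1:] ^ i)) j =
      (\<Sum>i<n. if i = j then coeff r j else 0)"
    by (simp add: coeff_sum if_distrib[where f="\<lambda>x. _ * x"] cong: if_cong)
  also have "\<dots> = coeff r j"
    using assms by (auto simp: coeff_eq_0)
  finally show "coeff (\<Sum>i<n. Polynomial.smult (coeff r i) ([:0, 1:] ^ i)) j =
      coeff r j" .
qed

section \<open>Lines meeting the variety in a scheme of length \<open>d\<close>\<close>

context secant_setup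
begin

abbreviation J :: "(nat \<Rightarrow> 'k) \<Rightarrow> 'k mpoly set" where
  "J v \<equiv> inter_ideal N X (proj_of (sp2 v w))"

lemma mem_J_affine:
  "p \<in> ideal_sum (J v) (principal N (h - 1)) \<longleftrightarrow>
    (\<exists>f\<in>I. \<exists>l\<in>hideal N (proj_of (sp2 v w)). \<exists>r\<in>polys N. p = f + l + (h - 1) * r)"
  by (auto simp: ideal_sum_def inter_ideal_def principal_def)

lemma not_on_q_combination:
  assumes "\<not> on_q v" "lc s v t w = (\<lambda>_. 0)"
  shows "s = 0" "t = 0"
proof -
  show "s = 0"
  proof (rule ccontr)
    assume s: "s \<noteq> 0"
    have e: "s * v i + t * w i = 0" for i using assms(2) by (rule fun_cong)
    have "v i = - (t / s) * w i" for i using e[of i] s by (simp add: field_simps add_eq_0_iff)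
    then have "on_q v" unfolding on_q_def vscale_def by (auto simp: w_i0 fun_eq_iff)
    then show False using assms(1) by simp
  qed
  then show "t = 0" using fun_cong[OF assms(2), of i0] by (simp add: w_i0)
qed

text \<open>In the chart given by \<open>h\<close>, restriction to \<open>v + X w\<close> identifies
  the coordinate ring of the intersection with \<open>k[X]\<close> modulo the monic polynomial
  \<open>lin G v w\<close> of degree \<open>d\<close>.\<close>

lemma scheme_length_if_in_V:
  assumes v: "v \<in> V" "\<not> on_q v"
  shows "scheme_length N (J v) d"
proof -
  have vk: "v \<in> kvec N" using v V_kvec by blast
  obtain j where j: "j \<le> N" "v j - w j * v i0 \<noteq> 0" using on_q_iff[OF vk] v(2) by blast
  \<comment> \<open>\<open>h\<close> is 1 at \<open>v\<close> and 0 at \<open>w\<close>, so on the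
    line it vanishes only at \<open>q\<close>, where \<open>G\<close> does not.\<close>
  define h where "h = pscale (inverse (v j - w j * v i0)) (y j)"
  have h: "is_form N 1 h" "peval h v = 1" "peval h w = 0"
    unfolding h_def using j by (simp_all add: is_form_scale[OF is_form_y[OF j(1)]] peval_y[of j v] del: One_nat_def)
  have lh: "lin h v w = 1" using j by (simp add: h_def lin_y pCons_one)
  have hp: "h \<in> polys N" using h(1) is_form_polys by blast
  let ?l = "proj_of (sp2 v w)" and ?g = "lin G v w"
  interpret L: hom_ideal N "hideal N ?l" by (rule hom_ideal_hideal)
  have indep: "(\<lambda>i. v i + x * w i) \<noteq> (\<lambda>_. 0)" for x
    using not_on_q_combination(1)[OF v(2), of 1 x] by auto
  have "zero_locus N (insert h (J v)) = {}"
  proof (rule ccontr)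
    assume "zero_locus N (insert h (J v)) \<noteq> {}"
    then obtain p where p: "p \<in> PN N" "\<And>f u. f \<in> insert h (J v) \<Longrightarrow> u \<in> p \<Longrightarrow> peval f u = 0"
      by (auto simp: zero_locus_def)
    obtain u where u: "u \<in> kvec N" "u \<noteq> (\<lambda>_. 0)" "p = pt u" using p(1) by (rule PN_E)
    have Jl: "f \<in> J v" if "f \<in> hideal N ?l" for f
      using that I_0 unfolding inter_ideal_def ideal_sum_def by force
    have GJ: "G \<in> J v" using G_I L.I_0 unfolding inter_ideal_def ideal_sum_def by force
    have "u \<in> sp2 v w"
    proof (rule ccontr)
      assume "u \<notin> sp2 v w"
      then obtain l where l: "is_form N 1 l" "\<forall>v\<in>sp2 v w \<inter> kvec N. peval l v = 0" "peval l u = 1"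
        using separating_form[OF subspace_sp2 u(1)] by blast
      have "sp2 v w \<subseteq> kvec N" using sp2_subset[OF subspace_kvec vk w_kvec] .
      then have "l \<in> hideal N ?l" using l(2) by (auto simp: form_in_hideal_proj_of[OF l(1)])
      then have "peval l u = 0" using p(2)[of l u] Jl u(3) by simp
      then show False using l(3) by simp
    qed
    then obtain s t where st: "u = lc s v t w" by (auto simp: sp2_def)
    have "peval (y j) u = s * (v j - w j * v i0)" by (simp add: peval_y st w_i0 algebra_simps)
    then have "peval h u = s" using j(2) by (simp add: h_def)
    then have "s = 0" using p(2)[of h u] u(3) by simp
    then have ut: "u = vscale t w" by (simp add: st vscale_def)
    have "peval G u = t ^ d" unfolding ut using peval_form_vscale[OF G_form, of t w] G_w by simp
    then have "t = 0" using p(2)[OF insertI2[OF GJ], of u] u(3) by simp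
    then show False using u(2) ut by (simp add: vscale_def)
  qed
  moreover have "quot_dim pscale (polys N) (ideal_sum (J v) (principal N (h - 1))) d"
  proof -
    let ?W = "ideal_sum (J v) (principal N (h - 1))"
    \<comment> \<open>\<open>x0\<close> restricts to \<open>v i0 + X\<close> and \<open>h\<close> to
      1, so \<open>c\<close> restricts to \<open>X\<close>; its powers below \<open>d\<close> give
      the basis.\<close>
    define c where "c = x0 - pscale (v i0) h"
    have cp: "c \<in> polys N" unfolding c_def using i0 hp by simp
    have lc: "lin c v w = [:0, 1:]" by (simp add: c_def lh w_i0)
    have W_iff: "p \<in> ?W \<longleftrightarrow> ?g dvd lin p v w" if p: "p \<in> polys N" for p
    proof
      assume "p \<in> ?W"
      then obtain f l r where *: "f \<in> I" "l \<in> hideal N ?l" "p = f + l + (h - 1) * r"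
        unfolding mem_J_affine by blast
      have "lin p v w = lin f v w" by (simp add: * lh lin_hideal_sp2[OF *(2) indep])
      then show "?g dvd lin p v w" using lin_G_dvd[OF v *(1)] by simp
    next
      assume "?g dvd lin p v w"
      then obtain r where r: "lin p v w = ?g * r" by (elim dvdE)
      define R where "R = (\<Sum>i<Suc (degree r). pscale (coeff r i) (c ^ i))"
      have R: "R \<in> polys N" unfolding R_def using cp by auto
      have "lin R v w = r"
        unfolding R_def lin_sum lin_scale lin_power lc by (rule sum_coeff_monom) simp
      then have "lin (p - R * G) v w = 0" using r by simp
      then obtain l s where ls: "l \<in> hideal N ?l" "s \<in> polys N" "p - R * G = l + (h - 1) * s"
        using lin_kernel[OF h, of "p - R * G"] p R G_I I_polys by (metis polys_diff polys_mult)
      then have "p = R * G + l + (h - 1) * s" by (simp add: algebra_simps)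
      then show "p \<in> ?W" unfolding mem_J_affine using I_mult[OF R G_I] ls by blast
    qed
    have "\<exists>!a. (\<forall>i\<ge>d. a i = 0) \<and> p - (\<Sum>i<d. pscale (a i) (c ^ i)) \<in> ?W" if p: "p \<in> polys N" for p
    proof -
      let ?r = "lin p v w mod ?g"
      have iff: "p - (\<Sum>i<d. pscale (a i) (c ^ i)) \<in> ?W \<longleftrightarrow>
          ?r = (\<Sum>i<d. Polynomial.smult (a i) ([:0, 1:] ^ i))" (is "_ \<longleftrightarrow> ?r = ?q") for a
      proof -
        have q: "?q mod ?g = ?q"
        proof (cases "?q = 0")
          case False
          have "degree ?q \<le> d - 1"
            by (intro degree_sum_le) (auto intro!: order_trans[OF degree_smult_le] simp: degree_power_eq)
          then show ?thesis using d_pos lin_G(1) by (intro mod_poly_less) simp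
        qed simp
        have "p - (\<Sum>i<d. pscale (a i) (c ^ i)) \<in> ?W \<longleftrightarrow> ?g dvd lin p v w - ?q"
          using p cp by (subst W_iff) (auto simp: lin_sum lc)
        also have "\<dots> \<longleftrightarrow> ?r = ?q mod ?g" by (rule mod_eq_dvd_iff[symmetric])
        finally show ?thesis using q by simp
      qed
      have cf: "coeff (\<Sum>i<d. Polynomial.smult (a i) ([:0, 1:] ^ i)) n = (if n < d then a n else 0)"
        for a :: "nat \<Rightarrow> 'k" and n
      proof -
        have "[:0, 1:] ^ i = (monom 1 i :: 'k poly)" for i by (simp add: monom_altdef)
        then show ?thesis by (simp add: coeff_sum if_distrib cong: if_cong)
      qed
      have deg: "degree ?r < d \<or> ?r = 0"
        using degree_mod_less[OF lin_G(3), of "lin p v w" v] lin_G(1) by auto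
      show ?thesis
      proof (rule ex1I[of _ "\<lambda>i. if i < d then coeff ?r i else 0"])
        show "(\<forall>i\<ge>d. (if i < d then coeff ?r i else 0) = 0) \<and>
            p - (\<Sum>i<d. pscale (if i < d then coeff ?r i else 0) (c ^ i)) \<in> ?W"
          unfolding iff using sum_coeff_monom[OF deg] by simp
        fix a assume a: "(\<forall>i\<ge>d. a i = 0) \<and> p - (\<Sum>i<d. pscale (a i) (c ^ i)) \<in> ?W"
        then have "?r = (\<Sum>i<d. Polynomial.smult (a i) ([:0, 1:] ^ i))" using iff by blast
        then show "a = (\<lambda>i. if i < d then coeff ?r i else 0)"
          using a cf by (auto simp: fun_eq_iff)
      qed
    qed
    then show ?thesis unfolding quot_dim_def using cp by (intro exI[of _ "\<lambda>i. c ^ i"]) auto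
  qed
  ultimately show ?thesis unfolding scheme_length_def using h(1) by blast
qed

text \<open>If an equation of \<open>V\<close> fails at \<open>v\<close>, then in any chart of the
  line some form of \<open>I\<close> restricts to a nonzero polynomial of degree at most
  \<open>d - 1\<close>, which bounds the length by \<open>d - 1\<close>. The chart is dictated by
  the \<open>h\<close> in \<open>scheme_length\<close>, so the point at infinity need not be
  \<open>q\<close>.\<close>

lemma in_V_if_scheme_length:
  assumes vk: "v \<in> kvec N" and nq: "\<not> on_q v" and len: "scheme_length N (J v) d"
  shows "v \<in> V"
proof (rule ccontr)
  assume "v \<notin> V"
  then obtain f where f: "f \<in> I" "is_form N d f" "peval f w = 0" "coeff (lin f v w) (d - 1) \<noteq> 0"
    using vk by (auto simp: V_def)
  obtain h where h: "is_form N 1 h"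
    "quot_dim pscale (polys N) (ideal_sum (J v) (principal N (h - 1))) d"
    using len by (auto simp: scheme_length_def)
  have hp: "h \<in> polys N" using h(1) is_form_polys by blast
  let ?l = "proj_of (sp2 v w)" and ?W = "ideal_sum (J v) (principal N (h - 1))"
  interpret L: hom_ideal N "hideal N ?l" by (rule hom_ideal_hideal)
  have W0: "0 \<in> ?W"
    unfolding mem_J_affine by (intro bexI[of _ 0] I_0 L.I_0 polys_0) simp
  have W_add: "a + b \<in> ?W" if ab: "a \<in> ?W" "b \<in> ?W" for a b
  proof -
    obtain f l r f' l' r' where *: "f \<in> I" "l \<in> hideal N ?l" "r \<in> polys N" "a = f + l + (h - 1) * r"
      "f' \<in> I" "l' \<in> hideal N ?l" "r' \<in> polys N" "b = f' + l' + (h - 1) * r'"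
      using ab unfolding mem_J_affine by blast
    have "a + b = (f + f') + (l + l') + (h - 1) * (r + r')"
      unfolding *(4) *(8) by (simp add: algebra_simps)
    then show ?thesis unfolding mem_J_affine using * I_add L.I_add polys_add by blast
  qed
  have W_scale: "pscale c a \<in> ?W" if a: "a \<in> ?W" for a c
  proof -
    obtain f l r where *: "f \<in> I" "l \<in> hideal N ?l" "r \<in> polys N" "a = f + l + (h - 1) * r"
      using a unfolding mem_J_affine by blast
    have "pscale c a = pscale c f + pscale c l + (h - 1) * pscale c r"
      unfolding *(4) by (simp add: pscale_def algebra_simps)
    then show ?thesis unfolding mem_J_affine using * I_scale L.I_scale polys_scale by blast
  qed
  have le: "d \<le> k" if "\<And>p. p \<in> polys N \<Longrightarrow> \<exists>e. p - (\<Sum>j<k. pscale (e j) (t j)) \<in> ?W"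
    for k and t :: "nat \<Rightarrow> 'k mpoly"
    by (rule quot_dim_le[OF h(2) W0 _ _ polys_0 that]) (rule W_add W_scale; assumption)+
  show False
  proof (cases "peval h v = 0 \<and> peval h w = 0")
    case True
    \<comment> \<open>If \<open>h\<close> vanishes on the line, both \<open>h\<close> and
      \<open>h - 1\<close> lie in \<open>?W\<close>, which is then the whole ring, so the length
      would be 0.\<close>
    then have "lin h v w = 0" by (simp add: lin_linear_form[OF h(1)])
    then have hl: "h \<in> hideal N ?l"
      unfolding form_in_hideal_proj_of[OF h(1)] using form_vanishes_on_sp2[OF h(1)] by blast
    have all: "p \<in> ?W" if p: "p \<in> polys N" for p
    proof -
      have "p = 0 + p * h + (h - 1) * (- p)" by (simp add: algebra_simps)
      then show ?thesis unfolding mem_J_affine using I_0 L.I_mult[OF p hl] polys_uminus[OF p] by blast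
    qed
    have "\<exists>e. p - (\<Sum>j<(0::nat). pscale (e j) (0 :: 'k mpoly)) \<in> ?W" if "p \<in> polys N" for p
      by (rule exI[of _ "\<lambda>_. 0"]) (use all[OF that] in simp)
    then have "d \<le> 0" by (rule le)
    then show False using d_pos by simp
  next
    case False
    \<comment> \<open>A basis of the plane adapted to \<open>h\<close>: the chart
      \<open>h = 1\<close> of the line is \<open>a + X b\<close>, with \<open>b\<close> at
      infinity.\<close>
    have "\<exists>a b. a \<in> sp2 v w \<and> b \<in> sp2 v w \<and> v \<in> sp2 a b \<and> w \<in> sp2 a b \<and>
        peval h a = 1 \<and> peval h b = 0 \<and> b \<noteq> (\<lambda>_. 0)"
    proof (cases "peval h w = 0")
      case True
      let ?a = "lc (1 / peval h v) v 0 w"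
      have hv: "peval h v \<noteq> 0" using True False by simp
      have "v = lc (peval h v) ?a 0 w" using hv by (simp add: fun_eq_iff)
      then have "v \<in> sp2 ?a w" using sp2_I[of "peval h v" ?a 0 w] by metis
      moreover have "peval h ?a = 1" unfolding peval_linear_form[OF h(1)] using hv by simp
      moreover have "?a \<in> sp2 v w" by (rule sp2_I)
      ultimately show ?thesis using True w_nz sp2_mem by blast
    next
      case hw: False
      let ?a = "lc 0 v (1 / peval h w) w" and ?b = "lc 1 v (- (peval h v / peval h w)) w"
      have "w = lc (peval h w) ?a 0 ?b" using hw by (simp add: fun_eq_iff)
      then have w: "w \<in> sp2 ?a ?b" using sp2_I[of "peval h w" ?a 0 ?b] by metis
      have "v = lc (peval h v) ?a 1 ?b" using hw by (simp add: fun_eq_iff)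
      then have v: "v \<in> sp2 ?a ?b" using sp2_I[of "peval h v" ?a 1 ?b] by metis
      have "?b \<noteq> (\<lambda>_. 0)" using not_on_q_combination(1)[OF nq, of 1] by (metis zero_neq_one)
      moreover have "peval h ?a = 1" "peval h ?b = 0"
        unfolding peval_linear_form[OF h(1)] using hw by simp_all
      ultimately show ?thesis using v w sp2_I by blast
    qed
    then obtain a b where ab: "a \<in> sp2 v w" "b \<in> sp2 v w" "v \<in> sp2 a b" "w \<in> sp2 a b"
      "peval h a = 1" "peval h b = 0" "b \<noteq> (\<lambda>_. 0)" by blast
    have sp: "sp2 a b = sp2 v w"
      by (intro subset_antisym sp2_subset subspace_sp2 ab)
    have abk: "a \<in> kvec N" "b \<in> kvec N" using sp2_subset[OF subspace_kvec vk w_kvec] ab by blast+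
    \<comment> \<open>\<open>sp2 a a\<close> consists of the multiples of \<open>a\<close>; a linear
      form vanishing on it and equal to 1 at \<open>b\<close> restricts to the coordinate
      \<open>X\<close>.\<close>
    have "b \<notin> sp2 a a"
    proof
      assume "b \<in> sp2 a a"
      then obtain s t where st: "b = lc s a t a" by (auto simp: sp2_def)
      then have "s + t = 0" using peval_linear_form[OF h(1), of s a t a] ab(5,6) by simp
      then have "b = (\<lambda>_. 0)" unfolding st by (simp flip: distrib_right)
      then show False using ab(7) by simp
    qed
    then obtain c where c: "is_form N 1 c" "\<forall>v\<in>sp2 a a \<inter> kvec N. peval c v = 0" "peval c b = 1"
      using separating_form[OF subspace_sp2 abk(2)] by blast
    have cp: "c \<in> polys N" using c(1) is_form_polys by blast
    have "peval c a = 0" using c(2) abk(1) sp2_mem by blast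
    then have lc: "lin c a b = [:0, 1:]" using c(3) by (simp add: lin_linear_form[OF c(1)])
    \<comment> \<open>Wanted is a form that vanishes at \<open>b\<close> but not on the whole line.
      Either \<open>G\<close> is one, or the value of \<open>f\<close> at \<open>b\<close> is
      cancelled by a multiple of \<open>G\<close>.\<close>
    have "\<exists>g. g \<in> I \<and> is_form N d g \<and> lin g a b \<noteq> 0 \<and> coeff (lin g a b) d = 0"
    proof (cases "peval G b = 0")
      case True
      have "lin G a b \<noteq> 0" using form_vanishes_on_sp2[OF G_form _ ab(4)] G_w by auto
      then show ?thesis using G_I G_form lin_form(2)[OF G_form, of a b] True by auto
    next
      case False
      define \<kappa> where "\<kappa> = peval f b / peval G b"
      define g where "g = f - pscale \<kappa> G"
      have g: "g \<in> I" "is_form N d g" unfolding g_def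
        by (rule I_diff[OF f(1) I_scale[OF G_I]]) (rule is_form_diff[OF f(2) is_form_scale[OF G_form]])
      have "lin g a b \<noteq> 0"
      proof
        assume "lin g a b = 0"
        then have van: "\<And>u. u \<in> sp2 v w \<Longrightarrow> peval g u = 0"
          using form_vanishes_on_sp2[OF g(2)] sp by blast
        \<comment> \<open>At \<open>w\<close> the form \<open>f\<close> vanishes and
          \<open>G\<close> is 1, so \<open>\<kappa>\<close> would be 0 and \<open>f\<close> itself
          would vanish on the line.\<close>
        have "\<kappa> = 0" using van[OF sp2_mem(2)] f(3) G_w by (simp add: g_def)
        then have "g = f" by (simp add: g_def pscale_def)
        then have "poly (lin f v w) x = 0" for x
          using van[OF sp2_I[of 1 v x w]] by (simp add: poly_lin)
        then show False using f(4) poly_eq_0_if_all_zero by fastforce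
      qed
      moreover have "coeff (lin g a b) d = 0"
        unfolding lin_form(2)[OF g(2)] using False by (simp add: g_def \<kappa>_def)
      ultimately show ?thesis using g by blast
    qed
    then obtain g where g: "g \<in> I" "is_form N d g" "lin g a b \<noteq> 0" "coeff (lin g a b) d = 0" by blast
    let ?g = "lin g a b"
    have dg: "degree ?g \<le> d - 1"
    proof -
      have "degree ?g \<noteq> d" using g(3,4) by (metis leading_coeff_0_iff)
      then show ?thesis using lin_form(1)[OF g(2), of a b] by simp
    qed
    have "\<exists>e. p - (\<Sum>i<d - 1. pscale (e i) (c ^ i)) \<in> ?W" if p: "p \<in> polys N" for p
    proof -
      define r where "r = lin p a b mod ?g"
      define Q where "Q = lin p a b div ?g"
      have pQ: "lin p a b = Q * ?g + r" by (simp add: Q_def r_def)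
      have dr: "degree r < d - 1 \<or> r = 0"
        using degree_mod_less[OF g(3), of "lin p a b"] dg by (auto simp: r_def)
      define R where "R = (\<Sum>i<d - 1. pscale (coeff r i) (c ^ i))"
      define T where "T = (\<Sum>i<Suc (degree Q). pscale (coeff Q i) (c ^ i))"
      have RT: "R \<in> polys N" "T \<in> polys N" unfolding R_def T_def using cp by auto
      have "lin R a b = r"
        unfolding R_def lin_sum lin_scale lin_power lc by (rule sum_coeff_monom[OF dr])
      moreover have "lin T a b = Q"
        unfolding T_def lin_sum lin_scale lin_power lc by (rule sum_coeff_monom) simp
      ultimately have "lin (p - T * g - R) a b = 0" using pQ by simp
      moreover have "p - T * g - R \<in> polys N" using p RT I_polys[OF g(1)] by auto
      ultimately obtain l s where ls: "l \<in> hideal N ?l" "s \<in> polys N" "p - T * g - R = l + (h - 1) * s"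
        using lin_kernel[OF h(1) ab(5,6)] unfolding sp by blast
      then have "p - R = T * g + l + (h - 1) * s" by (simp add: algebra_simps)
      then have "p - R \<in> ?W" unfolding mem_J_affine using I_mult[OF RT(2) g(1)] ls by blast
      then show ?thesis unfolding R_def by (rule exI[of _ "coeff r"])
    qed
    then have "d \<le> d - 1" by (rule le)
    then show False using d_pos by simp
  qed
qed

end

section \<open>Tangency\<close>

lemma lin_shift: "lin f (\<lambda>i. v i + x * b i) b = pcompose (lin f v b) [:x, 1:]"
  unfolding lin_def
  by (subst kalg_poly.psub_hom[where h="\<lambda>p. pcompose p [:x, 1:]"])
    (simp_all add: pcompose_add pcompose_mult pcompose_pCons pcompose_1 add.commute mult.commute)

text \<open>Substituting \<open>c X\<close> for \<open>X\<close> turns \<open>f(c a + X b)\<close>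
  into \<open>f(c (a + X b))\<close>, from which \<open>c ^ m\<close> factors out.\<close>

lemma coeff_lin_scale:
  assumes "is_form N m f"
  shows "c ^ j * coeff (lin f (vscale c a) b) j = c ^ m * coeff (lin f a b) j"
proof -
  have "pcompose (lin f (vscale c a) b) [:0, c:] = psub (\<lambda>e. [:e:]) f (\<lambda>i. [:c:] * [:a i, b i:])"
    unfolding lin_def vscale_def
    by (subst kalg_poly.psub_hom[where h="\<lambda>p. pcompose p [:0, c:]"])
      (simp_all add: pcompose_add pcompose_mult pcompose_pCons pcompose_1 mult.commute)
  also have "\<dots> = [:c:] ^ m * lin f a b"
    unfolding lin_def by (rule kalg_poly.psub_form_scale[OF assms])
  finally have "coeff (pcompose (lin f (vscale c a) b) [:0, c:]) j =
      c ^ m * coeff (lin f a b) j"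
    by (simp add: poly_const_pow)
  then show ?thesis by (simp add: coeff_pcompose_linear)
qed

lemma coeff_1_pderiv: "coeff p 1 = poly (pderiv p) 0"
  by (simp add: poly_0_coeff_0 coeff_pderiv)

lemma part_deriv_single:
  "part_deriv i (Poly_Mapping.single t c) =
    Poly_Mapping.single (t - Poly_Mapping.single i 1) (of_nat (Poly_Mapping.lookup t i) * c)"
  by (simp add: part_deriv_def)

lemma part_deriv_add: "part_deriv i (f + g) = part_deriv i f + part_deriv i g"
  unfolding part_deriv_def
  by (rule setsum_keys_plus_distrib) (auto simp: algebra_simps single_add)

text \<open>Translates the equations of \<open>tangent_space\<close> into the coefficient of
  \<open>X\<close> along a line, so that tangency can be read off from a double root.\<close>

lemma directional_derivative:
  assumes "f \<in> polys N"
  shows "(\<Sum>i\<le>N. peval (part_deriv i f) u * b i) = coeff (lin f u b) 1"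
proof -
  have "(\<forall>t\<in>Poly_Mapping.keys f. Poly_Mapping.keys t \<subseteq> {..N})" using assms by (simp add: polys_def)
  show ?thesis
  proof (induction f rule: mpoly_induct)
    case zero
    show ?case by (simp add: part_deriv_def)
  next
    case (add g h)
    then show ?case by (simp add: part_deriv_add distrib_right sum.distrib)
  next
    case (single t c)
    have tN: "Poly_Mapping.keys t \<subseteq> {..N}" using single assms by (auto simp: polys_def)
    let ?T = "Poly_Mapping.lookup t"
    have val: "mon_val u (t - Poly_Mapping.single i 1) = u i ^ (?T i - 1) * (\<Prod>j\<in>{..N} - {i}. u j ^ ?T j)"
      if i: "i \<le> N" for i
    proof -
      have "Poly_Mapping.keys (t - Poly_Mapping.single i 1) \<subseteq> Poly_Mapping.keys t"
        by (auto simp: in_keys_iff lookup_minus)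
      then have "Poly_Mapping.keys (t - Poly_Mapping.single i 1) \<subseteq> {..N}"
        using tN by blast
      then have "mon_val u (t - Poly_Mapping.single i 1) =
          (\<Prod>j\<in>{..N}. u j ^ Poly_Mapping.lookup (t - Poly_Mapping.single i 1) j)"
        by (intro mon_val_superset) auto
      also have "\<dots> = u i ^ Poly_Mapping.lookup (t - Poly_Mapping.single i 1) i *
          (\<Prod>j\<in>{..N} - {i}. u j ^ Poly_Mapping.lookup (t - Poly_Mapping.single i 1) j)"
        using i by (intro prod.remove) auto
      also have "(\<Prod>j\<in>{..N} - {i}. u j ^ Poly_Mapping.lookup (t - Poly_Mapping.single i 1) j) =
          (\<Prod>j\<in>{..N} - {i}. u j ^ ?T j)"
        by (intro prod.cong) (auto simp: lookup_minus lookup_single)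
      finally show ?thesis by (simp add: lookup_minus)
    qed
    have "coeff (lin (Poly_Mapping.single t c) u b) 1 =
        c * poly (pderiv (mon_val (\<lambda>i. [:u i, b i:]) t)) 0"
      unfolding coeff_1_pderiv lin_def kalg_poly.psub_single by (simp add: pderiv_smult)
    also have "mon_val (\<lambda>i. [:u i, b i:]) t = (\<Prod>j\<in>{..N}. [:u j, b j:] ^ ?T j)"
      using tN by (intro mon_val_superset) auto
    also have "poly (pderiv \<dots>) 0 = (\<Sum>i\<le>N. of_nat (?T i) * (u i ^ (?T i - 1) * (\<Prod>j\<in>{..N} - {i}. u j ^ ?T j)) * b i)"
      by (simp add: pderiv_prod poly_sum poly_prod pderiv_power pderiv_pCons ac_simps)
    finally show ?case
      by (simp add: part_deriv_single peval_psub kalg_id.psub_single val[unfolded One_nat_def] sum_distrib_left ac_simps)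
  qed
qed

section \<open>Double roots in a pencil of lines\<close>

lemma sum_lessThan_add: "(\<Sum>i<m + n. f i) = (\<Sum>i<m. f i) + (\<Sum>k<n. f (m + k))"
  for m n :: nat and f :: "nat \<Rightarrow> 'a::comm_monoid_add"
  by (induction n) (simp_all add: add.assoc)

text \<open>Counted with multiplicity, \<open>Q\<close> has more roots than \<open>T\<close> can
  absorb. The induction cancels a root of \<open>Q\<close> that is not one of \<open>R\<close> from
  both \<open>Q\<close> and \<open>T\<close>.\<close>

lemma common_root_if_dvd_mult:
  fixes Q R T :: "('k::alg_closed_field) poly"
  assumes "Q dvd T * R" "T \<noteq> 0" "degree T < degree Q"
  shows "\<exists>x. poly Q x = 0 \<and> poly R x = 0"
  using assms
proof (induction "degree T" arbitrary: Q T)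
  case 0
  then obtain x where x: "poly Q x = 0" using alg_closed_imp_poly_has_root[of Q] by auto
  have "poly (T * R) x = 0" using 0(2) x by (metis dvdE mult_zero_left poly_mult)
  moreover have "poly T x \<noteq> 0" using degree_eq_zeroE[OF 0(1)[symmetric]] 0(3) by force
  ultimately show ?case using x by auto
next
  case (Suc n)
  then obtain x where x: "poly Q x = 0" using alg_closed_imp_poly_has_root[of Q] by auto
  show ?case
  proof (cases "poly R x = 0")
    case False
    have "poly (T * R) x = 0" using Suc.prems(1) x by (metis dvdE mult_zero_left poly_mult)
    then have "poly T x = 0" using False by simp
    then obtain T1 Q1 where T1: "T = [:- x, 1:] * T1" and Q1: "Q = [:- x, 1:] * Q1"
      using x by (auto simp: poly_eq_0_iff_dvd elim!: dvdE)
    have nz: "T1 \<noteq> 0" "Q1 \<noteq> 0" using Suc.prems T1 Q1 by auto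
    have "[:- x, 1:] * Q1 dvd [:- x, 1:] * (T1 * R)" using Suc.prems(1) unfolding T1 Q1 by (simp only: mult.assoc)
    then have "Q1 dvd T1 * R" by (subst (asm) dvd_mult_cancel_left) simp
    moreover have "degree T = Suc (degree T1)"
      unfolding T1 by (subst degree_mult_eq) (use nz in auto)
    moreover have "degree Q = Suc (degree Q1)"
      unfolding Q1 by (subst degree_mult_eq) (use nz in auto)
    ultimately have "\<exists>z. poly Q1 z = 0 \<and> poly R z = 0"
      using Suc.prems(3) Suc.hyps(2) nz by (intro Suc.hyps(1)) auto
    then show ?thesis unfolding Q1 by auto
  qed (use x in blast)
qed

text \<open>
  The (transposed) Sylvester matrix of \<open>P\<close>, of degree \<open>d\<close>, and its derivative, regarded as a
  polynomial of degree \<open>d - 1\<close>; the columns are the coefficients of \<open>X\<^sup>i P\<close> for \<open>i < d - 1\<close> and of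
  \<open>X\<^sup>k P'\<close> for \<open>k < d\<close>.
\<close>

definition sylv :: "nat \<Rightarrow> (nat \<Rightarrow> 'a::comm_ring_1) \<Rightarrow> nat \<Rightarrow> nat \<Rightarrow> 'a" where
  "sylv d c j i = (if i < d - 1 then (if i \<le> j then c (j - i) else 0)
     else (if i - (d - 1) \<le> j then of_nat (Suc (j - (i - (d - 1)))) * c (Suc (j - (i - (d - 1)))) else 0))"

text \<open>The resultant of \<open>P\<close> and its derivative for the formal degrees
  \<open>d\<close> and \<open>d - 1\<close>. The coefficients are taken in a commutative ring, so
  that they may be polynomials in a parameter.\<close>

definition disc :: "nat \<Rightarrow> (nat \<Rightarrow> 'a::comm_ring_1) \<Rightarrow> 'a" where
  "disc d c = det (mat (2 * d - 1) (2 * d - 1) (\<lambda>(j, i). sylv d c j i))"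

lemma disc_expand:
  "disc d c = (\<Sum>p\<in>{p. p permutes {0..<2 * d - 1}}. of_int (sign p) * (\<Prod>j = 0..<2 * d - 1. sylv d c j (p j)))"
proof -
  have "p j < 2 * d - 1" if "p permutes {0..<2 * d - 1}" "j < 2 * d - 1" for p j
    using permutes_in_image[OF that(1), of j] that(2) by simp
  then show ?thesis
    unfolding disc_def by (subst det_def'[of _ "2 * d - 1"]) (auto intro!: sum.cong prod.cong)
qed

text \<open>A kernel vector of the matrix is a relation \<open>S P + T P' = 0\<close> with
  \<open>T\<close> nonzero of degree below \<open>d\<close>, so \<open>P\<close> divides
  \<open>T P'\<close>.\<close>

lemma common_root_if_disc_eq_0:
  fixes P :: "('k::alg_closed_field) poly"
  assumes P: "degree P = d" and d: "d \<ge> 1" and D: "disc d (coeff P) = 0"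
  shows "\<exists>x. poly P x = 0 \<and> poly (pderiv P) x = 0"
proof -
  let ?n = "2 * d - 1" and ?c = "coeff P"
  let ?A = "mat ?n ?n (\<lambda>(j, i). sylv d ?c j i)"
  have A: "?A \<in> carrier_mat ?n ?n" by simp
  obtain u where u: "u \<in> carrier_vec ?n" "u \<noteq> 0\<^sub>v ?n" "?A *\<^sub>v u = 0\<^sub>v ?n"
    using D det_0_iff_vec_prod_zero_field[OF A] unfolding disc_def by blast
  define S where "S = (\<Sum>i<d - 1. monom (u $ i) i)"
  define T where "T = (\<Sum>k<d. monom (u $ (d - 1 + k)) k)"
  have cS: "coeff S i = (if i < d - 1 then u $ i else 0)" for i
    by (simp add: S_def coeff_sum)
  have cT: "coeff T k = (if k < d then u $ (d - 1 + k) else 0)" for k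
    by (simp add: T_def coeff_sum)
  have P0: "P \<noteq> 0" using P d by auto
  have n: "?n = (d - 1) + d" using d by simp
  have ST: "S * P + T * pderiv P = 0"
  proof (rule poly_eqI)
    fix j
    have cm: "coeff (monom a i * q) j = (if i \<le> j then a * coeff q (j - i) else 0)"
      for a i and q :: "'k poly" by (simp add: coeff_monom_mult)
    have "coeff (S * P + T * pderiv P) j =
        (\<Sum>i<d - 1. u $ i * sylv d ?c j i) + (\<Sum>k<d. u $ (d - 1 + k) * sylv d ?c j (d - 1 + k))"
      unfolding S_def T_def sum_distrib_right coeff_add coeff_sum cm
      by (intro arg_cong2[where f="(+)"] sum.cong refl) (auto simp: sylv_def coeff_pderiv)
    also have "\<dots> = (\<Sum>i<?n. u $ i * sylv d ?c j i)"
      unfolding n sum_lessThan_add ..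
    finally have e: "coeff (S * P + T * pderiv P) j = (\<Sum>i<?n. u $ i * sylv d ?c j i)" .
    show "coeff (S * P + T * pderiv P) j = coeff 0 j"
    proof (cases "j < ?n")
      case True
      have "(?A *\<^sub>v u) $ j = (\<Sum>i<?n. u $ i * sylv d ?c j i)"
        using True u(1) by (simp add: scalar_prod_def mult.commute atLeast0LessThan)
      moreover have "(?A *\<^sub>v u) $ j = 0" unfolding u(3) using True by simp
      ultimately show ?thesis using e by (simp only: coeff_0)
    next
      case False
      have "sylv d ?c j i = 0" if "i < ?n" for i
        using False that P d by (auto simp: sylv_def intro!: coeff_eq_0)
      then show ?thesis unfolding e by simp
    qed
  qed
  have T0: "T \<noteq> 0"
  proof
    assume "T = 0"
    then have "S = 0" using ST P0 by simp
    have "u $ i = 0" if "i < ?n" for i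
    proof (cases "i < d - 1")
      case True
      then show ?thesis using cS[of i] \<open>S = 0\<close> by simp
    next
      case False
      then show ?thesis using cT[of "i - (d - 1)"] \<open>T = 0\<close> that by (simp split: if_splits)
    qed
    then have "u = 0\<^sub>v ?n" using u(1) by (intro eq_vecI) auto
    then show False using u(2) by simp
  qed
  have "P dvd T * pderiv P"
    using ST by (intro dvdI[of _ _ "- S"]) (simp add: eq_neg_iff_add_eq_0 add.commute mult.commute)
  moreover have "degree T < d"
    using d by (intro degree_lessI) (auto simp: cT T0)
  ultimately show ?thesis using T0 P by (intro common_root_if_dvd_mult) auto
qed

text \<open>The coefficient of \<open>X^j\<close> carries weight \<open>d - j\<close>, as in
  \<open>G(\<mu> a + X w)\<close>. The total weight of the columns exceeds that of the rows by
  \<open>d\<close> for each of the \<open>d - 1\<close> columns coming from \<open>P\<close>, which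
  is the exponent.\<close>

lemma disc_homogeneous:
  fixes c c' :: "nat \<Rightarrow> 'k::field"
  assumes \<mu>: "\<mu> \<noteq> 0" and c: "\<And>j. \<mu> ^ j * c' j = \<mu> ^ d * c j" "\<And>j. j > d \<Longrightarrow> c j = 0" and d: "d \<ge> 1"
  shows "disc d c' = \<mu> ^ (d * (d - 1)) * disc d c"
proof -
  let ?n = "2 * d - 1"
  \<comment> \<open>Column weights: after row \<open>j\<close> is scaled by
    \<open>\<mu> ^ j\<close>, column \<open>i\<close> carries the factor \<open>\<mu> ^ b i\<close>.
    The columns of the derivative have weight equal to their index.\<close>
  define b where "b i = (if i < d - 1 then d + i else i)" for i
  have sy: "\<mu> ^ j * sylv d c' j i = \<mu> ^ b i * sylv d c j i" for j i
  proof -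
    have key: "\<mu> ^ (a + m) * c' m = \<mu> ^ (a + d) * c m" for a m
      using c(1)[of m] by (simp add: power_add mult.assoc)
    show ?thesis
    proof (cases "i < d - 1")
      case True
      then show ?thesis using key[of i "j - i"] by (auto simp: sylv_def b_def add.commute)
    next
      case False
      let ?k = "i - (d - 1)"
      show ?thesis
      proof (cases "?k \<le> j")
        case True
        let ?m = "Suc (j - ?k)"
        have "\<mu> * (\<mu> ^ j * c' ?m) = \<mu> ^ (?k + ?m) * c' ?m" using True by (simp add: mult.assoc)
        also have "\<dots> = \<mu> ^ (?k + d) * c ?m" by (rule key)
        also have "?k + d = Suc i" using False d by simp
        finally have "\<mu> ^ j * c' ?m = \<mu> ^ i * c ?m" using \<mu> by simp
        then show ?thesis using False True by (simp add: sylv_def b_def mult.left_commute)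
      qed (use False in \<open>simp add: sylv_def\<close>)
    qed
  qed
  have sb: "(\<Sum>i = 0..<?n. b i) = (\<Sum>i = 0..<?n. i) + d * (d - 1)"
  proof -
    have "(\<Sum>i = 0..<?n. if i < d - 1 then d else 0) = (\<Sum>i\<in>{i \<in> {0..<?n}. i < d - 1}. d)"
      by (rule sum.inter_filter[symmetric]) simp
    also have "{i \<in> {0..<?n}. i < d - 1} = {0..<d - 1}" by auto
    finally have "(\<Sum>i = 0..<?n. if i < d - 1 then d else 0) = d * (d - 1)" by simp
    moreover have "(\<Sum>i = 0..<?n. b i) = (\<Sum>i = 0..<?n. i + (if i < d - 1 then d else 0))"
      by (intro sum.cong) (auto simp: b_def)
    ultimately show ?thesis by (simp only: sum.distrib)
  qed
  have "\<mu> ^ (\<Sum>i = 0..<?n. i) * disc d c' = \<mu> ^ (\<Sum>i = 0..<?n. b i) * disc d c"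
    unfolding disc_expand sum_distrib_left
  proof (intro sum.cong refl)
    fix p assume "p \<in> {p. p permutes {0..<?n}}"
    then have p: "p permutes {0..<?n}" by simp
    have "\<mu> ^ (\<Sum>i = 0..<?n. i) * (\<Prod>j = 0..<?n. sylv d c' j (p j)) = (\<Prod>j = 0..<?n. \<mu> ^ j * sylv d c' j (p j))"
      by (simp add: power_sum prod.distrib)
    also have "\<dots> = (\<Prod>j = 0..<?n. \<mu> ^ b (p j)) * (\<Prod>j = 0..<?n. sylv d c j (p j))"
      unfolding sy by (simp add: prod.distrib)
    also have "(\<Prod>j = 0..<?n. \<mu> ^ b (p j)) = \<mu> ^ (\<Sum>i = 0..<?n. b i)"
      using prod.permute[OF p, of "\<lambda>i. \<mu> ^ b i"] by (simp add: power_sum comp_def)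
    finally have e: "\<mu> ^ (\<Sum>i = 0..<?n. i) * (\<Prod>j = 0..<?n. sylv d c' j (p j)) =
        \<mu> ^ (\<Sum>i = 0..<?n. b i) * (\<Prod>j = 0..<?n. sylv d c j (p j))" .
    show "\<mu> ^ (\<Sum>i = 0..<?n. i) * (of_int (sign p) * (\<Prod>j = 0..<?n. sylv d c' j (p j))) =
        \<mu> ^ (\<Sum>i = 0..<?n. b i) * (of_int (sign p) * (\<Prod>j = 0..<?n. sylv d c j (p j)))"
      using e by (simp only: mult.left_commute[of _ "of_int (sign p)"])
  qed
  then show ?thesis unfolding sb using \<mu> by (simp add: power_add)
qed

lemma coeff_lin_polynomial:
  "\<exists>C. \<forall>j t. coeff (lin f (\<lambda>i. a i + t * b i) w) j = poly (C j) t"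
proof -
  interpret kalg "\<lambda>c::'a. [:[:c:]:]" by unfold_locales (auto simp: pCons_one)
  \<comment> \<open>The inner variable is the \<open>X\<close> of a line, the outer one the
    parameter of the pencil; evaluating the outer one at \<open>[:t:]\<close> gives the line through
    \<open>a + t b\<close>.\<close>
  define Q where "Q = psub (\<lambda>c. [:[:c:]:]) f (\<lambda>i. [:[:a i, w i:], [:b i:]:])"
  have Q: "lin f (\<lambda>i. a i + t * b i) w = poly Q [:t:]" for t
    unfolding Q_def lin_def
    by (subst psub_hom[where h="\<lambda>p. poly p [:t:]"]) (simp_all add: mult.commute)
  have "coeff (lin f (\<lambda>i. a i + t * b i) w) j =
      (\<Sum>i\<le>degree Q. coeff (coeff Q i) j * t ^ i)" for t j
    unfolding Q by (simp add: poly_altdef coeff_sum poly_const_pow mult.commute)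
  then have "coeff (lin f (\<lambda>i. a i + t * b i) w) j =
      poly (\<Sum>i\<le>degree Q. monom (coeff (coeff Q i) j) i) t" for t j
    by (simp add: poly_sum poly_monom)
  then show ?thesis
    by (intro exI[of _ "\<lambda>j. \<Sum>i\<le>degree Q. monom (coeff (coeff Q i) j) i"]) blast
qed

lemma disc_polynomial: "disc d (\<lambda>j. poly (C j) t) = poly (disc d C) t"
proof -
  have "sylv d (\<lambda>j. poly (C j) t) j i = poly (sylv d C j i) t" for j i
    by (simp add: sylv_def)
  then show ?thesis by (simp add: disc_expand poly_sum poly_prod)
qed

text \<open>
  The discriminant of \<open>G(s v1 + t v2 + X w)\<close> is a form of positive degree \<open>d (d - 1)\<close> in \<open>(s, t)\<close>. If
  it had no zero with \<open>s = 1\<close>, it would be a multiple of a power of \<open>s\<close> and vanish at \<open>(0, 1)\<close>.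
\<close>

lemma double_root_in_pencil:
  fixes G :: "('k::alg_closed_field) mpoly"
  assumes G: "is_form N d G" "peval G w = 1" and d: "d \<ge> 2"
  shows "\<exists>s t x. (s \<noteq> 0 \<or> t \<noteq> 0) \<and> poly (lin G (lc s v1 t v2) w) x = 0 \<and>
    poly (pderiv (lin G (lc s v1 t v2) w)) x = 0"
proof (rule ccontr)
  assume neg: "\<not> ?thesis"
  define D where "D s t = disc d (coeff (lin G (lc s v1 t v2) w))" for s t
  have deg: "degree (lin G v w) = d" for v
  proof (rule antisym)
    show "d \<le> degree (lin G v w)"
      using lin_form(2)[OF G(1), of v w] G(2) by (intro le_degree) simp
  qed (rule lin_form(1)[OF G(1)])
  have nz: "D s t \<noteq> 0" if "s \<noteq> 0 \<or> t \<noteq> 0" for s t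
    using common_root_if_disc_eq_0[OF deg, of "lc s v1 t v2"] neg that d unfolding D_def by fastforce
  obtain C1 where C1: "\<And>j t. coeff (lin G (\<lambda>i. v1 i + t * v2 i) w) j = poly (C1 j) t"
    using coeff_lin_polynomial[of G v1 v2 w] by blast
  obtain C2 where C2: "\<And>j t. coeff (lin G (\<lambda>i. v2 i + t * v1 i) w) j = poly (C2 j) t"
    using coeff_lin_polynomial[of G v2 v1 w] by blast
  define p1 p2 where "p1 = disc d C1" and "p2 = disc d C2"
  have D1: "D 1 t = poly p1 t" for t
    using C1[of t] by (simp add: D_def p1_def flip: disc_polynomial) (metis)
  have D2: "D s 1 = poly p2 s" for s
  proof -
    have "lc s v1 1 v2 = (\<lambda>i. v2 i + s * v1 i)" by (simp add: add.commute)
    then have "D s 1 = disc d (\<lambda>j. poly (C2 j) s)" unfolding D_def using C2[of s] by metis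
    then show ?thesis by (simp add: p2_def disc_polynomial)
  qed
  have "degree p1 = 0"
  proof (rule ccontr)
    assume "degree p1 \<noteq> 0"
    then obtain t where "poly p1 t = 0" using alg_closed_imp_poly_has_root[of p1] by auto
    then show False using D1 nz[of 1 t] by simp
  qed
  then obtain c where c: "p1 = [:c:]" by (rule degree_eq_zeroE)
  \<comment> \<open>Homogeneity moves the point \<open>(s, 1)\<close> to \<open>(1, 1 / s)\<close>,
    where the discriminant is the constant \<open>c\<close>.\<close>
  have "D s 1 = s ^ (d * (d - 1)) * c" if s: "s \<noteq> 0" for s
  proof -
    have "vscale s (lc 1 v1 (1 / s) v2) = lc s v1 1 v2"
      using s by (simp add: vscale_def distrib_left)
    then have "D s 1 = s ^ (d * (d - 1)) * D 1 (1 / s)"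
      unfolding D_def using s d coeff_lin_scale[OF G(1), of s _ "lc 1 v1 (1 / s) v2" w] deg
      by (intro disc_homogeneous) (auto intro!: coeff_eq_0)
    then show ?thesis using D1[of "1 / s"] c by simp
  qed
  then have "poly (p2 - monom c (d * (d - 1))) s = 0" if "s \<noteq> 0" for s
    using that D2 by (simp add: poly_monom mult.commute)
  then have "UNIV - {0} \<subseteq> {s. poly (p2 - monom c (d * (d - 1))) s = 0}" by blast
  then have "infinite {s. poly (p2 - monom c (d * (d - 1))) s = 0}"
    using infinite_alg_closed_field[where 'k='k] by (meson finite.emptyI finite_Diff2 finite_insert finite_subset)
  then have "p2 - monom c (d * (d - 1)) = 0" using poly_roots_finite by blast
  \<comment> \<open>Here \<open>d \<ge> 2\<close> enters: the exponent \<open>d * (d - 1)\<close> is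
    positive.\<close>
  then have "poly p2 0 = 0" using d by (simp add: poly_monom)
  then show False using D2[of 0] nz[of 0 1] by simp
qed

section \<open>The secant locus\<close>

lemma pt_eq_iff: "pt a = pt b \<longleftrightarrow> (\<exists>c. c \<noteq> 0 \<and> a = vscale c b)"
proof
  assume "pt a = pt b"
  then have "a \<in> pt b" using pt_self[of a] by simp
  then show "\<exists>c. c \<noteq> 0 \<and> a = vscale c b" by (auto simp: pt_def)
qed (use pt_vscale in auto)

lemma lc_vec: "lc s a t b = vscale s a + vscale t b"
  by (simp add: vscale_def plus_fun_def)

lemma subspace_lc: "kv.subspace S \<Longrightarrow> a \<in> S \<Longrightarrow> b \<in> S \<Longrightarrow> lc s a t b \<in> S"
  unfolding lc_vec by (intro kv.subspace_add kv.subspace_scale)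

context secant_setup
begin

abbreviation qpt :: "'k ppoint" where "qpt \<equiv> pt w"

text \<open>Formulated without the projection; \<open>secant_locus_eq\<close> identifies it with the
  secant locus.\<close>

abbreviation \<Sigma> :: "'k ppoint set" where "\<Sigma> \<equiv> X \<inter> \<Lambda>"

lemma on_q_pt: "v \<noteq> (\<lambda>_. 0) \<Longrightarrow> on_q v \<Longrightarrow> pt v = qpt"
  unfolding pt_eq_iff on_q_def by (metis vscale_eq_0)

lemma q_notin_X: "qpt \<notin> X"
  using pt_X[OF w_kvec w_nz] G_I G_w by (metis zero_neq_one)

lemma not_on_q_nz: "\<not> on_q v \<Longrightarrow> v \<noteq> (\<lambda>_. 0)"
  by (auto simp: on_q_def vscale_def)

lemma on_q_add_w: "on_q (lc 1 v x w) \<longleftrightarrow> on_q v"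
proof -
  have "vscale (v i0 + x * w i0) w j = vscale (v i0) w j + x * w j" for j
    by (simp add: vscale_def w_i0 distrib_right)
  then show ?thesis unfolding on_q_def fun_eq_iff by simp
qed

lemma X_E:
  assumes "p \<in> X"
  obtains v where "v \<in> kvec N" "\<not> on_q v" "p = pt v"
proof -
  have "p \<in> PN N" using assms X_PN by blast
  then obtain v where v: "v \<in> kvec N" "v \<noteq> (\<lambda>_. 0)" "p = pt v" by (rule PN_E)
  have "\<not> on_q v"
  proof
    assume "on_q v"
    then have "p = qpt" using on_q_pt[OF v(2)] v(3) by simp
    then show False using q_notin_X assms by simp
  qed
  then show ?thesis by (rule that[OF v(1) _ v(3)])
qed

lemma Sigma_E:
  assumes "p \<in> \<Sigma>"
  obtains v where "v \<in> V" "\<not> on_q v" "p = pt v"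
proof -
  have "p \<in> X" using assms by blast
  then obtain v where v: "v \<in> kvec N" "\<not> on_q v" "p = pt v" by (rule X_E)
  then have "v \<in> V" using assms pt_in_proj_of[OF subspace_V not_on_q_nz[OF v(2)]] by blast
  then show ?thesis by (rule that[OF _ v(2,3)])
qed

text \<open>On a line of the cone every element of \<open>I\<close> is a multiple of
  \<open>G\<close>, so a zero of \<open>G\<close> is a common zero of \<open>I\<close>.\<close>

lemma zero_of_G_in_X:
  assumes v: "v \<in> V" "\<not> on_q v" and z: "poly (lin G v w) x = 0"
  shows "pt (lc 1 v x w) \<in> \<Sigma>"
proof -
  have uV: "lc 1 v x w \<in> V" by (rule subspace_lc[OF subspace_V v(1) w_V])
  have un: "\<not> on_q (lc 1 v x w)" using v(2) on_q_add_w by blast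
  have "peval f (lc 1 v x w) = 0" if "f \<in> I" for f
  proof -
    obtain K where "lin f v w = lin G v w * K" using lin_G_dvd[OF v \<open>f \<in> I\<close>] by (rule dvdE)
    then have "poly (lin f v w) x = 0" using z by simp
    then show ?thesis by (simp add: poly_lin)
  qed
  then have "pt (lc 1 v x w) \<in> X" using pt_X not_on_q_nz[OF un] uV V_kvec by blast
  then show ?thesis using pt_in_proj_of_nz[OF subspace_V uV not_on_q_nz[OF un]] by blast
qed

lemma point_of_Sigma_on_line:
  assumes v: "v \<in> V" "\<not> on_q v"
  obtains x where "pt (lc 1 v x w) \<in> \<Sigma>"
proof -
  have "degree (lin G v w) > 0" using lin_G(1) d_pos by simp
  then obtain x where "poly (lin G v w) x = 0" using alg_closed_imp_poly_has_root by blast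
  from that[OF zero_of_G_in_X[OF v this]] show ?thesis .
qed

lemma Sigma_nonempty_iff: "\<Sigma> \<noteq> {} \<longleftrightarrow> (\<exists>v\<in>V. \<not> on_q v)"
proof
  assume "\<Sigma> \<noteq> {}"
  then obtain p where "p \<in> \<Sigma>" by blast
  then show "\<exists>v\<in>V. \<not> on_q v" by (rule Sigma_E) blast
next
  assume "\<exists>v\<in>V. \<not> on_q v"
  then obtain v where v: "v \<in> V" "\<not> on_q v" by blast
  obtain x where "pt (lc 1 v x w) \<in> \<Sigma>" by (rule point_of_Sigma_on_line[OF v])
  then show "\<Sigma> \<noteq> {}" by blast
qed

text \<open>Every vector of \<open>V\<close> that is not a multiple of \<open>w\<close> differs from
  one over a point of \<open>\<Sigma>\<close> by a multiple of \<open>w\<close>, because its line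
  contains a zero of \<open>G\<close>.\<close>

lemma lin_span_Sigma:
  assumes ne: "\<Sigma> \<noteq> {}"
  shows "lin_span N (insert qpt \<Sigma>) = \<Lambda>"
proof
  have "lin_subspace N \<Lambda>" unfolding lin_subspace_def using subspace_V V_kvec by blast
  moreover have "insert qpt \<Sigma> \<subseteq> \<Lambda>" using pt_in_proj_of_nz[OF subspace_V w_V w_nz] by blast
  ultimately show "lin_span N (insert qpt \<Sigma>) \<subseteq> \<Lambda>" unfolding lin_span_def by blast
  show "\<Lambda> \<subseteq> lin_span N (insert qpt \<Sigma>)"
    unfolding lin_span_def
  proof (intro Inter_greatest)
    fix L assume "L \<in> {L. lin_subspace N L \<and> insert qpt \<Sigma> \<subseteq> L}"
    then obtain W where W: "kv.subspace W" "L = proj_of W" "insert qpt \<Sigma> \<subseteq> proj_of W"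
      by (auto simp: lin_subspace_def)
    have wW: "w \<in> W" using W(3) pt_in_proj_of[OF W(1) w_nz] by blast
    have "v \<in> W" if v: "v \<in> V" for v
    proof (cases "on_q v")
      case True
      then show ?thesis using kv.subspace_scale[OF W(1) wW] by (metis on_q_def)
    next
      case False
      obtain x where x: "pt (lc 1 v x w) \<in> \<Sigma>" using point_of_Sigma_on_line[OF v False] .
      have "\<not> on_q (lc 1 v x w)" using False on_q_add_w by blast
      then have "lc 1 v x w \<in> W" using x W(3) pt_in_proj_of[OF W(1) not_on_q_nz] by blast
      then have "lc 1 (lc 1 v x w) (- x) w \<in> W" by (rule subspace_lc[OF W(1) _ wW])
      then show ?thesis by simp
    qed
    then show "\<Lambda> \<subseteq> L" unfolding W(2) proj_of_pt by blast
  qed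
qed

lemma Sigma_eq: "\<Sigma> = \<Lambda> \<inter> zero_locus N {G}"
proof
  show "\<Sigma> \<subseteq> \<Lambda> \<inter> zero_locus N {G}"
    using X_PN hideal_peval[OF G_I] by (auto simp: zero_locus_def)
  show "\<Lambda> \<inter> zero_locus N {G} \<subseteq> \<Sigma>"
  proof
    fix p assume p: "p \<in> \<Lambda> \<inter> zero_locus N {G}"
    then obtain v where v: "v \<in> V" "v \<noteq> (\<lambda>_. 0)" "p = pt v" by (auto simp: proj_of_pt)
    have Gv: "peval G v = 0" using p v(3) by (auto simp: zero_locus_def)
    have nq: "\<not> on_q v"
    proof
      assume q: "on_q v"
      then have "peval G v = v i0 ^ d"
        using peval_form_vscale[OF G_form, of "v i0" w] G_w by (simp add: on_q_def)
      then have "v i0 = 0" using Gv by simp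
      then show False using q v(2) by (metis on_q_def vscale_eq_0)
    qed
    have "poly (lin G v w) 0 = 0" using Gv by (simp add: poly_lin)
    from zero_of_G_in_X[OF v(1) nq this] show "p \<in> \<Sigma>" using v(3) by simp
  qed
qed

lemma hypersurface_Sigma:
  assumes ne: "\<Sigma> \<noteq> {}"
  shows "is_hypersurface N d \<Lambda> \<Sigma> (inter_ideal N X \<Lambda>)"
  unfolding is_hypersurface_def
proof (intro exI[of _ G] conjI G_form Sigma_eq)
  show "G \<notin> hideal N \<Lambda>"
    using form_in_hideal_proj_of[OF G_form, of V] w_V w_nz G_w by auto
  show "saturation N (inter_ideal N X \<Lambda>) = saturation N (ideal_sum (hideal N \<Lambda>) (principal N G))"
    using ideal_on_cone ne unfolding Sigma_nonempty_iff inter_ideal_def by simp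
qed

lemma independent_v_w:
  assumes "\<not> on_q v"
  shows "v \<noteq> w" "kv.independent {v, w}"
proof -
  show "v \<noteq> w" using assms w_i0 by (auto simp: on_q_def vscale_def)
  have "kv.span {w} = range (\<lambda>c. vscale c w)" by (rule kv.span_singleton)
  then have "v \<notin> kv.span {w}" using assms on_q_vscale_w by auto
  moreover have "kv.independent {w}" using w_nz by (simp add: zero_fun_def)
  ultimately show "kv.independent {v, w}" by (simp add: kv.independent_insert)
qed

lemma sp2_eqI:
  assumes "a \<in> sp2 v w" "\<not> on_q a"
  shows "sp2 a w = sp2 v w"
proof (intro subset_antisym sp2_subset subspace_sp2 sp2_mem assms(1))
  obtain s t where st: "a = lc s v t w" using assms(1) by (auto simp: sp2_def)
  have s: "s \<noteq> 0"
  proof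
    assume "s = 0"
    then have "a = vscale t w" by (simp add: st vscale_def)
    then show False using assms(2) on_q_vscale_w by simp
  qed
  have "v = lc (1 / s) a (- (t / s)) w" using s by (simp add: st fun_eq_iff distrib_left)
  then show "v \<in> sp2 a w" using sp2_I by metis
qed

text \<open>The length criteria concern planes \<open>sp2 v w\<close>. A two-dimensional space
  containing \<open>w\<close> has this form for any of its vectors \<open>v\<close> outside the
  multiples of \<open>w\<close>.\<close>

lemma secant_line_iff:
  "is_secant_line N X qpt d l \<longleftrightarrow> (\<exists>v\<in>V. \<not> on_q v \<and> l = proj_of (sp2 v w))"
proof
  assume "is_secant_line N X qpt d l"
  then obtain W where W: "kv.subspace W" "W \<subseteq> kvec N" "kv.dim W = 2" "l = proj_of W" "qpt \<in> l"
    and len: "scheme_length N (inter_ideal N X l) d"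
    by (auto simp: is_secant_line_def is_line_def)
  have wW: "w \<in> W" using W(4,5) pt_in_proj_of[OF W(1) w_nz] by blast
  obtain B where B: "B \<subseteq> W" "kv.independent B" "W \<subseteq> kv.span B" "card B = 2"
    using kv.basis_exists[of W] W(3) by metis
  have finB: "finite B" using B(4) by (metis card.infinite zero_neq_numeral)
  have bound: "finite S \<and> card S \<le> 2" if "kv.independent S" "S \<subseteq> W" for S
    using kv.independent_span_bound[OF finB that(1)] that(2) B(3,4) by auto
  have "\<exists>v\<in>W. \<not> on_q v"
  proof (rule ccontr)
    assume "\<not> (\<exists>v\<in>W. \<not> on_q v)"
    then have "B \<subseteq> kv.span {w}" using B(1) unfolding kv.span_singleton on_q_def by blast
    then have "card B \<le> card {w}" using kv.independent_span_bound[OF _ B(2), of "{w}"] by simp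
    then show False using B(4) by simp
  qed
  then obtain v where v: "v \<in> W" "\<not> on_q v" by blast
  have "W = sp2 v w"
  proof
    show "sp2 v w \<subseteq> W" by (rule sp2_subset[OF W(1) v(1) wW])
    show "W \<subseteq> sp2 v w"
    proof (rule ccontr)
      assume "\<not> W \<subseteq> sp2 v w"
      then obtain u where u: "u \<in> W" "u \<notin> kv.span {v, w}" unfolding sp2_span by blast
      then have uv: "u \<notin> {v, w}" using kv.span_base by blast
      then have "kv.independent {u, v, w}"
        using u(2) independent_v_w(2)[OF v(2)] by (simp add: kv.independent_insert)
      moreover have "card {u, v, w} = 3" using uv independent_v_w(1)[OF v(2)] by simp
      ultimately show False using bound[of "{u, v, w}"] u(1) v(1) wW by simp
    qed
  qed
  then show "\<exists>v\<in>V. \<not> on_q v \<and> l = proj_of (sp2 v w)"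
    using in_V_if_scheme_length[of v] v W(2,4) len by blast
next
  assume "\<exists>v\<in>V. \<not> on_q v \<and> l = proj_of (sp2 v w)"
  then obtain v where v: "v \<in> V" "\<not> on_q v" "l = proj_of (sp2 v w)" by blast
  have "kv.dim (sp2 v w) = 2"
    unfolding sp2_span using kv.dim_span_eq_card_independent[OF independent_v_w(2)[OF v(2)]]
      independent_v_w(1)[OF v(2)] by simp
  moreover have "sp2 v w \<subseteq> kvec N" using v(1) V_kvec w_kvec by (intro sp2_subset subspace_kvec) auto
  ultimately have "is_line N l" unfolding is_line_def v(3) using subspace_sp2 by blast
  moreover have "qpt \<in> l" unfolding v(3) by (rule pt_in_proj_of_nz[OF subspace_sp2 sp2_mem(2) w_nz])
  ultimately show "is_secant_line N X qpt d l"
    unfolding is_secant_line_def using scheme_length_if_in_V[OF v(1,2)] v(3) by simp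
qed

text \<open>Every \<open>f\<close> in \<open>I\<close> is a multiple of \<open>G\<close> along the
  line, so a double zero of \<open>G\<close> kills the coefficient of \<open>X\<close> in
  \<open>f\<close>, the derivative at \<open>u\<close> in direction \<open>w\<close>.
  \<open>tangent_space\<close> quantifies over all representatives of both points, hence the factors
  \<open>c\<close> and \<open>c'\<close>.\<close>

lemma double_point_tangent:
  assumes u: "u \<in> V" "\<not> on_q u" and z: "coeff (lin G u w) 0 = 0" "coeff (lin G u w) 1 = 0"
  shows "qpt \<in> tangent_variety N X"
proof -
  have "poly (lin G u w) 0 = 0" using z(1) by (simp add: poly_0_coeff_0)
  from zero_of_G_in_X[OF u this] have uX: "pt u \<in> X" by simp
  have "(\<Sum>i\<le>N. peval (part_deriv i f) (vscale c u) * vscale c' w i) = 0"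
    if f: "f \<in> I" and c: "c \<noteq> 0" for f c c'
  proof -
    let ?u = "vscale c u"
    have cu: "?u \<in> V" by (rule kv.subspace_scale[OF subspace_V u(1)])
    have cn: "\<not> on_q ?u"
    proof
      assume "on_q ?u"
      then have "c * u j = c * u i0 * w j" for j
        unfolding on_q_def vscale_def by (rule fun_cong)
      then have "u j = u i0 * w j" for j using c by (metis mult.assoc mult_left_cancel)
      then have "on_q u" unfolding on_q_def vscale_def by (rule ext)
      then show False using u(2) by simp
    qed
    have "coeff (lin G ?u w) j = 0" if "coeff (lin G u w) j = 0" for j
      using coeff_lin_scale[OF G_form, of c j u w] c that by simp
    then have g: "coeff (lin G ?u w) 0 = 0" "coeff (lin G ?u w) 1 = 0" using z by auto
    obtain K where "lin f ?u w = lin G ?u w * K" using lin_G_dvd[OF cu cn f] by (rule dvdE)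
    then have "coeff (lin f ?u w) 1 = 0" using g by (simp add: coeff_mult)
    then have "(\<Sum>i\<le>N. peval (part_deriv i f) ?u * w i) = 0"
      using directional_derivative[OF I_polys[OF f], of ?u w] by simp
    moreover have "(\<Sum>i\<le>N. peval (part_deriv i f) ?u * vscale c' w i) =
        c' * (\<Sum>i\<le>N. peval (part_deriv i f) ?u * w i)"
      by (simp add: vscale_def sum_distrib_left mult.left_commute)
    ultimately show ?thesis by simp
  qed
  moreover have "qpt \<in> PN N" by (rule pt_in_proj_of_nz[OF subspace_kvec w_kvec w_nz])
  ultimately have "qpt \<in> tangent_space N X (pt u)"
    unfolding tangent_space_def pt_def by auto
  then show ?thesis using uX by (auto simp: tangent_variety_def)
qed

text \<open>Some nontrivial combination \<open>s v1 + t v2\<close> has a double root on its line.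
  Unless it is a multiple of \<open>w\<close>, the root yields a tangent through \<open>q\<close>;
  so it is one, and this linear relation puts \<open>v2\<close> into the plane of \<open>v1\<close>
  and \<open>w\<close>.\<close>

lemma unique_line_if_not_tangent:
  assumes nt: "qpt \<notin> tangent_variety N X" and d2: "d \<ge> 2"
    and v1: "v1 \<in> V" "\<not> on_q v1" and v2: "v2 \<in> V" "\<not> on_q v2"
  shows "sp2 v1 w = sp2 v2 w"
proof -
  obtain s t x where stx: "s \<noteq> 0 \<or> t \<noteq> 0" "poly (lin G (lc s v1 t v2) w) x = 0"
    "poly (pderiv (lin G (lc s v1 t v2) w)) x = 0"
    using double_root_in_pencil[OF G_form G_w d2] by blast
  let ?v = "lc s v1 t v2"
  have vV: "?v \<in> V" by (rule subspace_lc[OF subspace_V v1(1) v2(1)])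
  have "on_q ?v"
  proof (rule ccontr)
    assume n: "\<not> on_q ?v"
    let ?u = "lc 1 ?v x w"
    have lu: "lin G ?u w = pcompose (lin G ?v w) [:x, 1:]"
      using lin_shift[of G ?v x w] by simp
    have "poly (lin G ?u w) 0 = 0" unfolding lu poly_pcompose using stx(2) by simp
    moreover have "poly (pderiv (lin G ?u w)) 0 = 0"
      unfolding lu pderiv_pcompose by (simp add: poly_pcompose stx(3))
    moreover have uV: "?u \<in> V" by (rule subspace_lc[OF subspace_V vV w_V])
    moreover have un: "\<not> on_q ?u" using n on_q_add_w by blast
    ultimately have "qpt \<in> tangent_variety N X"
      by (intro double_point_tangent[OF uV un]) (simp_all only: coeff_1_pderiv poly_0_coeff_0)
    then show False using nt by simp
  qed
  then obtain e where "?v = vscale e w" unfolding on_q_def by blast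
  then have e: "s * v1 j + t * v2 j = e * w j" for j by (simp add: vscale_def fun_eq_iff)
  have t0: "t \<noteq> 0"
  proof
    assume "t = 0"
    then have "v1 = vscale (e / s) w" using e stx(1) by (simp add: vscale_def fun_eq_iff field_simps)
    then show False using v1(2) on_q_vscale_w by simp
  qed
  have "v2 = lc (- (s / t)) v1 (e / t) w"
  proof
    fix j
    have "v2 j = (e * w j - s * v1 j) / t" using e[of j] t0 by (simp add: field_simps)
    then show "v2 j = - (s / t) * v1 j + e / t * w j" by (simp add: diff_divide_distrib)
  qed
  then have "v2 \<in> sp2 v1 w" by (metis sp2_I)
  from sp2_eqI[OF this v2(2)] show ?thesis ..
qed

end

section \<open>The projection from \<open>q\<close> and the image of the cone\<close>

locale secant_projection = secant_setup +
  fixes A :: "(nat \<Rightarrow> 'a) \<Rightarrow> (nat \<Rightarrow> 'a)"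
  assumes A: "proj_from N (pt w) A"
begin

lemma A_linear: "Vector_Spaces.linear vscale vscale A"
  using A by (simp add: proj_from_def)

lemma A_add: "A (a + b) = A a + A b" and A_diff: "A (a - b) = A a - A b" and A_scale: "A (vscale c a) = vscale c (A a)"
proof -
  interpret A: Vector_Spaces.linear vscale vscale A by (rule A_linear)
  show "A (a + b) = A a + A b" "A (a - b) = A a - A b" "A (vscale c a) = vscale c (A a)"
    by (rule A.add A.diff A.scale)+
qed

lemma A_eq_0_iff:
  assumes "v \<in> kvec N" shows "A v = (\<lambda>_. 0) \<longleftrightarrow> on_q v"
proof -
  have "{v \<in> kvec N. A v = (\<lambda>_. 0)} = insert (\<lambda>_. 0) (pt w)" using A by (simp add: proj_from_def)
  then have "A v = (\<lambda>_. 0) \<longleftrightarrow> v = (\<lambda>_. 0) \<or> v \<in> pt w" using assms by blast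
  also have "\<dots> \<longleftrightarrow> on_q v"
  proof
    assume "v = (\<lambda>_. 0) \<or> v \<in> pt w"
    then show "on_q v" using on_q_vscale_w by (auto simp: pt_def on_q_def vscale_def w_i0)
  next
    assume "on_q v"
    then show "v = (\<lambda>_. 0) \<or> v \<in> pt w" using on_q_pt pt_self by metis
  qed
  finally show ?thesis .
qed

lemma A_lc: "A (lc s v t w) = vscale s (A v)"
proof -
  have "A w = (\<lambda>_. 0)" using A_eq_0_iff[OF w_kvec] on_q_vscale_w[of 1] by (simp add: vscale_def)
  then have "vscale s (A v) + vscale t (A w) = vscale s (A v)" by (simp add: vscale_def plus_fun_def)
  then show ?thesis unfolding lc_vec A_add A_scale .
qed

lemma pmap_pt: "pmap A (pt v) = pt (A v)"
proof -
  have "pmap A (pt v) = {A (vscale c v) | c. c \<noteq> 0}" by (auto simp: pmap_def pt_def)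
  then show ?thesis by (simp add: A_scale pt_def)
qed

text \<open>The kernel of \<open>A\<close> consists of the multiples of \<open>w\<close>, so
  \<open>A u\<close> is a multiple of \<open>A v\<close> exactly when \<open>u\<close> is a
  combination of \<open>v\<close> and \<open>w\<close>.\<close>

lemma line_over_pt:
  assumes v: "v \<in> kvec N" "\<not> on_q v"
  shows "line_over N (pt w) A (pmap A (pt v)) = proj_of (sp2 v w)"
proof -
  have key: "(pt u = pt w \<or> pmap A (pt u) = pmap A (pt v)) \<longleftrightarrow> u \<in> sp2 v w"
    if u: "u \<in> kvec N" "u \<noteq> (\<lambda>_. 0)" for u
  proof
    assume "pt u = pt w \<or> pmap A (pt u) = pmap A (pt v)"
    then show "u \<in> sp2 v w"
    proof
      assume "pt u = pt w"
      then obtain c where "u = vscale c w" unfolding pt_eq_iff by blast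
      then show ?thesis using sp2_I[of 0 v c w] by (simp add: vscale_def)
    next
      assume "pmap A (pt u) = pmap A (pt v)"
      then obtain c where c: "A u = vscale c (A v)" unfolding pmap_pt pt_eq_iff by blast
      have k: "u - vscale c v \<in> kvec N"
        using u(1) v(1) by (intro kv.subspace_diff[OF subspace_kvec] kv.subspace_scale[OF subspace_kvec])
      have "A (u - vscale c v) = (\<lambda>_. 0)" by (simp add: A_diff A_scale c zero_fun_def)
      then obtain e where "u - vscale c v = vscale e w" using A_eq_0_iff[OF k] unfolding on_q_def by blast
      then have "u = vscale c v + vscale e w" by (metis diff_add_cancel add.commute)
      then show ?thesis using sp2_I[of c v e w] by (simp add: lc_vec)
    qed
  next
    assume "u \<in> sp2 v w"
    then obtain s t where st: "u = lc s v t w" by (auto simp: sp2_def)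
    show "pt u = pt w \<or> pmap A (pt u) = pmap A (pt v)"
    proof (cases "s = 0")
      case True
      then have "u = vscale t w" by (simp add: st vscale_def)
      then show ?thesis using u(2) on_q_pt on_q_vscale_w by blast
    next
      case False
      have "A u = vscale s (A v)" unfolding st by (rule A_lc)
      then show ?thesis using False by (auto simp: pmap_pt pt_vscale)
    qed
  qed
  show ?thesis
  proof (intro equalityI subsetI)
    fix p assume p: "p \<in> line_over N (pt w) A (pmap A (pt v))"
    then obtain u where u: "u \<in> kvec N" "u \<noteq> (\<lambda>_. 0)" "p = pt u" by (auto simp: line_over_def elim: PN_E)
    then have "u \<in> sp2 v w" using p key[OF u(1,2)] by (auto simp: line_over_def)
    then show "p \<in> proj_of (sp2 v w)" using u pt_in_proj_of_nz[OF subspace_sp2] by blast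
  next
    fix p assume "p \<in> proj_of (sp2 v w)"
    then obtain u where u: "u \<in> sp2 v w" "u \<noteq> (\<lambda>_. 0)" "p = pt u" by (auto simp: proj_of_pt)
    moreover have uk: "u \<in> kvec N" using sp2_subset[OF subspace_kvec v(1) w_kvec] u(1) by blast
    ultimately show "p \<in> line_over N (pt w) A (pmap A (pt v))"
      using key[OF uk u(2)] pt_in_proj_of_nz[OF subspace_kvec uk u(2)] by (simp add: line_over_def)
  qed
qed

lemma secant_locus_eq: "secant_locus N X (pt w) A d = \<Sigma>"
proof (intro equalityI subsetI)
  fix p assume p: "p \<in> secant_locus N X (pt w) A d"
  then have "p \<in> X" by (simp add: secant_locus_def)
  then obtain v where v: "v \<in> kvec N" "\<not> on_q v" "p = pt v" by (rule X_E)
  have "scheme_length N (J v) d" using p line_over_pt[OF v(1,2)] v(3) by (simp add: secant_locus_def)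
  then have "v \<in> V" using in_V_if_scheme_length v by blast
  then show "p \<in> \<Sigma>" using v \<open>p \<in> X\<close> pt_in_proj_of_nz[OF subspace_V _ not_on_q_nz] by blast
next
  fix p assume p: "p \<in> \<Sigma>"
  then obtain v where v: "v \<in> V" "\<not> on_q v" "p = pt v" by (rule Sigma_E)
  then show "p \<in> secant_locus N X (pt w) A d"
    using p line_over_pt[of v] scheme_length_if_in_V[of v] V_kvec by (auto simp: secant_locus_def)
qed

abbreviation Z :: "'a ppoint set" where "Z \<equiv> pmap A ` \<Sigma>"

lemma pmap_add_w: "pmap A (pt (lc 1 v x w)) = pmap A (pt v)"
proof -
  have "A (lc 1 v x w) = A v" unfolding A_lc by (simp add: vscale_def)
  then show ?thesis unfolding pmap_pt by (rule arg_cong)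
qed

text \<open>Every line of the cone carries a point of \<open>\<Sigma>\<close>, and adding multiples
  of \<open>w\<close> does not change the image.\<close>

lemma Z_eq: "Z = {pmap A (pt v) | v. v \<in> V \<and> \<not> on_q v}"
proof (intro equalityI subsetI)
  fix y assume "y \<in> Z"
  then obtain p where "p \<in> \<Sigma>" "y = pmap A p" by blast
  moreover obtain v where "v \<in> V" "\<not> on_q v" "p = pt v" by (rule Sigma_E[OF \<open>p \<in> \<Sigma>\<close>])
  ultimately show "y \<in> {pmap A (pt v) | v. v \<in> V \<and> \<not> on_q v}" by blast
next
  fix y assume "y \<in> {pmap A (pt v) | v. v \<in> V \<and> \<not> on_q v}"
  then obtain v where v: "v \<in> V" "\<not> on_q v" "y = pmap A (pt v)" by blast
  obtain x where "pt (lc 1 v x w) \<in> \<Sigma>" using point_of_Sigma_on_line[OF v(1,2)] .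
  then show "y \<in> Z" unfolding v(3) pmap_add_w[of v x, symmetric] by (rule imageI)
qed

lemma lin_subspace_Z: "lin_subspace (N - 1) Z"
proof -
  interpret A: Vector_Spaces.linear vscale vscale A by (rule A_linear)
  have "kv.subspace (A ` V)" by (rule A.subspace_image[OF subspace_V])
  moreover have "A ` V \<subseteq> kvec (N - 1)" using A V_kvec by (auto simp: proj_from_def)
  moreover have "Z = proj_of (A ` V)"
  proof -
    have "A v = (\<lambda>_. 0) \<longleftrightarrow> on_q v" if "v \<in> V" for v using A_eq_0_iff that V_kvec by blast
    then have "{pmap A (pt v) | v. v \<in> V \<and> \<not> on_q v} = proj_of (A ` V)"
      unfolding proj_of_pt pmap_pt by blast
    with Z_eq show ?thesis by (rule trans)
  qed
  ultimately show ?thesis unfolding lin_subspace_def by blast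
qed

text \<open>A point of \<open>Z\<close> is recovered from its line: the line contains a point of
  \<open>X\<close> above it, which differs from \<open>q\<close>.\<close>

lemma bij_Z: "bij_betw (line_over N (pt w) A) Z {l. is_secant_line N X (pt w) d l}"
  unfolding bij_betw_def
proof
  show "inj_on (line_over N (pt w) A) Z"
  proof (rule inj_onI)
    fix y y' assume y: "y \<in> Z" "y' \<in> Z" and eq: "line_over N (pt w) A y = line_over N (pt w) A y'"
    then obtain p where p: "p \<in> X" "y = pmap A p" by blast
    then have "p \<in> line_over N (pt w) A y" using X_PN by (auto simp: line_over_def)
    then have "p = pt w \<or> pmap A p = y'" unfolding eq by (simp add: line_over_def)
    then show "y = y'" using p q_notin_X by blast
  qed
  have "line_over N (pt w) A ` Z = {proj_of (sp2 v w) | v. v \<in> V \<and> \<not> on_q v}"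
    unfolding Z_eq using line_over_pt V_kvec by (force simp: image_iff)
  then show "line_over N (pt w) A ` Z = {l. is_secant_line N X (pt w) d l}"
    unfolding secant_line_iff by auto
qed

end

section \<open>The form \<open>G\<close> and the conclusion\<close>

text \<open>Above degree \<open>d\<close>, \<open>f\<close> is a combination of elements of
  \<open>I\<close> of lower degree, and one of these is nonzero at \<open>w\<close> too. Below
  \<open>d\<close>, powers of \<open>x0\<close> raise the degree without changing the value at
  \<open>w\<close>.\<close>

lemma (in betti_ideal) normalized_form_of_degree_d:
  assumes "f \<in> I" "is_form N m f" "peval f w \<noteq> 0"
  shows "\<exists>G\<in>I. is_form N d G \<and> peval G w = 1"
  using assms
proof (induction m arbitrary: f rule: less_induct)
  case (less m)
  show ?case
  proof (cases "m \<le> d")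
    case True
    let ?G = "pscale (1 / peval f w) (x0 ^ (d - m) * f)"
    have "is_form N (d - m + m) (x0 ^ (d - m) * f)"
      using is_form_mult[OF is_form_power[OF is_form_pvar[OF i0], of "d - m"] less.prems(2)] by simp
    then have "is_form N d ?G" using True by (intro is_form_scale) simp
    moreover have "x0 ^ (d - m) * f \<in> I" by (rule I_mult) (use i0 less.prems in auto)
    ultimately show ?thesis using less.prems(3) I_scale w_i0 by (intro bexI[of _ ?G]) auto
  next
    case False
    then have "m > d" by simp
    from generated_in_degree_le[OF less.prems(1,2) this]
    obtain g where g0: "\<forall>j. g j \<in> I \<and> is_form N (m - 1) (g j)" and g3: "f = (\<Sum>j\<le>N. pvar j * g j)"
      by (elim exE conjE)
    have g: "g j \<in> I" "is_form N (m - 1) (g j)" for j using g0 by blast+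
    have "\<exists>j. peval (g j) w \<noteq> 0"
    proof (rule ccontr)
      assume "\<not> ?thesis"
      then have "peval f w = 0" by (simp add: g3 peval_sum)
      then show False using less.prems(3) by simp
    qed
    then show ?thesis using less.IH[OF _ g(1,2)] \<open>m > d\<close> by auto
  qed
qed

lemma lin_span_subset_PN: "S \<subseteq> PN N \<Longrightarrow> lin_span N S \<subseteq> PN N"
  unfolding lin_span_def lin_subspace_def using subspace_kvec by (intro Inter_lower) blast

lemma secant_variety_subset_PN:
  assumes "X \<subseteq> PN N" shows "secant_variety N X \<subseteq> PN N"
proof -
  have "zclosed N (PN N)" unfolding zclosed_def by (intro exI[of _ "{}"]) (simp add: zero_locus_def)
  moreover have "\<Union> {lin_span N {x, y} | x y. x \<in> X \<and> y \<in> X \<and> x \<noteq> y} \<subseteq> PN N"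
  proof (rule Union_least)
    fix L assume "L \<in> {lin_span N {x, y} | x y. x \<in> X \<and> y \<in> X \<and> x \<noteq> y}"
    then obtain x y where "L = lin_span N {x, y}" "x \<in> X" "y \<in> X" by blast
    then show "L \<subseteq> PN N" using lin_span_subset_PN[of "{x, y}" N] assms by auto
  qed
  ultimately show ?thesis unfolding secant_variety_def zclosure_def by (intro Inter_lower) simp
qed

theorem theorem3p3:
  fixes X :: "('k::alg_closed_field) ppoint set"
    and q :: "'k ppoint"
    and A :: "(nat \<Rightarrow> 'k) \<Rightarrow> (nat \<Rightarrow> 'k)"
    and n e d :: nat
  assumes "irreducible_closed (n + e) X"
    and "has_dim (n + e) X n"
    and "nondegenerate (n + e) X"
    and "2 \<le> d"
    and "property_N (n + e) X d 2"
    and "q \<in> (secant_variety (n + e) X \<union> tangent_variety (n + e) X) - X"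
    and "proj_from (n + e) q A"
  defines "\<Sigma> \<equiv> secant_locus (n + e) X q A d"
    and "Z \<equiv> pmap A ` secant_locus (n + e) X q A d"
  shows "(\<Sigma> = {} \<or>
           (let \<Lambda> = lin_span (n + e) (insert q \<Sigma>)
            in is_hypersurface (n + e) d \<Lambda> \<Sigma> (inter_ideal (n + e) X \<Lambda>))) \<and>
         ((Z = {} \<or> lin_subspace (n + e - 1) Z \<and> Z \<subseteq> pmap A ` X) \<and>
          bij_betw (line_over (n + e) q A) Z {l. is_secant_line (n + e) X q d l}) \<and>
         (q \<in> secant_variety (n + e) X - (tangent_variety (n + e) X \<union> X) \<and> Z \<noteq> {} \<longrightarrow>
          (\<exists>!l. is_secant_line (n + e) X q d l))"
proof -
  define N where "N = n + e"
  obtain S where S: "\<forall>f\<in>S. \<exists>m. is_form N m f" "X = zero_locus N S"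
    using assms(1) by (auto simp: irreducible_closed_def zclosed_def N_def)
  have X_PN: "X \<subseteq> PN N" unfolding S(2) by (auto simp: zero_locus_def)
  have X_zeros: "p \<in> X" if p: "p \<in> PN N" "\<And>f m v. f \<in> hideal N X \<Longrightarrow> is_form N m f \<Longrightarrow> v \<in> p \<Longrightarrow> peval f v = 0" for p
  proof -
    have "peval f v = 0" if f: "f \<in> S" and v: "v \<in> p" for f v
    proof -
      obtain m where m: "is_form N m f" using S(1) f by blast
      have "f \<in> hideal N X" unfolding form_in_hideal[OF m] using f by (auto simp: S(2) zero_locus_def)
      then show ?thesis using p(2) m v by blast
    qed
    then show ?thesis using p(1) by (auto simp: S(2) zero_locus_def)
  qed
  have "tangent_variety N X \<subseteq> PN N" by (auto simp: tangent_variety_def tangent_space_def)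
  then have qPN: "q \<in> PN N" and qX: "q \<notin> X"
    using assms(6) secant_variety_subset_PN[OF X_PN] by (auto simp: N_def)
  obtain w0 where w0: "w0 \<in> kvec N" "w0 \<noteq> (\<lambda>_. 0)" "q = pt w0" using qPN by (rule PN_E)
  obtain i0 where i0: "w0 i0 \<noteq> 0" using w0(2) by blast
  have i0N: "i0 \<le> N" using w0(1) i0 by (auto simp: kvec_def not_less[symmetric])
  \<comment> \<open>Scaled so that the coordinate \<open>i0\<close> is 1, hence \<open>x0\<close>
    has value 1 at \<open>w\<close>.\<close>
  define w where "w = vscale (1 / w0 i0) w0"
  have wq: "q = pt w" unfolding w_def using i0 w0(3) by (simp add: pt_vscale)
  have wk: "w \<in> kvec N" unfolding w_def by (rule kv.subspace_scale[OF subspace_kvec w0(1)])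
  have w1: "w i0 = 1" using i0 by (simp add: w_def vscale_def)
  \<comment> \<open>The resolution to which \<open>has_betti\<close> refers, since the vanishing is
    assumed for this one.\<close>
  define F where "F = resolution_of N (hideal N X)"
  interpret I: hom_ideal N "hideal N X" by (rule hom_ideal_hideal)
  have F: "graded_free_resolution N (hideal N X) F"
    unfolding F_def resolution_of_def
    by (rule someI_ex, rule graded_free_resolution_exists)
      (auto intro: I.I_polys I.I_0 I.I_add I.I_mult I.I_hom)
  have betti: "quot_dim vscale (fib_ker F i (i + j)) (fib_map F i ` fib F (Suc i) (i + j)) 0"
    if "i \<le> 2" "j \<ge> d" for i j
    using assms(5) that by (auto simp: property_N_def has_betti_def F_def N_def Let_def)
  have proper: "1 \<notin> hideal N X"
  proof
    assume 1: "1 \<in> hideal N X"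
    obtain p where p: "p \<in> X" using assms(1) by (auto simp: irreducible_closed_def)
    have "p \<in> PN N" using p X_PN by blast
    then obtain v where v: "p = pt v" by (rule PN_E)
    have "peval 1 v = (0::'k)" by (rule hideal_peval[OF 1 p]) (simp add: v)
    then show False by simp
  qed
  interpret B: betti_ideal N "hideal N X" F w i0 d
  proof unfold_locales
    show "quot_dim vscale (fib_ker F (Suc 0) a) (fib_map F (Suc 0) ` fib F (Suc (Suc 0)) a) 0" if "a > d" for a
      using betti[of "Suc 0" "a - 1"] that by simp
    show "quot_dim vscale (fib_ker F (Suc (Suc 0)) a) (fib_map F (Suc (Suc 0)) ` fib F (Suc (Suc (Suc 0))) a) 0"
      if ad: "a > Suc d" for a
    proof -
      obtain j where "a = Suc (Suc 0) + j" "j \<ge> d"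
        using ad le_Suc_ex[of "Suc (Suc 0)" a] by auto
      then show ?thesis using betti[of "Suc (Suc 0)" j] by simp
    qed
  qed (use F i0N w1 proper assms(4) in auto)
  \<comment> \<open>\<open>q\<close> lies off the closed set \<open>X\<close>, so some form in the
    ideal is nonzero at \<open>w\<close>.\<close>
  have "\<exists>f m. f \<in> hideal N X \<and> is_form N m f \<and> peval f w \<noteq> 0"
  proof (rule ccontr)
    assume neg: "\<not> ?thesis"
    have "pt w \<in> X"
    proof (rule X_zeros)
      fix f m v assume "f \<in> hideal N X" "is_form N m f" "v \<in> pt w"
      then show "peval f v = 0" using neg peval_form_pt[of N m f w] by blast
    qed (use qPN wq in simp)
    then show False using qX wq by simp
  qed
  then obtain G where G: "G \<in> hideal N X" "is_form N d G" "peval G w = 1"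
    using B.normalized_form_of_degree_d by blast
  interpret P: secant_projection N X F w i0 d G A
    by unfold_locales (use X_PN X_zeros wk G assms(7) wq in \<open>auto simp: N_def\<close>)
  have \<Sigma>: "\<Sigma> = X \<inter> proj_of P.V" using P.secant_locus_eq by (simp add: \<Sigma>_def N_def wq)
  have Z: "Z = pmap A ` (X \<inter> proj_of P.V)" using \<Sigma> by (simp add: Z_def \<Sigma>_def)
  have "\<Sigma> = {} \<or> (let \<Lambda> = lin_span N (insert q \<Sigma>) in is_hypersurface N d \<Lambda> \<Sigma> (inter_ideal N X \<Lambda>))"
  proof (cases "\<Sigma> = {}")
    case False
    then show ?thesis
      using P.lin_span_Sigma P.hypersurface_Sigma unfolding \<Sigma> wq Let_def by simp
  qed simp
  moreover have "Z = {} \<or> lin_subspace (N - 1) Z \<and> Z \<subseteq> pmap A ` X"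
    using P.lin_subspace_Z unfolding Z by blast
  moreover have "bij_betw (line_over N q A) Z {l. is_secant_line N X q d l}"
    using P.bij_Z unfolding Z wq by simp
  moreover have "\<exists>!l. is_secant_line N X q d l"
    if nt: "q \<in> secant_variety N X - (tangent_variety N X \<union> X)" and ne: "Z \<noteq> {}"
  proof -
    obtain v where v: "v \<in> P.V" "\<not> P.on_q v"
      using ne P.Sigma_nonempty_iff unfolding Z by auto
    show ?thesis
    proof (rule ex1I)
      show "is_secant_line N X q d (proj_of (sp2 v w))" unfolding wq P.secant_line_iff using v by blast
      fix l assume "is_secant_line N X q d l"
      then obtain u where u: "u \<in> P.V" "\<not> P.on_q u" "l = proj_of (sp2 u w)"
        unfolding wq P.secant_line_iff by blast
      have "sp2 u w = sp2 v w"
        using nt assms(4) u v unfolding wq by (intro P.unique_line_if_not_tangent) auto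
      then show "l = proj_of (sp2 v w)" using u(3) by simp
    qed
  qed
  ultimately show ?thesis unfolding N_def[symmetric] by blast
qed

end
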